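(* Let $\{\Sigma_a\}_{a>1/2}$ be the Mori family of rotational free boundary minimal annuli in geodesic balls $B(r(a))\subset\mathbb{H}^3$ defined in the context, with $K(a)=(a^2-\tfrac14)^{1/2}$. By a previously established result on this family, the function $H(a)=\sinh r(a)/K(a)$ is strictly increasing on a right neighbourhood of $\tfrac12$. Consequently there exists $\delta_0>0$ such that $r'(a)>0$ for every $a\in(\tfrac12,\tfrac12+\delta_0)$; on that range the Mori family carries no parametric degeneration, that is, $\varphi_a\notin\mathcal{K}(\Sigma_a,r(a))$, and $$\dim\mathcal{K}_0^{\mathrm{ev}}(\Sigma_a)=0\qquad\text{for every }a\in\bigl(\tfrac12,\tfrac12+\delta_0\bigr).$$
   Context: In Fermi coordinates about a geodesic axis the metric of $\mathbb{H}^3$ is $du^2+\cosh^2u\,dt^2+\sinh^2u\,d\theta^2$, where $u$ is the distance from the axis, $t$ the arclength along it, $\theta$ the rotation angle; $p_0$ is the point $u=t=0$, $\rho=\operatorname{dist}(p_0,\cdot)$, $\cosh\rho=\cosh u\cosh t$, and $B(r)$ is the closed geodesic ball of radius $r$ centred at $p_0$. The Mori family. For $a>\tfrac12$ let $K=K(a)=(a^2-\tfrac14)^{1/2}$ and $B_0=a-\tfrac12$. The profile, parametrized by arclength $s\in\mathbb{R}$, is $s\mapsto(u(s),t(s))$ with $b=\sinh u$, where $b$ is the even solution of $\ddot b=b+K^2b^{-3}$, $b(0)=B_0^{1/2}$, $\dot b(0)=0$ (so that $\dot b^2=1+b^2-K^2/b^2$), and $t$ is the odd function with $t(0)=0$,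 $b(1+b^2)\dot t=K$. Rotating it about the axis gives a minimal surface with induced metric $ds^2+b^2d\theta^2$. Let $s_0(a)>0$ be the free boundary parameter, i.e. the (unique) $s>0$ at which the profile is orthogonal to the level sets of $\rho$, which reads $\dot b\sinh t=K\cosh t$. $\Sigma_a$ is the part $s\in[-s_0(a),s_0(a)]$; it is a free boundary minimal annulus in $B(r(a))$ with $\cosh r(a)=\cosh u(s_0(a))\cosh t(s_0(a))$ (its outward unit conormal $\eta$ equals $\partial_\rho$ on the boundary). Parametric field. Let $\Psi_a(\tau,\theta)$, $\tau\in[-1,1]$, be the point of $\Sigma_a$ with profile parameter $s=s_0(a)\tau$ and rotation angle $\theta$; $\varphi_a=\langle\partial_a\Psi_a,\nu_a\rangle$, with unit normals $\nu_a$ chosen smoothly in $a$. Kernel. $\mathcal{K}(\Sigma_a,r(a))=\{u\in C^\infty(\Sigma_a):\Delta u+(|A|^2-2)u=0\text{ on }\Sigma_a,\ \partial_\eta u-\coth(r(a))u=0\text{ on }\partial\Sigma_a\}$, where $A$ is the second fundamental form of $\Sigma_a$, and $\mathcal{K}_0^{\mathrm{ev}}(\Sigma_a)$ is its subspace of functions independent of $\theta$ and even in $s$. *)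

theory Defs
  imports "HOL-Analysis.Analysis" "HOL-Library.Function_Algebras"
begin

section \<open>Smooth functions and partial derivatives\<close>

text \<open>\<open>S\<close> is meant to be open.\<close>

primrec Ck_on :: "nat \<Rightarrow> 'a::euclidean_space set \<Rightarrow> ('a \<Rightarrow> 'b::euclidean_space) \<Rightarrow> bool" where
  "Ck_on 0 S f \<longleftrightarrow> continuous_on S f"
| "Ck_on (Suc k) S f \<longleftrightarrow>
    (\<exists>f'. (\<forall>x\<in>S. (f has_derivative f' x) (at x)) \<and> (\<forall>v. Ck_on k S (\<lambda>x. f' x v)))"

definition smooth_on :: "'a::euclidean_space set \<Rightarrow> ('a \<Rightarrow> 'b::euclidean_space) \<Rightarrow> bool" where
  "smooth_on S f \<longleftrightarrow> (\<forall>k. Ck_on k S f)"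

definition partial :: "'n::finite \<Rightarrow> (real^'n \<Rightarrow> 'b::real_normed_vector) \<Rightarrow> real^'n \<Rightarrow> 'b" where
  "partial i f x = vector_derivative (\<lambda>h. f (x + h *\<^sub>R axis i 1)) (at 0)"


section \<open>Hyperbolic space in Fermi coordinates\<close>

text \<open>A point of \<open>\<H>\<^sup>3\<close> off the axis is represented by its Fermi coordinates
  \<open>vector [u, t, \<theta>]\<close>, \<open>u > 0\<close>, and a tangent vector by its components in the coordinate frame.\<close>

definition fermi_metric :: "real^3 \<Rightarrow> real^3^3" where
  "fermi_metric p = (\<chi> i j. if i \<noteq> j then 0
     else if i = 1 then 1
     else if i = 2 then (cosh (p $ 1))\<^sup>2
     else (sinh (p $ 1))\<^sup>2)"

definition hyp_inner :: "real^3 \<Rightarrow> real^3 \<Rightarrow> real^3 \<Rightarrow> real" where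
  "hyp_inner p v w = (\<Sum>i\<in>UNIV. \<Sum>j\<in>UNIV. fermi_metric p $ i $ j * v $ i * w $ j)"

text \<open>Christoffel symbols of the first kind, \<open>\<Gamma>\<^sub>i\<^sub>j\<^sub>,\<^sub>k = \<langle>\<nabla>\<^sub>i \<partial>\<^sub>j, \<partial>\<^sub>k\<rangle>\<close>.\<close>

definition christoffel :: "real^3 \<Rightarrow> 3 \<Rightarrow> 3 \<Rightarrow> 3 \<Rightarrow> real" where
  "christoffel p i j k =
     (partial i (\<lambda>q. fermi_metric q $ j $ k) p
      + partial j (\<lambda>q. fermi_metric q $ i $ k) p
      - partial k (\<lambda>q. fermi_metric q $ i $ j) p) / 2"

text \<open>The distance from \<open>p\<^sub>0\<close>, the point \<open>u = t = 0\<close>.\<close>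

definition dist_p0 :: "real^3 \<Rightarrow> real" where
  "dist_p0 p = arcosh (cosh (p $ 1) * cosh (p $ 2))"


section \<open>Geometry of a parametrized surface\<close>

definition first_form :: "(real^2 \<Rightarrow> real^3) \<Rightarrow> real^2 \<Rightarrow> real^2^2" where
  "first_form X x = (\<chi> i j. hyp_inner (X x) (partial i X x) (partial j X x))"

definition is_unit_normal :: "(real^2 \<Rightarrow> real^3) \<Rightarrow> real^2 \<Rightarrow> real^3 \<Rightarrow> bool" where
  "is_unit_normal X x N \<longleftrightarrow>
     hyp_inner (X x) N N = 1 \<and> (\<forall>i. hyp_inner (X x) N (partial i X x) = 0)"

text \<open>The coefficients \<open>\<langle>\<nabla>\<^sub>i \<partial>\<^sub>j X, N\<rangle>\<close>, \<open>\<nabla>\<close> being the Levi-Civita connection of \<open>\<H>\<^sup>3\<close>.\<close>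

definition second_form :: "(real^2 \<Rightarrow> real^3) \<Rightarrow> real^2 \<Rightarrow> real^3 \<Rightarrow> real^2^2" where
  "second_form X x N = (\<chi> i j.
     hyp_inner (X x) (partial i (partial j X) x) N
     + (\<Sum>l\<in>UNIV. \<Sum>m\<in>UNIV. \<Sum>k\<in>UNIV.
          christoffel (X x) l m k * partial i X x $ l * partial j X x $ m * N $ k))"

text \<open>\<open>|A|\<^sup>2\<close> is the trace of the squared shape operator; both choices of the unit normal
  give the same value.\<close>

definition normA_sq :: "(real^2 \<Rightarrow> real^3) \<Rightarrow> real^2 \<Rightarrow> real" where
  "normA_sq X x =
     (let S = matrix_inv (first_form X x) ** second_form X x (SOME N. is_unit_normal X x N)
      in trace (S ** S))"

definition laplace_beltrami :: "(real^2 \<Rightarrow> real^3) \<Rightarrow> (real^2 \<Rightarrow> real) \<Rightarrow> real^2 \<Rightarrow> real" where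
  "laplace_beltrami X f x =
     (\<Sum>i\<in>UNIV. partial i (\<lambda>y. sqrt (det (first_form X y)) *
          (\<Sum>j\<in>UNIV. matrix_inv (first_form X y) $ i $ j * partial j f y)) x)
     / sqrt (det (first_form X x))"

text \<open>The derivative along the outward unit conormal of the band \<open>{x. \<bar>x $ 1\<bar> \<le> c}\<close>, \<open>c > 0\<close>, at a
  boundary point \<open>x $ 1 = \<plusminus>c\<close>: the conormal is the normalized gradient of the coordinate \<open>x $ 1\<close>
  with the sign of \<open>x $ 1\<close>.\<close>

definition conormal_deriv :: "(real^2 \<Rightarrow> real^3) \<Rightarrow> (real^2 \<Rightarrow> real) \<Rightarrow> real^2 \<Rightarrow> real" where
  "conormal_deriv X f x =
     sgn (x $ 1) * (\<Sum>i\<in>UNIV. matrix_inv (first_form X x) $ 1 $ i * partial i f x)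
     / sqrt (matrix_inv (first_form X x) $ 1 $ 1)"


section \<open>The Mori family\<close>

definition mori_K :: "real \<Rightarrow> real" where
  "mori_K a = sqrt (a\<^sup>2 - 1/4)"

definition mori_b :: "real \<Rightarrow> real \<Rightarrow> real" where
  "mori_b a = (THE b. (\<forall>s. b s > 0) \<and> (\<forall>s. b (- s) = b s) \<and> b 0 = sqrt (a - 1/2) \<and>
     (\<exists>b'. b' 0 = 0 \<and> (\<forall>s. (b has_real_derivative b' s) (at s) \<and>
        (b' has_real_derivative (b s + (mori_K a)\<^sup>2 / (b s) ^ 3)) (at s))))"

definition mori_u :: "real \<Rightarrow> real \<Rightarrow> real" where
  "mori_u a s = arsinh (mori_b a s)"

definition mori_t :: "real \<Rightarrow> real \<Rightarrow> real" where
  "mori_t a = (THE t. t 0 = 0 \<and> (\<forall>s. t (- s) = - t s) \<and>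
     (\<exists>t'. \<forall>s. (t has_real_derivative t' s) (at s) \<and>
        mori_b a s * (1 + (mori_b a s)\<^sup>2) * t' s = mori_K a))"

text \<open>The complete rotational surface in the parameters \<open>vector [s, \<theta>]\<close>; it is \<open>2\<pi>\<close>-periodic in
  \<open>\<theta>\<close> as a map to \<open>\<H>\<^sup>3\<close>.\<close>

definition mori_surface :: "real \<Rightarrow> real^2 \<Rightarrow> real^3" where
  "mori_surface a x = vector [mori_u a (x $ 1), mori_t a (x $ 1), x $ 2]"

definition mori_s0 :: "real \<Rightarrow> real" where
  "mori_s0 a = (THE s. s > 0 \<and>
     deriv (mori_b a) s * sinh (mori_t a s) = mori_K a * cosh (mori_t a s))"

definition mori_r :: "real \<Rightarrow> real" where
  "mori_r a = dist_p0 (mori_surface a (vector [mori_s0 a, 0]))"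

definition mori_H :: "real \<Rightarrow> real" where
  "mori_H a = sinh (mori_r a) / mori_K a"

definition mori_band :: "real \<Rightarrow> (real^2) set" where
  "mori_band a = {x. \<bar>x $ 1\<bar> \<le> mori_s0 a}"

definition mori_Psi :: "real \<Rightarrow> real \<Rightarrow> real \<Rightarrow> real^3" where
  "mori_Psi a \<tau> \<theta> = mori_surface a (vector [mori_s0 a * \<tau>, \<theta>])"

text \<open>A choice of unit normals, smooth in \<open>a\<close> and along the surfaces. A smooth choice along
  \<open>\<Sigma>\<^sub>a\<close> extends to the complete surface, so it is taken there.\<close>

definition unit_normal_family :: "(real \<Rightarrow> real^2 \<Rightarrow> real^3) \<Rightarrow> bool" where
  "unit_normal_family \<nu> \<longleftrightarrow>
     (\<forall>a>1/2. \<forall>x. is_unit_normal (mori_surface a) x (\<nu> a x)) \<and>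
     smooth_on ({1/2<..} \<times> UNIV) (\<lambda>(a, x). \<nu> a x)"

text \<open>Functions on \<open>\<Sigma>\<^sub>a\<close> are represented in the parameters \<open>vector [s, \<theta>]\<close>, that is, as functions
  on the band \<open>\<bar>s\<bar> \<le> s\<^sub>0(a)\<close> which are \<open>2\<pi>\<close>-periodic in \<open>\<theta>\<close>; so that each function on \<open>\<Sigma>\<^sub>a\<close> has exactly
  one representative, the value outside the band is set to 0.\<close>

definition parametric_field :: "(real \<Rightarrow> real^2 \<Rightarrow> real^3) \<Rightarrow> real \<Rightarrow> real^2 \<Rightarrow> real" where
  "parametric_field \<nu> a x =
     (if x \<in> mori_band a
      then hyp_inner (mori_surface a x)
        (vector_derivative (\<lambda>\<alpha>. mori_Psi \<alpha> (x $ 1 / mori_s0 a) (x $ 2)) (at a)) (\<nu> a x)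
      else 0)"

text \<open>Smoothness up to the boundary means that there is a smooth extension \<open>F\<close> to the plane. The
  derivatives of \<open>F\<close> on the closed band depend only on the given function.\<close>

definition jacobi_kernel :: "real \<Rightarrow> real \<Rightarrow> (real^2 \<Rightarrow> real) set" where
  "jacobi_kernel a r = {f.
     (\<forall>x. x \<notin> mori_band a \<longrightarrow> f x = 0) \<and>
     (\<forall>x. f (x + (2 * pi) *\<^sub>R axis 2 1) = f x) \<and>
     (\<exists>F. smooth_on UNIV F \<and> (\<forall>x\<in>mori_band a. f x = F x) \<and>
        (\<forall>x\<in>mori_band a. laplace_beltrami (mori_surface a) F x
            + (normA_sq (mori_surface a) x - 2) * F x = 0) \<and>
        (\<forall>x. \<bar>x $ 1\<bar> = mori_s0 a \<longrightarrow>
            conormal_deriv (mori_surface a) F x - cosh r / sinh r * F x = 0))}"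

definition jacobi_kernel_0_ev :: "real \<Rightarrow> (real^2 \<Rightarrow> real) set" where
  "jacobi_kernel_0_ev a = {f \<in> jacobi_kernel a (mori_r a).
     (\<forall>s \<theta> \<theta>'. f (vector [s, \<theta>]) = f (vector [s, \<theta>'])) \<and>
     (\<forall>s \<theta>. f (vector [- s, \<theta>]) = f (vector [s, \<theta>]))}"


section \<open>Dimension of spaces of functions\<close>

interpretation fun_space: vector_space "\<lambda>(c::real) (f :: real^2 \<Rightarrow> real) x. c * f x"
  by standard (auto simp: fun_eq_iff algebra_simps)

text \<open>The library's \<open>fun_space.dim\<close> is 0 also for infinite-dimensional spaces; here the dimension
  is asserted through a finite basis.\<close>

definition has_dimension :: "(real^2 \<Rightarrow> real) set \<Rightarrow> nat \<Rightarrow> bool" where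
  "has_dimension V n \<longleftrightarrow>
     (\<exists>B. finite B \<and> card B = n \<and> fun_space.independent B \<and> fun_space.span B = V)"

end

theory Submission
  imports Defs "HOL-Real_Asymp.Real_Asymp"
begin

text \<open>Write \<open>b\<close>, \<open>t\<close> for the profile functions and \<open>B = a - 1/2\<close>. The energy integral
\<open>b'\<^sup>2 = 1 + b\<^sup>2 - K\<^sup>2/b\<^sup>2\<close> makes the equation for \<open>b\<^sup>2\<close> linear, hence \<open>b\<^sup>2 = a cosh 2s - 1/2\<close>, while \<open>t\<close> is an
elliptic integral, accessible only as a primitive of \<open>K/(b(1 + b\<^sup>2))\<close>. Everything therefore rests on
differentiating primitives with respect to a parameter.

\<^emph>\<open>The monotonicity of \<open>H\<close>.\<close> As \<open>a \<rightarrow> 1/2\<close> the annuli shrink to a point; blown up by the neck radius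
\<open>\<surd>B\<close> they tend to the critical catenoid in a Euclidean ball. The substitution
\<open>sinh s = \<surd>(B/2a) sinh x\<close> turns the profile into \<open>b = \<surd>B cosh x\<close>, \<open>t = \<surd>B T(B, x)\<close>, and the free
boundary condition into \<open>tanh(\<surd>B T)/\<surd>B = R(B, x)\<close>, an equation whose two sides and their first
partial derivatives extend continuously to \<open>B = 0\<close>, where it reads \<open>x = coth x\<close>. The equation is
strictly monotone in \<open>x\<close>, so it has at most one root; for small \<open>B > 0\<close> there is a root \<open>x(B)\<close>, which is
differentiable in \<open>B\<close> and tends to the root \<open>x\<^sub>0\<close> of \<open>x = coth x\<close>.
At the root, \<open>H\<^sup>2 = cosh\<^sup>4 x / ((sinh\<^sup>2 x - B)(1 + B))\<close>.
Differentiating implicitly and letting \<open>B \<rightarrow> 0\<close> gives, with \<open>p = x\<^sub>0\<^sup>2 - 1 = 1/sinh\<^sup>2 x\<^sub>0\<close>,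
\<open>(log H\<^sup>2)' = (1 - p)(1/(2p) - 1/3)\<close>. This is positive because \<open>p < 1\<close>, that is \<open>sinh x\<^sub>0 > 1\<close>, which
follows from \<open>arsinh 1 < \<surd>2\<close>. Hence \<open>H\<close> increases near \<open>1/2\<close>, and so does \<open>sinh r = K H\<close>, with
\<open>r' > 0\<close> (\<open>mori_near_limit\<close>).

\<^emph>\<open>The kernel.\<close> In the coordinates \<open>(b, t)\<close> of the profile plane the area element is \<open>db dt\<close>, so the normal
component of the variation field is the Jacobian \<open>\<phi> = b\<^sub>s t\<^sub>a - t\<^sub>s b\<^sub>a\<close>. The function \<open>b\<^sub>s\<close> is the Jacobi
field of the translations along the axis; it is odd, and its Wronskian with \<open>\<phi>\<close> is
\<open>b (\<phi>\<^sub>s b\<^sub>s - \<phi> b\<^sub>s\<^sub>s) = a/K\<close>, an identity in which the elliptic integral \<open>t\<^sub>a\<close> cancels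
(\<open>jacobi_field_wronskian\<close>). Comparing Wronskians with \<open>b\<^sub>s\<close> shows that every even rotational Jacobi function
is a multiple of \<open>\<phi>\<close> (\<open>even_jacobi_solution\<close>). Differentiating the free boundary condition along the
family gives the defect of \<open>\<phi>\<close> in the boundary condition,
\<open>\<phi>\<^sub>s - coth r \<phi> = (K/b\<^sup>2) r'\<close> at \<open>s\<^sub>0\<close> (\<open>jacobi_field_boundary_defect\<close>). Where \<open>r' > 0\<close>, neither \<open>\<phi>\<close> nor any
nonzero multiple of it satisfies the boundary condition, which is the second half of the theorem.\<close>

section \<open>Primitives depending on a parameter, and implicitly defined roots\<close>

text \<open>The primitive of \<open>f\<close> that vanishes at 0, for both signs of \<open>x\<close>. Integrating over the fixed interval
  \<open>[0, 1]\<close> lets the theorems on integrals with a parameter treat \<open>x\<close> as one more parameter.\<close>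

definition primitive :: "(real \<Rightarrow> real) \<Rightarrow> real \<Rightarrow> real" where
  "primitive f x = integral {0..1} (\<lambda>y. x * f (x * y))"

lemma primitive_0 [simp]: "primitive f 0 = 0"
  by (simp add: primitive_def)

lemma primitive_minus:
  assumes "\<And>x. f (- x) = f x"
  shows "primitive f (- x) = - primitive f x"
  using assms by (simp add: primitive_def)

lemma has_real_derivative_primitive:
  assumes "continuous_on UNIV f"
  shows "(primitive f has_real_derivative f x) (at x)"
proof -
  have "\<exists>G. \<forall>x::real. - \<infinity> < ereal x \<longrightarrow> ereal x < \<infinity> \<longrightarrow> (G has_vector_derivative f x) (at x)"
    by (rule einterval_antiderivative)
       (use assms continuous_on_eq_continuous_at[of UNIV f] in auto)
  then obtain G where G: "\<And>x. (G has_real_derivative f x) (at x)"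
    by (auto simp: has_real_derivative_iff_has_vector_derivative)
  have "primitive f x = G x - G 0" for x
  proof -
    have "((\<lambda>y. G (x * y)) has_real_derivative x * f (x * y)) (at y within {0..1})" for y
      using has_field_derivative_at_within[OF DERIV_chain2[OF G[of "x * y"] DERIV_cmult_Id[of x y]]]
      by (simp add: mult.commute)
    then have "((\<lambda>y. x * f (x * y)) has_integral (G (x * 1) - G (x * 0))) {0..1}"
      by (intro fundamental_theorem_of_calculus)
         (simp_all flip: has_real_derivative_iff_has_vector_derivative)
    from integral_unique[OF this] show ?thesis
      by (simp add: primitive_def)
  qed
  then have "primitive f = (\<lambda>x. G x - G 0)"
    by auto
  then show ?thesis
    using G by (auto intro!: derivative_eq_intros)
qed

lemma primitive_unique:
  assumes "\<And>x. (G has_real_derivative f x) (at x)" and "G 0 = 0" and "continuous_on UNIV f"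
  shows "G x = primitive f x"
proof -
  have "\<And>x. ((\<lambda>x. G x - primitive f x) has_real_derivative 0) (at x)"
    by (auto intro!: derivative_eq_intros assms(1) has_real_derivative_primitive[OF assms(3)])
  then have "G x - primitive f x = G 0 - primitive f 0"
    using DERIV_isconst_all[of "\<lambda>x. G x - primitive f x" x 0] by blast
  then show ?thesis
    using assms(2) by simp
qed

text \<open>Joint continuity up to the boundary of the parameter set is what makes the limit \<open>B \<rightarrow> 0\<close>
  accessible later, with \<open>U = [0, \<infinity>)\<close>.\<close>

lemma continuous_on_primitive_param:
  fixes f :: "real \<Rightarrow> real \<Rightarrow> real"
  assumes "continuous_on (U \<times> UNIV) (\<lambda>(p, x). f p x)"
  shows "continuous_on (U \<times> UNIV) (\<lambda>(p, x). primitive (f p) x)"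
proof -
  have "continuous_on ((U \<times> UNIV) \<times> {0..1}) (\<lambda>((p, x), y). x * f p (x * y))"
    unfolding split_beta
    by (intro continuous_intros continuous_on_compose2[OF assms, unfolded split_beta,
          of _ "\<lambda>z. (fst (fst z), snd (fst z) * snd z)", simplified]) auto
  then have "continuous_on (U \<times> UNIV) (\<lambda>z. integral (cbox 0 1) (\<lambda>y. snd z * f (fst z) (snd z * y)))"
    by (intro integral_continuous_on_param) (simp add: split_beta)
  then show ?thesis
    by (simp add: primitive_def split_beta)
qed

lemma continuous_on_slice:
  assumes "continuous_on (U \<times> UNIV) (\<lambda>(p, x). f p x)" and "p \<in> U"
  shows "continuous_on S (f p)"
  by (rule continuous_on_compose2[OF assms(1), of S "\<lambda>x. (p, x)", simplified])
     (use assms(2) in \<open>auto intro!: continuous_intros\<close>)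

lemma has_real_derivative_primitive_param:
  fixes f f' :: "real \<Rightarrow> real \<Rightarrow> real"
  assumes der: "\<And>p x. p \<in> U \<Longrightarrow> ((\<lambda>p. f p x) has_real_derivative f' p x) (at p)"
    and cont: "continuous_on (U \<times> UNIV) (\<lambda>(p, x). f p x)"
    and cont': "continuous_on (U \<times> UNIV) (\<lambda>(p, x). f' p x)"
    and U: "open U" "convex U" and a: "a \<in> U"
  shows "((\<lambda>p. primitive (f p) x) has_real_derivative primitive (f' a) x) (at a)"
proof -
  have "((\<lambda>p. integral (cbox 0 1) (\<lambda>y. x * f p (x * y))) has_real_derivative
          integral (cbox 0 1) (\<lambda>y. x * f' a (x * y))) (at a within U)"
  proof (rule leibniz_rule_field_derivative[OF _ _ _ a \<open>convex U\<close>])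
    show "((\<lambda>p. x * f p (x * y)) has_real_derivative x * f' p (x * y)) (at p within U)"
      if "p \<in> U" for p y
      by (rule has_field_derivative_at_within[OF DERIV_cmult[OF der[OF that]]])
    show "(\<lambda>y. x * f p (x * y)) integrable_on cbox 0 1" if "p \<in> U" for p
      by (intro integrable_continuous continuous_on_mult continuous_on_const continuous_on_id
          continuous_on_compose2[OF continuous_on_slice[OF cont that, of UNIV], of _ "\<lambda>y. x * y"]) auto
    show "continuous_on (U \<times> cbox 0 1) (\<lambda>(p, y). x * f' p (x * y))"
      unfolding split_beta
      by (intro continuous_on_mult continuous_on_const continuous_on_compose2[OF cont', unfolded split_beta,
            of _ "\<lambda>z. (fst z, x * snd z)", simplified] continuous_on_Pair continuous_on_fst
            continuous_on_snd continuous_on_id) auto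
  qed
  then show ?thesis
    unfolding primitive_def at_within_open[OF a \<open>open U\<close>] cbox_interval .
qed

text \<open>The chain rule for a primitive whose parameter and upper limit both depend on \<open>p\<close>. The primitive is jointly
  differentiable because its derivative in \<open>x\<close>, the integrand, is jointly continuous.\<close>

lemma has_real_derivative_primitive_total:
  fixes f f' :: "real \<Rightarrow> real \<Rightarrow> real"
  assumes der: "\<And>p x. p \<in> U \<Longrightarrow> ((\<lambda>p. f p x) has_real_derivative f' p x) (at p)"
    and cont: "continuous_on (U \<times> UNIV) (\<lambda>(p, x). f p x)"
    and cont': "continuous_on (U \<times> UNIV) (\<lambda>(p, x). f' p x)"
    and U: "open U" "convex U" and a: "a \<in> U"
    and g: "(g has_real_derivative g') (at a)"
  shows "((\<lambda>p. primitive (f p) (g p)) has_real_derivative primitive (f' a) (g a) + f a (g a) * g') (at a)"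
proof -
  have *: "((\<lambda>(p, x). primitive (f p) x) has_derivative
      (\<lambda>(h, k). primitive (f' a) (g a) * h + blinfun_mult_right (f a (g a)) k)) (at (a, g a) within U \<times> UNIV)"
  proof (rule has_derivative_partialsI)
    show "((\<lambda>p. primitive (f p) (g a)) has_derivative (\<lambda>h. primitive (f' a) (g a) * h)) (at a within U)"
      using has_real_derivative_primitive_param[OF der cont cont' U a, of "g a"]
      by (simp add: has_field_derivative_def has_derivative_at_withinI)
    show "(primitive (f p) has_derivative blinfun_apply (blinfun_mult_right (f p x))) (at x within UNIV)"
      if "p \<in> U" for p x
      using has_real_derivative_primitive[OF continuous_on_slice[OF cont that]]
      by (simp add: has_field_derivative_def)
    have "continuous_on (U \<times> UNIV) (\<lambda>(p, x). blinfun_mult_right (f p x))"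
      using cont unfolding split_beta
      by (intro bounded_linear.continuous_on[OF bounded_linear_blinfun_mult_right])
    then show "continuous (at (a, g a) within U \<times> UNIV) (\<lambda>(p, x). blinfun_mult_right (f p x))"
      using a by (auto simp: continuous_on_eq_continuous_within)
  qed auto
  have at: "at (a, g a) within U \<times> UNIV = at (a, g a)"
    using a U by (intro at_within_open) (auto intro: open_Times)
  have "((\<lambda>p. (p, g p)) has_derivative (\<lambda>h. (h, g' * h))) (at a)"
    using g by (intro has_derivative_Pair) (auto simp: has_field_derivative_def)
  from has_derivative_compose[OF this *[unfolded at]]
  have "((\<lambda>p. primitive (f p) (g p)) has_derivative (\<lambda>h. primitive (f' a) (g a) * h + f a (g a) * (g' * h))) (at a)"
    by simp
  moreover have "(\<lambda>h. primitive (f' a) (g a) * h + f a (g a) * (g' * h)) = (*) (primitive (f' a) (g a) + f a (g a) * g')"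
    by (auto simp: algebra_simps)
  ultimately show ?thesis
    by (simp add: has_field_derivative_def)
qed

text \<open>Roots of strictly increasing functions depend continuously on a parameter as soon as the functions do so
  pointwise: the signs at two points enclosing \<open>x0\<close> persist and trap the root. The point \<open>a\<close> may
  lie on the boundary of \<open>U\<close>.\<close>

lemma strict_mono_root_tendsto:
  fixes F :: "real \<Rightarrow> real \<Rightarrow> real"
  assumes mono: "\<And>p. p \<in> U \<Longrightarrow> strict_mono_on {0<..} (F p)"
    and cont: "\<And>x. x > 0 \<Longrightarrow> ((\<lambda>p. F p x) \<longlongrightarrow> F a x) (at a within U)"
    and a: "a \<in> U" "x0 > 0" "F a x0 = 0"
    and X: "eventually (\<lambda>p. X p > 0 \<and> F p (X p) = 0) (at a within U)"
  shows "(X \<longlongrightarrow> x0) (at a within U)"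
proof (rule order_tendstoI)
  fix l assume l: "l < x0"
  define m where "m = max l (x0 / 2)"
  have m: "m > 0" "m < x0" "l \<le> m"
    using l a by (auto simp: m_def)
  have "F a m < 0"
    using strict_mono_onD[OF mono[OF a(1)], of m x0] m a by simp
  then have "eventually (\<lambda>p. F p m < 0) (at a within U)"
    using order_tendstoD(2)[OF cont[OF m(1)]] by simp
  moreover have "eventually (\<lambda>p. p \<in> U) (at a within U)"
    by (simp add: eventually_at_filter)
  ultimately show "eventually (\<lambda>p. l < X p) (at a within U)"
    using X
  proof eventually_elim
    case (elim p)
    have "\<not> X p \<le> m"
      using strict_mono_on_leD[OF mono[OF elim(2)], of "X p" m] elim m by auto
    then show ?case
      using m by simp
  qed
next
  fix m assume m: "x0 < m"
  have "F a m > 0"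
    using strict_mono_onD[OF mono[OF a(1)], of x0 m] m a by simp
  then have "eventually (\<lambda>p. F p m > 0) (at a within U)"
    using order_tendstoD(1)[OF cont[of m]] m a by simp
  moreover have "eventually (\<lambda>p. p \<in> U) (at a within U)"
    by (simp add: eventually_at_filter)
  ultimately show "eventually (\<lambda>p. X p < m) (at a within U)"
    using X
  proof eventually_elim
    case (elim p)
    have "\<not> m \<le> X p"
      using strict_mono_on_leD[OF mono[OF elim(2)], of m "X p"] elim m a by auto
    then show ?case
      by simp
  qed
qed

text \<open>A one-dimensional implicit function theorem for a root that is already known to be continuous. Only
  one value of the derivative in the parameter enters; the mean value theorem handles the variable \<open>x\<close>.\<close>

lemma implicit_root_has_real_derivative:
  fixes F :: "real \<Rightarrow> real \<Rightarrow> real"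
  assumes Fp: "((\<lambda>p. F p (X a)) has_real_derivative Fp) (at a)"
    and Fx: "\<And>p x. p \<in> U \<Longrightarrow> x > 0 \<Longrightarrow> ((\<lambda>x. F p x) has_real_derivative Fx p x) (at x)"
    and cont: "isCont (\<lambda>(p, x). Fx p x) (a, X a)"
    and nz: "Fx a (X a) \<noteq> 0"
    and U: "open U" "a \<in> U"
    and X: "(X \<longlongrightarrow> X a) (at a)" "\<And>p. p \<in> U \<Longrightarrow> X p > 0" "\<And>p. p \<in> U \<Longrightarrow> F p (X p) = 0"
  shows "(X has_real_derivative - Fp / Fx a (X a)) (at a)"
proof -
  \<comment> \<open>The mean value theorem gives an intermediate point; it may lie on either side of \<open>X a\<close>.\<close>
  define between where "between p c \<longleftrightarrow> min (X p) (X a) \<le> c \<and> c \<le> max (X p) (X a) \<and>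
      F p (X p) - F p (X a) = (X p - X a) * Fx p c" for p c
  have "\<exists>c. between p c" if p: "p \<in> U" for p
  proof (rule linorder_cases[of "X p" "X a"])
    assume *: "X p < X a"
    have "\<exists>c>X p. c < X a \<and> F p (X a) - F p (X p) = (X a - X p) * Fx p c"
      using X(2)[OF p] by (intro MVT2[OF *] Fx[OF p]) auto
    then obtain c where "X p < c" "c < X a" "F p (X a) - F p (X p) = (X a - X p) * Fx p c"
      by blast
    then show ?thesis
      using * by (intro exI[of _ c]) (simp add: between_def left_diff_distrib)
  next
    assume *: "X a < X p"
    have "\<exists>c>X a. c < X p \<and> F p (X p) - F p (X a) = (X p - X a) * Fx p c"
      using X(2)[OF U(2)] by (intro MVT2[OF *] Fx[OF p]) auto
    then obtain c where "X a < c" "c < X p" "F p (X p) - F p (X a) = (X p - X a) * Fx p c"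
      by blast
    then show ?thesis
      using * by (intro exI[of _ c]) (simp add: between_def)
  qed (auto simp: between_def)
  then obtain c where "\<And>p. p \<in> U \<Longrightarrow> between p (c p)"
    by metis
  then have c: "min (X p) (X a) \<le> c p" "c p \<le> max (X p) (X a)"
      "F p (X p) - F p (X a) = (X p - X a) * Fx p (c p)" if "p \<in> U" for p
    using that by (simp_all add: between_def)
  have evU: "eventually (\<lambda>p. p \<in> U) (at a)"
    using U by (simp add: eventually_at_in_open')
  have "(c \<longlongrightarrow> X a) (at a)"
  proof (rule tendsto_sandwich)
    show "((\<lambda>p. min (X p) (X a)) \<longlongrightarrow> X a) (at a)" "((\<lambda>p. max (X p) (X a)) \<longlongrightarrow> X a) (at a)"
      using tendsto_min[OF X(1) tendsto_const[of "X a"]] tendsto_max[OF X(1) tendsto_const[of "X a"]] by simp_all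
  qed (use evU c in \<open>fastforce elim!: eventually_mono\<close>)+
  then have "((\<lambda>p. (p, c p)) \<longlongrightarrow> (a, X a)) (at a)"
    by (intro tendsto_Pair tendsto_ident_at)
  from isCont_tendsto_compose[OF cont this]
  have lim: "((\<lambda>p. Fx p (c p)) \<longlongrightarrow> Fx a (X a)) (at a)"
    unfolding split_conv .
  have "((\<lambda>p. - ((F p (X a) - F a (X a)) / (p - a)) / Fx p (c p)) \<longlongrightarrow> - Fp / Fx a (X a)) (at a)"
    using Fp lim nz by (intro tendsto_divide tendsto_minus) (simp_all add: has_field_derivative_iff)
  moreover have "eventually (\<lambda>p. - ((F p (X a) - F a (X a)) / (p - a)) / Fx p (c p) = (X p - X a) / (p - a)) (at a)"
    using evU tendsto_imp_eventually_ne[OF lim nz]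
  proof eventually_elim
    case (elim p)
    have "F p (X a) = - (X p - X a) * Fx p (c p)"
      using c(3)[OF elim(1)] X(3)[OF elim(1)] by (simp add: algebra_simps)
    then show ?case
      using elim(2) X(3)[OF U(2)] by (simp add: divide_simps)
  qed
  ultimately show ?thesis
    unfolding has_field_derivative_iff by (rule Lim_transform_eventually)
qed

section \<open>The profile of the Mori surfaces in closed form\<close>

text \<open>The functions \<open>prof\<close>, \<open>slope\<close> and \<open>climb\<close> are \<open>b\<close>, \<open>db/ds\<close> and \<open>dt/ds\<close> of the Mori profile in closed
  form.\<close>

definition prof :: "real \<Rightarrow> real \<Rightarrow> real" where
  "prof a s = sqrt (a * cosh (2 * s) - 1/2)"

definition slope :: "real \<Rightarrow> real \<Rightarrow> real" where
  "slope a s = a * sinh (2 * s) / prof a s"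

definition climb :: "real \<Rightarrow> real \<Rightarrow> real" where
  "climb a s = mori_K a / (prof a s * (1 + (prof a s)\<^sup>2))"

lemma mori_K_sq: "a > 1/2 \<Longrightarrow> (mori_K a)\<^sup>2 = a\<^sup>2 - 1/4"
  using mult_strict_mono[of "1/2" a "1/2" a] by (simp add: mori_K_def power2_eq_square)

lemma mori_K_pos: "a > 1/2 \<Longrightarrow> mori_K a > 0"
  using mult_strict_mono[of "1/2" a "1/2" a] by (simp add: mori_K_def power2_eq_square)

lemma mori_K_has_real_derivative:
  assumes "a > 1/2"
  shows "(mori_K has_real_derivative a / mori_K a) (at a)"
  using mult_strict_mono[of "1/2" a "1/2" a] assms unfolding mori_K_def
  by (auto intro!: derivative_eq_intros simp: power2_eq_square divide_simps)

lemma prof_arg_pos: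
  fixes a s :: real
  assumes "a > 1/2"
  shows "a * cosh (2 * s) - 1/2 > 0"
proof -
  have "a * 1 \<le> a * cosh (2 * s)"
    using cosh_real_ge_1[of "2 * s"] assms by (intro mult_left_mono) auto
  then show ?thesis
    using assms by linarith
qed

lemma prof_sq: "a > 1/2 \<Longrightarrow> (prof a s)\<^sup>2 = a * cosh (2 * s) - 1/2"
  using prof_arg_pos[of a s] by (simp add: prof_def)

lemma prof_pos [simp]: "a > 1/2 \<Longrightarrow> prof a s > 0"
  using prof_arg_pos[of a s] by (simp add: prof_def)

lemma prof_nonzero [simp]: "a > 1/2 \<Longrightarrow> prof a s \<noteq> 0"
  using prof_pos[of a s] by force

lemma prof_minus [simp]: "prof a (- s) = prof a s"
  by (simp add: prof_def)

lemma climb_minus [simp]: "climb a (- s) = climb a s"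
  by (simp add: climb_def)

lemma slope_0 [simp]: "slope a 0 = 0"
  by (simp add: slope_def)

lemma slope_pos: "a > 1/2 \<Longrightarrow> s > 0 \<Longrightarrow> slope a s > 0"
  by (simp add: slope_def)

lemma climb_pos: "a > 1/2 \<Longrightarrow> climb a s > 0"
  by (simp add: climb_def mori_K_pos add_pos_nonneg)

lemma climb_times:
  assumes "a > 1/2"
  shows "climb a s * (prof a s * (1 + (prof a s)\<^sup>2)) = mori_K a"
proof -
  have "prof a s * (1 + (prof a s)\<^sup>2) \<noteq> 0"
    using assms by (simp add: add_pos_nonneg less_imp_neq[symmetric])
  then show ?thesis
    by (simp add: climb_def)
qed

lemma slope_sq:
  assumes "a > 1/2"
  shows "(slope a s)\<^sup>2 = 1 + (prof a s)\<^sup>2 - (mori_K a)\<^sup>2 / (prof a s)\<^sup>2"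
proof -
  define x where "x = (prof a s)\<^sup>2"
  have x: "x > 0" "a * cosh (2 * s) = x + 1/2"
    using prof_nonzero[OF assms, of s] by (simp add: x_def, simp add: x_def prof_sq[OF assms])
  have "(a * sinh (2 * s))\<^sup>2 = (a * cosh (2 * s))\<^sup>2 - a\<^sup>2"
    by (simp add: power_mult_distrib sinh_square_eq right_diff_distrib)
  also have "\<dots> = x\<^sup>2 + x - (mori_K a)\<^sup>2"
    unfolding x(2) mori_K_sq[OF assms] by (simp add: power2_eq_square algebra_simps)
  finally have "(slope a s)\<^sup>2 = (x\<^sup>2 + x - (mori_K a)\<^sup>2) / x"
    by (simp add: slope_def power_divide x_def)
  also have "\<dots> = 1 + x - (mori_K a)\<^sup>2 / x"
    using x(1) by (simp add: field_simps power2_eq_square)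
  finally show ?thesis
    by (simp add: x_def)
qed

lemma prof_has_real_derivative:
  assumes "a > 1/2"
  shows "(prof a has_real_derivative slope a s) (at s)"
  unfolding prof_def[abs_def] slope_def
  using prof_arg_pos[OF assms, of s] assms
  by (auto intro!: derivative_eq_intros simp: field_simps)

lemma slope_has_real_derivative:
  assumes "a > 1/2"
  shows "(slope a has_real_derivative prof a s + (mori_K a)\<^sup>2 / (prof a s) ^ 3) (at s)"
proof -
  have "(slope a has_real_derivative
      (2 * (a * cosh (2 * s)) * prof a s - a * sinh (2 * s) * slope a s) / (prof a s)\<^sup>2) (at s)"
    unfolding slope_def[abs_def]
    using prof_nonzero[OF assms, of s]
    by (auto intro!: derivative_eq_intros prof_has_real_derivative[OF assms, unfolded slope_def[abs_def]]
        simp: power2_eq_square)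
  moreover have "(2 * (a * cosh (2 * s)) * prof a s - a * sinh (2 * s) * slope a s) / (prof a s)\<^sup>2
      = (2 * (a * cosh (2 * s)) - (slope a s)\<^sup>2) / prof a s"
    using assms by (simp add: slope_def power2_eq_square field_simps)
  moreover have "\<dots> = prof a s + (mori_K a)\<^sup>2 / (prof a s) ^ 3"
  proof -
    have "a * cosh (2 * s) = (prof a s)\<^sup>2 + 1/2"
      using assms by (simp add: prof_sq)
    then show ?thesis
      unfolding slope_sq[OF assms] using assms
      by (simp add: field_simps power2_eq_square power3_eq_cube)
  qed
  ultimately show ?thesis
    by simp
qed

lemma continuous_on_prof [continuous_intros]:
  "continuous_on S f \<Longrightarrow> continuous_on S g \<Longrightarrow> continuous_on S (\<lambda>x. prof (f x) (g x))"
  unfolding prof_def by (intro continuous_intros)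

lemma continuous_on_climb: "a > 1/2 \<Longrightarrow> continuous_on S (climb a)"
  unfolding climb_def[abs_def]
  by (intro continuous_intros) (auto simp: add_pos_nonneg less_imp_neq[symmetric] intro: add_pos_nonneg)

text \<open>The equation \<open>z'' = 4 z\<close> splits into the first-order factors \<open>d/ds + 2\<close> and \<open>d/ds - 2\<close>, each of
  which has an integrating factor.\<close>

lemma second_order_linear_unique:
  fixes z z' :: "real \<Rightarrow> real"
  assumes z: "\<And>s. (z has_real_derivative z' s) (at s)"
    and z': "\<And>s. (z' has_real_derivative 4 * z s) (at s)"
    and 0: "z 0 = 0" "z' 0 = 0"
  shows "z s = 0"
proof -
  have "((\<lambda>s. (z' s - 2 * z s) * exp (2 * s)) has_real_derivative 0) (at s)" for s
    by (auto intro!: derivative_eq_intros z z' simp: algebra_simps)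
  then have "(z' s - 2 * z s) * exp (2 * s) = 0" for s
    using DERIV_isconst_all[of "\<lambda>s. (z' s - 2 * z s) * exp (2 * s)" s 0] 0 by simp
  then have "z' s = 2 * z s" for s
    by simp
  then have "((\<lambda>s. z s * exp (- 2 * s)) has_real_derivative 0) (at s)" for s
    by (auto intro!: derivative_eq_intros z simp: algebra_simps)
  then have "z s * exp (- 2 * s) = 0"
    using DERIV_isconst_all[of "\<lambda>s. z s * exp (- 2 * s)" s 0] 0 by simp
  then show ?thesis
    by simp
qed

text \<open>The energy integral turns the nonlinear equation for \<open>b\<close> into \<open>(b\<^sup>2)'' = 4 b\<^sup>2 + 2\<close>.\<close>

lemma mori_b_eq:
  assumes a: "a > 1/2"
  shows "mori_b a = prof a"
  unfolding mori_b_def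
proof (rule the_equality)
  show "(\<forall>s. prof a s > 0) \<and> (\<forall>s. prof a (- s) = prof a s) \<and> prof a 0 = sqrt (a - 1/2) \<and>
     (\<exists>b'. b' 0 = 0 \<and> (\<forall>s. (prof a has_real_derivative b' s) (at s) \<and>
        (b' has_real_derivative (prof a s + (mori_K a)\<^sup>2 / (prof a s) ^ 3)) (at s)))"
    using a prof_has_real_derivative[OF a] slope_has_real_derivative[OF a]
    by (auto intro!: exI[of _ "slope a"]) (simp add: prof_def)
next
  fix b :: "real \<Rightarrow> real"
  assume b: "(\<forall>s. b s > 0) \<and> (\<forall>s. b (- s) = b s) \<and> b 0 = sqrt (a - 1/2) \<and>
     (\<exists>b'. b' 0 = 0 \<and> (\<forall>s. (b has_real_derivative b' s) (at s) \<and>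
        (b' has_real_derivative (b s + (mori_K a)\<^sup>2 / (b s) ^ 3)) (at s)))"
  then obtain b' where b': "b' 0 = 0" "\<And>s. (b has_real_derivative b' s) (at s)"
      "\<And>s. (b' has_real_derivative (b s + (mori_K a)\<^sup>2 / (b s) ^ 3)) (at s)"
    by blast
  have pos: "b s > 0" for s
    using b by blast
  then have nz: "b s \<noteq> 0" for s
    by (simp add: less_imp_neq[symmetric])
  \<comment> \<open>The energy integral of the equation.\<close>
  have "((\<lambda>s. (b' s)\<^sup>2 - (b s)\<^sup>2 + (mori_K a)\<^sup>2 / (b s)\<^sup>2) has_real_derivative 0) (at s)" for s
    by (auto intro!: derivative_eq_intros b'(2,3) simp: nz)
       (use nz[of s] in \<open>simp add: divide_simps\<close>, use nz[of s] in algebra)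
  then have "(b' s)\<^sup>2 - (b s)\<^sup>2 + (mori_K a)\<^sup>2 / (b s)\<^sup>2 = (b' 0)\<^sup>2 - (b 0)\<^sup>2 + (mori_K a)\<^sup>2 / (b 0)\<^sup>2" for s
    using DERIV_isconst_all[of "\<lambda>s. (b' s)\<^sup>2 - (b s)\<^sup>2 + (mori_K a)\<^sup>2 / (b s)\<^sup>2" s 0] by blast
  moreover have "(b' 0)\<^sup>2 - (b 0)\<^sup>2 + (mori_K a)\<^sup>2 / (b 0)\<^sup>2 = 1"
    using b a by (simp add: b'(1) mori_K_sq[OF a]) (simp add: field_simps power2_eq_square)
  ultimately have energy: "(b' s)\<^sup>2 = 1 + (b s)\<^sup>2 - (mori_K a)\<^sup>2 / (b s)\<^sup>2" for s
    by (smt (verit))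
  have "(b s)\<^sup>2 - (a * cosh (2 * s) - 1/2) = 0" for s
  proof (rule second_order_linear_unique[of "\<lambda>s. (b s)\<^sup>2 - (a * cosh (2 * s) - 1/2)"
        "\<lambda>s. 2 * b s * b' s - 2 * a * sinh (2 * s)"])
    show "((\<lambda>s. (b s)\<^sup>2 - (a * cosh (2 * s) - 1/2)) has_real_derivative
        2 * b s * b' s - 2 * a * sinh (2 * s)) (at s)" for s
      by (auto intro!: derivative_eq_intros b'(2))
    have "((\<lambda>s. 2 * b s * b' s - 2 * a * sinh (2 * s)) has_real_derivative
        2 * (b' s)\<^sup>2 + 2 * b s * (b s + (mori_K a)\<^sup>2 / (b s) ^ 3) - 4 * a * cosh (2 * s)) (at s)" for s
      by (auto intro!: derivative_eq_intros b'(2,3) simp: power2_eq_square)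
    moreover have "2 * (b' s)\<^sup>2 + 2 * b s * (b s + (mori_K a)\<^sup>2 / (b s) ^ 3) - 4 * a * cosh (2 * s)
        = 4 * ((b s)\<^sup>2 - (a * cosh (2 * s) - 1/2))" for s
      unfolding energy using nz[of s] by (simp add: field_simps power2_eq_square power3_eq_cube)
    ultimately show "((\<lambda>s. 2 * b s * b' s - 2 * a * sinh (2 * s)) has_real_derivative
        4 * ((b s)\<^sup>2 - (a * cosh (2 * s) - 1/2))) (at s)" for s
      by simp
  qed (use b b'(1) a in simp_all)
  then have "(b s)\<^sup>2 = (prof a s)\<^sup>2" for s
    using a by (simp add: prof_sq)
  then show "b = prof a"
    using pos a by (simp add: fun_eq_iff power2_eq_iff_nonneg less_imp_le)
qed

lemma mori_t_eq:
  assumes a: "a > 1/2"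
  shows "mori_t a = primitive (climb a)"
  unfolding mori_t_def
proof (rule the_equality)
  have "prof a s * (1 + (prof a s)\<^sup>2) * climb a s = mori_K a" for s
    using climb_times[OF a, of s] by (simp add: mult_ac)
  then show "primitive (climb a) 0 = 0 \<and> (\<forall>s. primitive (climb a) (- s) = - primitive (climb a) s) \<and>
     (\<exists>t'. \<forall>s. (primitive (climb a) has_real_derivative t' s) (at s) \<and>
        mori_b a s * (1 + (mori_b a s)\<^sup>2) * t' s = mori_K a)"
    using has_real_derivative_primitive[OF continuous_on_climb[OF a]]
    by (auto intro!: primitive_minus exI[of _ "climb a"] simp: mori_b_eq[OF a])
next
  fix t :: "real \<Rightarrow> real"
  assume t: "t 0 = 0 \<and> (\<forall>s. t (- s) = - t s) \<and>
     (\<exists>t'. \<forall>s. (t has_real_derivative t' s) (at s) \<and>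
        mori_b a s * (1 + (mori_b a s)\<^sup>2) * t' s = mori_K a)"
  then obtain t' where t': "\<And>s. (t has_real_derivative t' s) (at s)"
      "\<And>s. prof a s * (1 + (prof a s)\<^sup>2) * t' s = mori_K a"
    by (auto simp: mori_b_eq[OF a])
  have "t' s = climb a s" for s
  proof -
    have "prof a s * (1 + (prof a s)\<^sup>2) \<noteq> 0"
      using a by (simp add: add_pos_nonneg less_imp_neq[symmetric])
    then show ?thesis
      using t'(2)[of s] by (simp add: climb_def eq_divide_eq mult_ac)
  qed
  then show "t = primitive (climb a)"
    using primitive_unique[of t "climb a"] t' t continuous_on_climb[OF a] by (auto simp: fun_eq_iff)
qed

lemma prof_has_real_derivative_param:
  assumes "a > 1/2"
  shows "((\<lambda>a. prof a s) has_real_derivative cosh (2 * s) / (2 * prof a s)) (at a)"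
  unfolding prof_def using prof_arg_pos[OF assms, of s]
  by (auto intro!: derivative_eq_intros simp: field_simps)

text \<open>The derivative of \<open>climb a s\<close> with respect to \<open>a\<close>, for fixed \<open>s\<close>.\<close>

definition climb_param :: "real \<Rightarrow> real \<Rightarrow> real" where
  "climb_param a s = (a / mori_K a) / (prof a s * (1 + (prof a s)\<^sup>2))
     - mori_K a * (cosh (2 * s) / (2 * prof a s)) * (1 + 3 * (prof a s)\<^sup>2) / (prof a s * (1 + (prof a s)\<^sup>2))\<^sup>2"

lemma climb_has_real_derivative_param:
  assumes a: "a > 1/2"
  shows "((\<lambda>a. climb a s) has_real_derivative climb_param a s) (at a)"
proof -
  have nz: "prof a s * (1 + (prof a s)\<^sup>2) \<noteq> 0"
    using a by (simp add: add_pos_nonneg less_imp_neq[symmetric])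
  have "((\<lambda>a. prof a s * (1 + (prof a s)\<^sup>2)) has_real_derivative
     cosh (2 * s) / (2 * prof a s) * (1 + 3 * (prof a s)\<^sup>2)) (at a)"
    by (rule derivative_eq_intros prof_has_real_derivative_param[OF a] refl)+
       (use prof_nonzero[OF a, of s] in \<open>simp add: field_simps power2_eq_square\<close>)
  from DERIV_divide[OF mori_K_has_real_derivative[OF a] this nz]
  show ?thesis
    unfolding climb_def climb_param_def
    by (rule DERIV_cong) (use nz in \<open>simp add: diff_divide_distrib power2_eq_square\<close>)
qed

lemma continuous_on_climb_param:
  "continuous_on ({1/2<..} \<times> UNIV) (\<lambda>(a, s). climb a s)"
  "continuous_on ({1/2<..} \<times> UNIV) (\<lambda>(a, s). climb_param a s)"
proof -
  have nz: "prof (fst x) (snd x) \<noteq> 0" "1 + (prof (fst x) (snd x))\<^sup>2 \<noteq> 0" "mori_K (fst x) \<noteq> 0"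
    if "x \<in> {1/2<..} \<times> UNIV" for x
    using that mori_K_pos[of "fst x"] by (auto simp: add_pos_nonneg less_imp_neq[symmetric])
  have K: "continuous_on S (\<lambda>x. mori_K (fst x))" for S :: "(real \<times> real) set"
    unfolding mori_K_def by (intro continuous_intros)
  show "continuous_on ({1/2<..} \<times> UNIV) (\<lambda>(a, s). climb a s)"
    unfolding climb_def split_beta using nz by (intro continuous_intros K) auto
  show "continuous_on ({1/2<..} \<times> UNIV) (\<lambda>(a, s). climb_param a s)"
    unfolding climb_param_def split_beta using nz by (intro continuous_intros K) auto
qed

section \<open>The free boundary equation at the scale of the neck\<close>

text \<open>\<open>tanh (\<surd>B y) / \<surd>B\<close>, continued to \<open>B = 0\<close>.\<close>

definition scaled_tanh :: "real \<Rightarrow> real \<Rightarrow> real" where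
  "scaled_tanh B y = (if B = 0 then y else tanh (sqrt B * y) / sqrt B)"

text \<open>The derivative \<open>dT/dx\<close> of the height \<open>T = t/\<surd>B\<close> in the scaled parameter \<open>x\<close>, where
  \<open>sinh s = \<surd>(B/2a) sinh x\<close> and \<open>B = a - 1/2\<close>.\<close>

definition scaled_climb :: "real \<Rightarrow> real \<Rightarrow> real" where
  "scaled_climb B x = sqrt (1 + B) / ((1 + B * (cosh x)\<^sup>2) * sqrt (1 + B + B * (cosh x)\<^sup>2))"

definition scaled_height :: "real \<Rightarrow> real \<Rightarrow> real" where
  "scaled_height B = primitive (scaled_climb B)"

text \<open>The quotient \<open>K / (\<surd>B db/ds)\<close> in the scaled parameter. The free boundary condition
  \<open>tanh t = K / (db/ds)\<close> says that \<open>scaled_tanh B T\<close> equals it.\<close>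

definition fb_target :: "real \<Rightarrow> real \<Rightarrow> real" where
  "fb_target B x = sqrt (1 + B) * cosh x / (sinh x * sqrt (1 + B + B * (cosh x)\<^sup>2))"

definition scaled_fb :: "real \<Rightarrow> real \<Rightarrow> real" where
  "scaled_fb B x = scaled_tanh B (scaled_height B x) - fb_target B x"

text \<open>The suffixes \<open>B\<close> and \<open>x\<close> denote partial derivatives, written as logarithmic derivatives where possible.\<close>

definition scaled_climb_B :: "real \<Rightarrow> real \<Rightarrow> real" where
  "scaled_climb_B B x = scaled_climb B x * (1 / (2 * (1 + B)) - (cosh x)\<^sup>2 / (1 + B * (cosh x)\<^sup>2)
     - (1 + (cosh x)\<^sup>2) / (2 * (1 + B + B * (cosh x)\<^sup>2)))"

definition fb_target_B :: "real \<Rightarrow> real \<Rightarrow> real" where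
  "fb_target_B B x = fb_target B x * (1 / (2 * (1 + B)) - (1 + (cosh x)\<^sup>2) / (2 * (1 + B + B * (cosh x)\<^sup>2)))"

definition fb_target_x :: "real \<Rightarrow> real \<Rightarrow> real" where
  "fb_target_x B x = - fb_target B x * (1 / (sinh x * cosh x) + B * cosh x * sinh x / (1 + B + B * (cosh x)\<^sup>2))"

text \<open>With \<open>z = \<surd>B y\<close>, the derivative of \<open>tanh (\<surd>B y) / \<surd>B\<close> in \<open>B\<close> is \<open>y\<^sup>3 tanh_defect z / 2\<close>; the value
  \<open>-2/3\<close> at 0 makes it continuous.\<close>

definition tanh_defect :: "real \<Rightarrow> real" where
  "tanh_defect z = (if z = 0 then - 2/3 else ((1 - (tanh z)\<^sup>2) * z - tanh z) / z ^ 3)"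

definition scaled_fb_B :: "real \<Rightarrow> real \<Rightarrow> real" where
  "scaled_fb_B B x = (1 - (tanh (sqrt B * scaled_height B x))\<^sup>2) * primitive (scaled_climb_B B) x
     + (scaled_height B x) ^ 3 * tanh_defect (sqrt B * scaled_height B x) / 2 - fb_target_B B x"

definition scaled_fb_x :: "real \<Rightarrow> real \<Rightarrow> real" where
  "scaled_fb_x B x = (1 - (tanh (sqrt B * scaled_height B x))\<^sup>2) * scaled_climb B x - fb_target_x B x"

lemma cosh_sq_terms_pos:
  fixes B x :: real
  assumes "B \<ge> 0"
  shows "1 + B * (cosh x)\<^sup>2 > 0" "1 + B + B * (cosh x)\<^sup>2 > 0"
  using assms by (auto intro!: add_pos_nonneg)

lemma continuous_on_scaled_climb:
  "continuous_on ({0..} \<times> UNIV) (\<lambda>(B, x). scaled_climb B x)"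
  "continuous_on ({0..} \<times> UNIV) (\<lambda>(B, x). scaled_climb_B B x)"
proof -
  have nz: "1 + fst z * (cosh (snd z))\<^sup>2 \<noteq> 0" "1 + fst z + fst z * (cosh (snd z))\<^sup>2 \<noteq> 0" "1 + fst z \<noteq> 0"
      "2 * (1 + fst z + fst z * (cosh (snd z))\<^sup>2) \<noteq> 0" "2 * (1 + fst z) \<noteq> 0"
    if "z \<in> {0..} \<times> UNIV" for z :: "real \<times> real"
    using that cosh_sq_terms_pos[of "fst z" "snd z"] by (auto simp del: distrib_left_numeral)
  show "continuous_on ({0..} \<times> UNIV) (\<lambda>(B, x). scaled_climb B x)"
    unfolding scaled_climb_def split_beta using nz by (intro continuous_intros) auto
  then show "continuous_on ({0..} \<times> UNIV) (\<lambda>(B, x). scaled_climb_B B x)"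
    unfolding scaled_climb_B_def split_beta using nz by (intro continuous_intros) (auto simp del: distrib_left_numeral)
qed

lemma continuous_on_scaled_climb_slice: "B \<ge> 0 \<Longrightarrow> continuous_on UNIV (scaled_climb B)"
  by (rule continuous_on_slice[OF continuous_on_scaled_climb(1)]) auto

lemma scaled_climb_has_real_derivative:
  assumes "B > 0"
  shows "((\<lambda>B. scaled_climb B x) has_real_derivative scaled_climb_B B x) (at B)"
proof -
  define c A D E where "c = (cosh x)\<^sup>2" and "A = sqrt (1 + B)" and "D = 1 + B * c"
    and "E = sqrt (1 + B + B * c)"
  have pos: "1 + B > 0" "D > 0" "1 + B + B * c > 0"
    using assms cosh_sq_terms_pos[of B x] by (auto simp: c_def D_def)
  then have nz: "A \<noteq> 0" "D \<noteq> 0" "E \<noteq> 0" and sq: "A\<^sup>2 = 1 + B" "E\<^sup>2 = 1 + B + B * c"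
    by (auto simp: A_def E_def)
  have dA: "((\<lambda>B. sqrt (1 + B)) has_real_derivative 1 / (2 * A)) (at B)"
    using pos by (auto intro!: derivative_eq_intros simp: A_def divide_simps)
  have dD: "((\<lambda>B. 1 + B * c) has_real_derivative c) (at B)"
    by (auto intro!: derivative_eq_intros)
  have dE: "((\<lambda>B. sqrt (1 + B + B * c)) has_real_derivative (1 + c) / (2 * E)) (at B)"
    using pos by (auto intro!: derivative_eq_intros simp: E_def divide_simps)
  have "((\<lambda>B. sqrt (1 + B) / ((1 + B * c) * sqrt (1 + B + B * c))) has_real_derivative
      ((1 / (2 * A)) * (D * E) - A * (c * E + (1 + c) / (2 * E) * D)) / (D * E * (D * E))) (at B)"
    using DERIV_divide[OF dA DERIV_mult[OF dD dE]] nz by (simp add: A_def D_def E_def)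
  also have "((1 / (2 * A)) * (D * E) - A * (c * E + (1 + c) / (2 * E) * D)) / (D * E * (D * E))
      = A / (D * E) * (1 / (2 * A\<^sup>2) - c / D - (1 + c) / (2 * E\<^sup>2))"
    using nz by (simp add: field_simps power2_eq_square)
  also have "\<dots> = scaled_climb_B B x"
    unfolding sq scaled_climb_B_def scaled_climb_def by (simp add: A_def D_def E_def c_def)
  finally show ?thesis
    by (simp add: scaled_climb_def c_def)
qed

lemma fb_target_has_real_derivative_B:
  assumes "B > 0" "x > 0"
  shows "((\<lambda>B. fb_target B x) has_real_derivative fb_target_B B x) (at B)"
proof -
  define c s A E where "c = (cosh x)\<^sup>2" and "s = sinh x" and "A = sqrt (1 + B)"
    and "E = sqrt (1 + B + B * c)"
  have pos: "1 + B > 0" "1 + B + B * c > 0" "s > 0"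
    using assms cosh_sq_terms_pos[of B x] by (auto simp: c_def s_def)
  then have nz: "A \<noteq> 0" "E \<noteq> 0" "s \<noteq> 0" and sq: "A\<^sup>2 = 1 + B" "E\<^sup>2 = 1 + B + B * c"
    by (auto simp: A_def E_def)
  have dA: "((\<lambda>B. sqrt (1 + B) * cosh x) has_real_derivative 1 / (2 * A) * cosh x) (at B)"
    using pos by (auto intro!: derivative_eq_intros simp: A_def divide_simps)
  have dE: "((\<lambda>B. s * sqrt (1 + B + B * c)) has_real_derivative s * ((1 + c) / (2 * E))) (at B)"
    using pos by (auto intro!: derivative_eq_intros simp: E_def divide_simps)
  have "((\<lambda>B. sqrt (1 + B) * cosh x / (s * sqrt (1 + B + B * c))) has_real_derivative
      (1 / (2 * A) * cosh x * (s * E) - A * cosh x * (s * ((1 + c) / (2 * E)))) / (s * E * (s * E))) (at B)"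
    using DERIV_divide[OF dA dE] nz by (simp add: A_def E_def)
  also have "(1 / (2 * A) * cosh x * (s * E) - A * cosh x * (s * ((1 + c) / (2 * E)))) / (s * E * (s * E))
      = A * cosh x / (s * E) * (1 / (2 * A\<^sup>2) - (1 + c) / (2 * E\<^sup>2))"
    using nz by (simp add: field_simps power2_eq_square)
  also have "\<dots> = fb_target_B B x"
    unfolding sq fb_target_B_def fb_target_def by (simp add: A_def s_def E_def c_def)
  finally show ?thesis
    by (simp add: fb_target_def c_def s_def)
qed

lemma fb_target_has_real_derivative_x:
  assumes "B \<ge> 0" "x > 0"
  shows "(fb_target B has_real_derivative fb_target_x B x) (at x)"
proof -
  define A s c E where "A = sqrt (1 + B)" and "s = sinh x" and "c = cosh x"
    and "E = sqrt (1 + B + B * (cosh x)\<^sup>2)"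
  have E2: "E\<^sup>2 = 1 + B + B * c\<^sup>2" and nz: "E \<noteq> 0" "s \<noteq> 0" "c \<noteq> 0"
    using assms cosh_sq_terms_pos[of B x] cosh_real_pos[of x] by (auto simp: E_def s_def c_def)
  have dE: "((\<lambda>x. sinh x * sqrt (1 + B + B * (cosh x)\<^sup>2)) has_real_derivative c * E + s * (B * c * s / E)) (at x)"
    using cosh_sq_terms_pos[of B x] assms
    by (auto intro!: derivative_eq_intros simp: E_def s_def c_def divide_simps)
  have dA: "((\<lambda>x. A * cosh x) has_real_derivative A * s) (at x)"
    by (auto intro!: derivative_eq_intros simp: s_def)
  have "(fb_target B has_real_derivative
      (A * s * (s * E) - A * c * (c * E + s * (B * c * s / E))) / (s * E * (s * E))) (at x)"
    using DERIV_divide[OF dA dE] nz by (simp add: fb_target_def[abs_def] A_def E_def s_def c_def)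
  also have "(A * s * (s * E) - A * c * (c * E + s * (B * c * s / E))) / (s * E * (s * E))
      = A / s * (s\<^sup>2 - c\<^sup>2) / (s * E) - A * c * (B * c * s) / (s * E * E\<^sup>2)"
    using nz by (simp add: field_simps power2_eq_square)
  also have "s\<^sup>2 - c\<^sup>2 = -1"
    by (simp add: s_def c_def cosh_square_eq)
  also have "A / s * - 1 / (s * E) - A * c * (B * c * s) / (s * E * E\<^sup>2)
      = - (A * c / (s * E)) * (1 / (s * c) + B * c * s / E\<^sup>2)"
    using nz by (simp add: field_simps)
  also have "\<dots> = fb_target_x B x"
    unfolding E2 fb_target_x_def fb_target_def by (simp add: A_def c_def s_def E_def)
  finally show ?thesis .
qed

lemma scaled_tanh_has_real_derivative:
  assumes "B \<ge> 0"
  shows "(scaled_tanh B has_real_derivative 1 - (tanh (sqrt B * y))\<^sup>2) (at y)"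
proof (cases "B = 0")
  case False
  then have "B > 0"
    using assms by simp
  then show ?thesis
    unfolding scaled_tanh_def[abs_def] by (auto intro!: derivative_eq_intros simp: field_simps)
qed (auto simp: scaled_tanh_def[abs_def])

lemma one_minus_tanh_sq_pos: "1 - (tanh y)\<^sup>2 > (0::real)"
  using tanh_real_bounds[of y] by (simp add: abs_square_less_1 abs_less_iff)

lemma scaled_height_has_real_derivative:
  "B \<ge> 0 \<Longrightarrow> (scaled_height B has_real_derivative scaled_climb B x) (at x)"
  unfolding scaled_height_def by (intro has_real_derivative_primitive continuous_on_scaled_climb_slice)

lemma scaled_climb_pos: "B \<ge> 0 \<Longrightarrow> scaled_climb B x > 0"
  using cosh_sq_terms_pos[of B x] by (simp add: scaled_climb_def)

lemma scaled_fb_has_real_derivative_x: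
  assumes "B \<ge> 0" "x > 0"
  shows "(scaled_fb B has_real_derivative scaled_fb_x B x) (at x)"
  unfolding scaled_fb_def[abs_def] scaled_fb_x_def
  by (intro derivative_intros DERIV_chain2[OF scaled_tanh_has_real_derivative[OF assms(1)]]
      scaled_height_has_real_derivative fb_target_has_real_derivative_x assms)

lemma scaled_fb_x_pos:
  assumes "B \<ge> 0" "x > 0"
  shows "scaled_fb_x B x > 0"
proof -
  have "scaled_climb B x > 0" "fb_target B x > 0"
    using assms cosh_sq_terms_pos[of B x] by (simp_all add: scaled_climb_pos fb_target_def)
  moreover have "1 / (sinh x * cosh x) + B * cosh x * sinh x / (1 + B + B * (cosh x)\<^sup>2) > 0"
    using assms cosh_sq_terms_pos[of B x] by (intro add_pos_nonneg) auto
  ultimately show ?thesis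
    using one_minus_tanh_sq_pos by (simp add: scaled_fb_x_def fb_target_x_def add_pos_pos)
qed

text \<open>The height increases with \<open>x\<close> while the target decreases; this gives uniqueness of the
  free boundary parameter.\<close>

lemma scaled_fb_strict_mono:
  assumes "B \<ge> 0"
  shows "strict_mono_on {0<..} (scaled_fb B)"
proof (rule strict_mono_onI)
  fix x y :: real assume xy: "x \<in> {0<..}" "x < y"
  show "scaled_fb B x < scaled_fb B y"
  proof (rule DERIV_pos_imp_increasing[OF xy(2)])
    fix z assume "x \<le> z"
    then have "z > 0"
      using xy by simp
    then show "\<exists>d. (scaled_fb B has_real_derivative d) (at z) \<and> d > 0"
      using scaled_fb_has_real_derivative_x[OF assms] scaled_fb_x_pos[OF assms] by blast
  qed
qed

text \<open>The endpoint \<open>B = 0\<close> enters through the limit of this derivative.\<close>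

lemma scaled_fb_has_real_derivative_B:
  assumes "B > 0" "x > 0"
  shows "((\<lambda>B. scaled_fb B x) has_real_derivative scaled_fb_B B x) (at B)"
proof -
  define T T' where "T = scaled_height B x" and "T' = primitive (scaled_climb_B B) x"
  define w z where "w = sqrt B" and "z = sqrt B * T"
  have w: "w > 0"
    using assms by (auto simp: w_def)
  have T: "((\<lambda>B. scaled_height B x) has_real_derivative T') (at B)"
    unfolding scaled_height_def T'_def
  proof (rule has_real_derivative_primitive_param[where U = "{0<..}"])
    show "continuous_on ({0<..} \<times> UNIV) (\<lambda>(B, x). scaled_climb B x)"
      "continuous_on ({0<..} \<times> UNIV) (\<lambda>(B, x). scaled_climb_B B x)"
      by (rule continuous_on_subset[OF continuous_on_scaled_climb(1)], force)
         (rule continuous_on_subset[OF continuous_on_scaled_climb(2)], force)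
  qed (use assms in \<open>simp_all add: scaled_climb_has_real_derivative\<close>)
  have "scaled_height B 0 < scaled_height B x"
  proof (rule DERIV_pos_imp_increasing[OF assms(2)])
    show "\<exists>d. (scaled_height B has_real_derivative d) (at z) \<and> d > 0" for z
      using scaled_height_has_real_derivative[of B z] scaled_climb_pos[of B z] assms(1) by auto
  qed
  then have "scaled_height B x > 0"
    by (simp add: scaled_height_def)
  then have Tpos: "T > 0"
    by (simp add: T_def)
  have "((\<lambda>B. tanh (sqrt B * scaled_height B x) / sqrt B) has_real_derivative
     ((1 - (tanh z)\<^sup>2) * (T / (2 * w) + w * T') * w - tanh z * (1 / (2 * w))) / w\<^sup>2) (at B)"
  proof -
    have w': "((\<lambda>B. sqrt B) has_real_derivative 1 / (2 * w)) (at B)"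
      using assms by (auto intro!: derivative_eq_intros simp: w_def divide_simps)
    have z': "((\<lambda>B. tanh (sqrt B * scaled_height B x)) has_real_derivative
        (1 - (tanh z)\<^sup>2) * (T / (2 * w) + w * T')) (at B)"
      by (rule DERIV_cong[OF has_field_derivative_tanh[OF _ DERIV_mult[OF w' T]]])
         (simp_all add: z_def w_def T_def mult_ac)
    show ?thesis
      using DERIV_divide[OF z' w'] w by (simp add: z_def w_def T_def power2_eq_square)
  qed
  also have "((1 - (tanh z)\<^sup>2) * (T / (2 * w) + w * T') * w - tanh z * (1 / (2 * w))) / w\<^sup>2
      = (1 - (tanh z)\<^sup>2) * T' + T ^ 3 * tanh_defect z / 2"
  proof -
    define th where "th = tanh z"
    have nz: "w \<noteq> 0" "T \<noteq> 0" and z: "z = w * T"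
      using w Tpos by (simp_all add: z_def w_def)
    show ?thesis
      unfolding tanh_defect_def th_def[symmetric] z using nz
      by (simp add: field_simps power3_eq_cube power2_eq_square)
  qed
  finally have d: "((\<lambda>B. tanh (sqrt B * scaled_height B x) / sqrt B) has_real_derivative
      (1 - (tanh z)\<^sup>2) * T' + T ^ 3 * tanh_defect z / 2) (at B)" .
  have "eventually (\<lambda>B. tanh (sqrt B * scaled_height B x) / sqrt B = scaled_tanh B (scaled_height B x)) (nhds B)"
    by (rule eventually_mono[OF eventually_nhds_in_open[OF open_greaterThan, of B 0]])
       (use assms in \<open>auto simp: scaled_tanh_def\<close>)
  from DERIV_cong_ev[OF refl this refl, THEN iffD1, OF d]
  have "((\<lambda>B. scaled_tanh B (scaled_height B x)) has_real_derivative
      (1 - (tanh z)\<^sup>2) * T' + T ^ 3 * tanh_defect z / 2) (at B)" .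
  from DERIV_diff[OF this fb_target_has_real_derivative_B[OF assms]]
  show ?thesis
    by (simp add: scaled_fb_def scaled_fb_B_def T_def T'_def z_def)
qed

section \<open>The Euclidean limit of the scaled equation\<close>

lemma isCont_tanh_defect: "isCont tanh_defect z"
proof (cases "z = 0")
  case True
  have "((\<lambda>z::real. ((1 - (tanh z)\<^sup>2) * z - tanh z) / z ^ 3) \<longlongrightarrow> - 2/3) (at 0)"
    by real_asymp
  moreover have "eventually (\<lambda>z. ((1 - (tanh z)\<^sup>2) * z - tanh z) / z ^ 3 = tanh_defect z) (at 0)"
    by (auto simp: tanh_defect_def eventually_at_filter)
  ultimately have "(tanh_defect \<longlongrightarrow> - 2/3) (at 0)"
    by (rule Lim_transform_eventually)
  then show ?thesis
    using True by (simp add: isCont_def tanh_defect_def)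
next
  case False
  have "eventually (\<lambda>y. ((1 - (tanh y)\<^sup>2) * y - tanh y) / y ^ 3 = tanh_defect y) (nhds z)"
    by (rule eventually_mono[OF t1_space_nhds[OF False]]) (simp add: tanh_defect_def)
  moreover have "isCont (\<lambda>y. ((1 - (tanh y)\<^sup>2) * y - tanh y) / y ^ 3) z"
    using False by (intro continuous_intros) auto
  ultimately show ?thesis
    by (simp add: isCont_cong)
qed

lemma scaled_tanh_eq:
  assumes "B \<ge> 0"
  shows "scaled_tanh B y = y * (if sqrt B * y = 0 then 1 else tanh (sqrt B * y) / (sqrt B * y))"
  using assms by (auto simp: scaled_tanh_def)

lemma isCont_tanh_ratio: "isCont (\<lambda>z::real. if z = 0 then 1 else tanh z / z) z"
proof (cases "z = 0")
  case True
  have "((\<lambda>z::real. tanh z / z) \<longlongrightarrow> 1) (at 0)"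
    by real_asymp
  moreover have "eventually (\<lambda>z::real. tanh z / z = (if z = 0 then 1 else tanh z / z)) (at 0)"
    by (auto simp: eventually_at_filter)
  ultimately have "((\<lambda>z::real. if z = 0 then 1 else tanh z / z) \<longlongrightarrow> 1) (at 0)"
    by (rule Lim_transform_eventually)
  then show ?thesis
    using True by (simp add: isCont_def)
next
  case False
  have "eventually (\<lambda>y. tanh y / y = (if y = 0 then 1 else tanh y / y)) (nhds z)"
    by (rule eventually_mono[OF t1_space_nhds[OF False]]) simp
  moreover have "isCont (\<lambda>y. tanh y / y) z"
    using False by (intro continuous_intros) auto
  ultimately show ?thesis
    by (simp add: isCont_cong)
qed

lemma continuous_on_scaled_height:
  "continuous_on ({0..} \<times> {0<..}) (\<lambda>z. scaled_height (fst z) (snd z))"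
  using continuous_on_subset[OF continuous_on_primitive_param[OF continuous_on_scaled_climb(1)], of "{0..} \<times> {0<..}"]
  by (simp add: scaled_height_def split_beta Sigma_mono)

lemma continuous_on_scaled_height_B:
  "continuous_on ({0..} \<times> {0<..}) (\<lambda>z. primitive (scaled_climb_B (fst z)) (snd z))"
  using continuous_on_subset[OF continuous_on_primitive_param[OF continuous_on_scaled_climb(2)], of "{0..} \<times> {0<..}"]
  by (simp add: split_beta Sigma_mono)

lemma continuous_on_fb_target:
  "continuous_on ({0..} \<times> {0<..}) (\<lambda>z. fb_target (fst z) (snd z))"
  "continuous_on ({0..} \<times> {0<..}) (\<lambda>z. fb_target_B (fst z) (snd z))"
  "continuous_on ({0..} \<times> {0<..}) (\<lambda>z. fb_target_x (fst z) (snd z))"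
proof -
  have nz: "1 + fst z + fst z * (cosh (snd z))\<^sup>2 \<noteq> 0" "1 + fst z \<noteq> 0" "sinh (snd z) \<noteq> 0" "cosh (snd z) \<noteq> 0"
      "2 * (1 + fst z + fst z * (cosh (snd z))\<^sup>2) \<noteq> 0" "2 * (1 + fst z) \<noteq> 0"
    if "z \<in> {0..} \<times> {0<..}" for z :: "real \<times> real"
    using that cosh_sq_terms_pos[of "fst z" "snd z"] by (auto simp del: distrib_left_numeral)
  show 1: "continuous_on ({0..} \<times> {0<..}) (\<lambda>z. fb_target (fst z) (snd z))"
    unfolding fb_target_def using nz by (intro continuous_intros) auto
  show "continuous_on ({0..} \<times> {0<..}) (\<lambda>z. fb_target_B (fst z) (snd z))"
    unfolding fb_target_B_def using nz
    by (intro continuous_intros 1) (auto simp del: distrib_left_numeral)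
  show "continuous_on ({0..} \<times> {0<..}) (\<lambda>z. fb_target_x (fst z) (snd z))"
    unfolding fb_target_x_def using nz by (intro continuous_intros 1) auto
qed

text \<open>All three functions extend continuously to \<open>B = 0\<close>, since \<open>tanh z / z\<close> and \<open>tanh_defect\<close> are
  continuous at 0.\<close>

lemma continuous_on_scaled_fb:
  "continuous_on ({0..} \<times> {0<..}) (\<lambda>z. scaled_fb (fst z) (snd z))"
  "continuous_on ({0..} \<times> {0<..}) (\<lambda>z. scaled_fb_B (fst z) (snd z))"
  "continuous_on ({0..} \<times> {0<..}) (\<lambda>z. scaled_fb_x (fst z) (snd z))"
proof -
  let ?D = "{0..} \<times> {0<..} :: (real \<times> real) set"
  have z: "continuous_on ?D (\<lambda>z. sqrt (fst z) * scaled_height (fst z) (snd z))"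
    by (intro continuous_intros continuous_on_scaled_height)
  have "continuous_on UNIV (\<lambda>z::real. if z = 0 then 1 else tanh z / z)"
    using isCont_tanh_ratio by (simp add: continuous_on_eq_continuous_at)
  from continuous_on_compose2[OF this z]
  have "continuous_on ?D (\<lambda>z. scaled_height (fst z) (snd z) *
      (if sqrt (fst z) * scaled_height (fst z) (snd z) = 0 then 1
       else tanh (sqrt (fst z) * scaled_height (fst z) (snd z)) / (sqrt (fst z) * scaled_height (fst z) (snd z))))"
    by (intro continuous_on_mult continuous_on_scaled_height) auto
  then have "continuous_on ?D (\<lambda>z. scaled_tanh (fst z) (scaled_height (fst z) (snd z)))"
    by (rule continuous_on_eq) (auto simp: scaled_tanh_eq)
  then show "continuous_on ?D (\<lambda>z. scaled_fb (fst z) (snd z))"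
    unfolding scaled_fb_def by (intro continuous_on_diff continuous_on_fb_target)
  have "continuous_on UNIV tanh_defect"
    using isCont_tanh_defect by (simp add: continuous_on_eq_continuous_at)
  from continuous_on_compose2[OF this z]
  have d: "continuous_on ?D (\<lambda>z. tanh_defect (sqrt (fst z) * scaled_height (fst z) (snd z)))"
    by auto
  have t: "continuous_on ?D (\<lambda>z. tanh (sqrt (fst z) * scaled_height (fst z) (snd z)))"
    using z by (intro continuous_on_tanh) auto
  show "continuous_on ?D (\<lambda>z. scaled_fb_B (fst z) (snd z))"
    unfolding scaled_fb_B_def
    by (intro continuous_on_diff continuous_on_add continuous_on_mult continuous_on_divide continuous_on_power
        continuous_on_const t d continuous_on_scaled_height continuous_on_scaled_height_B continuous_on_fb_target) auto
  have "continuous_on ?D (\<lambda>z. scaled_climb (fst z) (snd z))"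
    using continuous_on_subset[OF continuous_on_scaled_climb(1), of ?D] by (simp add: split_beta Sigma_mono)
  then show "continuous_on ?D (\<lambda>z. scaled_fb_x (fst z) (snd z))"
    unfolding scaled_fb_x_def
    by (intro continuous_on_diff continuous_on_mult continuous_on_power
        continuous_on_const t continuous_on_fb_target)
qed

lemma scaled_height_at_0: "scaled_height 0 x = x"
proof -
  have "scaled_climb 0 = (\<lambda>x. 1)"
    by (simp add: scaled_climb_def fun_eq_iff)
  then show ?thesis
    by (simp add: scaled_height_def primitive_def)
qed

text \<open>The free boundary condition of the critical catenoid.\<close>

lemma scaled_fb_at_0: "scaled_fb 0 x = x - cosh x / sinh x"
  by (simp add: scaled_fb_def scaled_tanh_def scaled_height_at_0 fb_target_def)

lemma primitive_scaled_climb_B_at_0: "primitive (scaled_climb_B 0) x = - (3/4) * (x + sinh x * cosh x)"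
proof -
  have s: "scaled_climb_B 0 = (\<lambda>x. - (3/2) * (cosh x)\<^sup>2)"
    by (simp add: scaled_climb_B_def scaled_climb_def fun_eq_iff field_simps)
  have "- (3/4) * (x + sinh x * cosh x) = primitive (scaled_climb_B 0) x"
    unfolding s
  proof (rule primitive_unique)
    show "((\<lambda>x. - (3/4) * (x + sinh x * cosh x)) has_real_derivative - (3/2) * (cosh x)\<^sup>2) (at x)" for x :: real
      using cosh_square_eq[of x]
      by (auto intro!: derivative_eq_intros simp: power2_eq_square algebra_simps)
  qed (auto intro!: continuous_intros)
  then show ?thesis
    by simp
qed

lemma scaled_fb_B_at_0:
  "scaled_fb_B 0 x = - (3/4) * (x + sinh x * cosh x) - x ^ 3 / 3 + (cosh x) ^ 3 / (2 * sinh x)"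
  by (simp add: scaled_fb_B_def primitive_scaled_climb_B_at_0 scaled_height_at_0 tanh_defect_def fb_target_B_def fb_target_def
      field_simps power3_eq_cube power2_eq_square)

lemma scaled_fb_x_at_0:
  assumes "x > 0"
  shows "scaled_fb_x 0 x = 1 + 1 / (sinh x)\<^sup>2"
  using assms by (simp add: scaled_fb_x_def scaled_climb_def fb_target_x_def fb_target_def power2_eq_square)

lemma arsinh_1_less_sqrt_2: "arsinh (1::real) < sqrt 2"
proof -
  have "arsinh (1::real) = ln (1 + sqrt 2)"
    by (simp add: arsinh_real_def add_ac)
  also have "\<dots> < sqrt 2"
    by (rule ln_add_one_self_less_self) simp
  finally show ?thesis .
qed

text \<open>The bound \<open>sinh x0 > 1\<close> decides the sign of the derivative of \<open>H\<close>. It holds because at the point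
  with \<open>sinh x = 1\<close>, where \<open>coth x = \<surd>2\<close>, the left side \<open>x\<close> is still smaller than the right side.\<close>

lemma euclidean_root:
  obtains x0 where "x0 > 0" "scaled_fb 0 x0 = 0" "sinh x0 > 1"
proof -
  define l where "l = arsinh (1::real)"
  have sl: "sinh l = 1"
    by (simp add: l_def)
  have l0: "l > 0"
    by (simp add: l_def)
  have "(cosh l)\<^sup>2 = 2"
    using sl by (simp add: cosh_square_eq)
  then have "cosh l = sqrt 2"
    by (metis abs_of_pos cosh_real_pos real_sqrt_abs)
  then have fl: "scaled_fb 0 l < 0"
    using arsinh_1_less_sqrt_2 sl by (simp add: scaled_fb_at_0 l_def)
  have "sinh l \<le> sinh 2 \<and> l \<le> 2"
  proof -
    have "l < sqrt 2"
      using arsinh_1_less_sqrt_2 by (simp add: l_def)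
    moreover have "sqrt 2 < (2::real)"
      by (rule real_less_lsqrt) auto
    ultimately have "l \<le> 2" by linarith
    then show ?thesis by simp
  qed
  then have s2: "sinh (2::real) \<ge> 1" "l \<le> 2"
    using sl by auto
  have "(cosh (2::real))\<^sup>2 < (2 * sinh 2)\<^sup>2"
  proof -
    have "1 \<le> (sinh (2::real))\<^sup>2"
      using s2(1) by (simp add: one_le_power)
    then show ?thesis
      unfolding cosh_square_eq power_mult_distrib by simp
  qed
  then have "cosh (2::real) < 2 * sinh 2"
    by (rule power2_less_imp_less) (use s2 in simp)
  then have f2: "scaled_fb 0 2 > 0"
    using s2 by (simp add: scaled_fb_at_0 divide_simps)
  \<comment> \<open>The equation changes sign between \<open>arsinh 1\<close> and 2, since \<open>coth 2 < 2\<close>.\<close>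
  have "\<exists>x\<ge>l. x \<le> 2 \<and> scaled_fb 0 x = 0"
  proof (rule IVT)
    show "\<forall>x. l \<le> x \<and> x \<le> 2 \<longrightarrow> isCont (scaled_fb 0) x"
      using DERIV_isCont[OF scaled_fb_has_real_derivative_x[of 0]] l0 by auto
  qed (use fl f2 s2 in auto)
  then obtain x where x: "x \<ge> l" "scaled_fb 0 x = 0"
    by blast
  have "x \<noteq> l"
    using x(2) fl by auto
  then have "sinh l < sinh x"
    using x(1) by simp
  then show ?thesis
    using that[of x] x l0 sl by simp
qed

section \<open>The free boundary root and the squared ratio near the limit\<close>

definition scaled_fb_root :: "real \<Rightarrow> real" where
  "scaled_fb_root B = (THE x. x > 0 \<and> scaled_fb B x = 0)"

lemma scaled_fb_root_eqI:
  assumes "B \<ge> 0" "x > 0" "scaled_fb B x = 0"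
  shows "scaled_fb_root B = x"
  unfolding scaled_fb_root_def
proof (rule the_equality)
  fix y assume y: "y > 0 \<and> scaled_fb B y = 0"
  have "inj_on (scaled_fb B) {0<..}"
    by (rule strict_mono_on_imp_inj_on[OF scaled_fb_strict_mono[OF assms(1)]])
  from inj_onD[OF this, of y x] show "y = x"
    using y assms by simp
qed (use assms in simp)

lemma scaled_fb_tendsto_B:
  assumes "x > 0" "a \<ge> 0"
  shows "((\<lambda>B. scaled_fb B x) \<longlongrightarrow> scaled_fb a x) (at a within {0..})"
proof -
  have "continuous_on {0..} (\<lambda>B. scaled_fb B x)"
    by (rule continuous_on_compose2[OF continuous_on_scaled_fb(1), of "{0..}" "\<lambda>B. (B, x)", simplified])
       (use assms in \<open>auto intro!: continuous_intros\<close>)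
  then show ?thesis
    using assms by (auto simp: continuous_on_def)
qed

text \<open>The sign change of the Euclidean equation around its root survives for small \<open>B\<close>.\<close>

lemma eventually_scaled_fb_root:
  "eventually (\<lambda>B. scaled_fb_root B > 0 \<and> scaled_fb B (scaled_fb_root B) = 0) (at_right 0)"
proof -
  obtain x0 where x0: "x0 > 0" "scaled_fb 0 x0 = 0"
    by (rule euclidean_root)
  have "scaled_fb 0 (x0 / 2) < scaled_fb 0 x0" "scaled_fb 0 x0 < scaled_fb 0 (2 * x0)"
    using x0(1) by (intro strict_mono_onD[OF scaled_fb_strict_mono]; simp)+
  then have "eventually (\<lambda>B. scaled_fb B (x0 / 2) < 0) (at 0 within {0..})"
      "eventually (\<lambda>B. scaled_fb B (2 * x0) > 0) (at 0 within {0..})"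
    using x0 order_tendstoD[OF scaled_fb_tendsto_B] by auto
  then have "eventually (\<lambda>B. scaled_fb B (x0 / 2) < 0) (at_right 0)"
      "eventually (\<lambda>B. scaled_fb B (2 * x0) > 0) (at_right 0)"
    by (simp_all add: at_within_Ici_at_right)
  moreover have "eventually (\<lambda>B::real. B > 0) (at_right 0)"
    by (simp add: eventually_at_right_less)
  ultimately show ?thesis
  proof eventually_elim
    case (elim B)
    have "\<exists>x\<ge>x0 / 2. x \<le> 2 * x0 \<and> scaled_fb B x = 0"
    proof (rule IVT)
      show "\<forall>x. x0 / 2 \<le> x \<and> x \<le> 2 * x0 \<longrightarrow> isCont (scaled_fb B) x"
        using DERIV_isCont[OF scaled_fb_has_real_derivative_x[of B]] elim x0 by auto
    qed (use elim x0 in auto)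
    then obtain x where "x \<ge> x0 / 2" "scaled_fb B x = 0"
      by blast
    then have "x > 0" "scaled_fb B x = 0"
      using x0 by auto
    then show ?case
      using scaled_fb_root_eqI[of B x] elim by simp
  qed
qed

lemma scaled_fb_root_tendsto:
  assumes "x0 > 0" "scaled_fb 0 x0 = 0"
  shows "(scaled_fb_root \<longlongrightarrow> x0) (at_right 0)"
proof -
  have "(scaled_fb_root \<longlongrightarrow> x0) (at 0 within {0..})"
    by (rule strict_mono_root_tendsto[where F = scaled_fb])
       (use assms eventually_scaled_fb_root scaled_fb_tendsto_B[of _ 0]
         in \<open>auto simp: scaled_fb_strict_mono at_within_Ici_at_right\<close>)
  then show ?thesis
    by (simp add: at_within_Ici_at_right)
qed

lemma scaled_fb_root_has_real_derivative:
  assumes root: "\<And>B. 0 < B \<Longrightarrow> B < \<beta> \<Longrightarrow> scaled_fb_root B > 0 \<and> scaled_fb B (scaled_fb_root B) = 0"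
    and B: "0 < B" "B < \<beta>"
  shows "(scaled_fb_root has_real_derivative - scaled_fb_B B (scaled_fb_root B) / scaled_fb_x B (scaled_fb_root B)) (at B)"
proof (rule implicit_root_has_real_derivative[where U = "{0<..<\<beta>}" and F = scaled_fb])
  have pos: "scaled_fb_root B > 0"
    using root B by blast
  show "((\<lambda>p. scaled_fb p (scaled_fb_root B)) has_real_derivative scaled_fb_B B (scaled_fb_root B)) (at B)"
    by (rule scaled_fb_has_real_derivative_B[OF B(1) pos])
  have "open ({0<..} \<times> {0<..} :: (real \<times> real) set)"
    by (intro open_Times open_greaterThan)
  moreover have "continuous_on ({0<..} \<times> {0<..}) (\<lambda>(B, x). scaled_fb_x B x)"
    using continuous_on_subset[OF continuous_on_scaled_fb(3), of "{0<..} \<times> {0<..}"]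
    by (simp add: split_beta Sigma_mono greaterThan_subset_iff subset_iff)
  ultimately show "isCont (\<lambda>(B, x). scaled_fb_x B x) (B, scaled_fb_root B)"
    using B(1) pos by (auto simp: continuous_on_eq_continuous_at)
  have at: "at B within {0<..<\<beta>} = at B"
    using B by (intro at_within_open) auto
  have "(scaled_fb_root \<longlongrightarrow> scaled_fb_root B) (at B within {0<..<\<beta>})"
  proof (rule strict_mono_root_tendsto[where F = scaled_fb])
    show "((\<lambda>p. scaled_fb p x) \<longlongrightarrow> scaled_fb B x) (at B within {0<..<\<beta>})" if "x > 0" for x
      by (rule tendsto_within_subset[OF scaled_fb_tendsto_B]) (use that B in auto)
    show "eventually (\<lambda>p. scaled_fb_root p > 0 \<and> scaled_fb p (scaled_fb_root p) = 0) (at B within {0<..<\<beta>})"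
      using root by (simp add: eventually_at_filter)
  qed (use B root in \<open>auto simp: scaled_fb_strict_mono\<close>)
  then show "(scaled_fb_root \<longlongrightarrow> scaled_fb_root B) (at B)"
    by (simp add: at)
  show "scaled_fb_x B (scaled_fb_root B) \<noteq> 0"
    using scaled_fb_x_pos[of B "scaled_fb_root B"] B pos by simp
qed (use B root in \<open>auto simp: scaled_fb_has_real_derivative_x\<close>)

text \<open>\<open>H\<^sup>2 = sinh\<^sup>2 r / K\<^sup>2\<close> in the scaled parameter \<open>x\<close> of the free boundary.\<close>

definition H_sq :: "real \<Rightarrow> real \<Rightarrow> real" where
  "H_sq B x = (cosh x) ^ 4 / (((sinh x)\<^sup>2 - B) * (1 + B))"

text \<open>The derivative of \<open>H_sq\<close> along the curve of roots, whose slope is \<open>- scaled_fb_B / scaled_fb_x\<close>.\<close>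

definition H_sq_rate :: "real \<Rightarrow> real \<Rightarrow> real" where
  "H_sq_rate B x = H_sq B x *
     ((4 * sinh x / cosh x - 2 * sinh x * cosh x / ((sinh x)\<^sup>2 - B)) * (- scaled_fb_B B x / scaled_fb_x B x)
      + (1 / ((sinh x)\<^sup>2 - B) - 1 / (1 + B)))"

lemma H_sq_has_real_derivative:
  assumes g: "(g has_real_derivative - scaled_fb_B B (g B) / scaled_fb_x B (g B)) (at B)"
    and B: "B > 0" "(sinh (g B))\<^sup>2 > B"
  shows "((\<lambda>B. H_sq B (g B)) has_real_derivative H_sq_rate B (g B)) (at B)"
proof -
  define g' S C where "g' = - scaled_fb_B B (g B) / scaled_fb_x B (g B)" and "S = sinh (g B)" and "C = cosh (g B)"
  have nz: "S\<^sup>2 - B \<noteq> 0" "1 + B \<noteq> 0" "C \<noteq> 0"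
    using B by (auto simp: S_def C_def)
  note g = g[folded g'_def]
  have dS: "((\<lambda>B. sinh (g B)) has_real_derivative C * g') (at B)"
    unfolding C_def by (rule DERIV_chain2[OF _ g]) (auto intro!: derivative_eq_intros)
  have dC: "((\<lambda>B. cosh (g B)) has_real_derivative S * g') (at B)"
    unfolding S_def by (rule DERIV_chain2[OF _ g]) (auto intro!: derivative_eq_intros)
  have d1: "((\<lambda>B. (cosh (g B)) ^ 4) has_real_derivative 4 * C ^ 3 * (S * g')) (at B)"
    by (rule DERIV_cong[OF DERIV_power[OF dC]]) (simp add: C_def)
  have d2: "((\<lambda>B. ((sinh (g B))\<^sup>2 - B) * (1 + B)) has_real_derivative
      (2 * S * (C * g') - 1) * (1 + B) + (S\<^sup>2 - B)) (at B)"
    by (rule DERIV_cong, (rule DERIV_mult DERIV_diff DERIV_power dS DERIV_ident DERIV_add DERIV_const)+)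
       (simp add: S_def)
  have "((\<lambda>B. H_sq B (g B)) has_real_derivative
      (4 * C ^ 3 * (S * g') * ((S\<^sup>2 - B) * (1 + B)) - C ^ 4 * ((2 * S * (C * g') - 1) * (1 + B) + (S\<^sup>2 - B)))
        / (((S\<^sup>2 - B) * (1 + B)) * ((S\<^sup>2 - B) * (1 + B)))) (at B)"
    unfolding H_sq_def using DERIV_divide[OF d1 d2] nz by (simp add: S_def C_def)
  moreover have "(4 * C ^ 3 * (S * g') * (U * V) - C ^ 4 * ((2 * S * (C * g') - 1) * V + U)) / ((U * V) * (U * V))
      = C ^ 4 / (U * V) * ((4 * S / C - 2 * S * C / U) * g' + (1 / U - 1 / V))"
    if "U \<noteq> 0" "V \<noteq> 0" for U V
    using that nz(3) by (simp add: field_simps power_numeral_reduce)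
  ultimately show ?thesis
    using nz unfolding H_sq_rate_def H_sq_def S_def[symmetric] C_def[symmetric] g'_def[symmetric] by simp
qed

text \<open>In terms of \<open>p = 1/sinh\<^sup>2 x\<close>, for which \<open>x\<^sup>2 = 1 + p\<close>, the slope of the curve of roots at \<open>B = 0\<close> is
  \<open>x (1/(4p) + 1/3)\<close>, and the logarithmic derivative of \<open>H\<^sup>2\<close> along it factors as
  \<open>(1 - p) (1/(2p) - 1/3)\<close>.\<close>

lemma H_sq_rate_at_0_pos:
  assumes x: "x > 0" "scaled_fb 0 x = 0" "sinh x > 1"
  shows "H_sq_rate 0 x > 0"
proof -
  define S p where "S = sinh x" and "p = 1 / S\<^sup>2"
  have S: "S > 1" "S > 0"
    using x by (auto simp: S_def)
  have C: "cosh x = x * S"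
    using x(2) S by (simp add: scaled_fb_at_0 S_def field_simps)
  have p: "p > 0" "p < 1"
    using S one_less_power[of S 2] by (auto simp: p_def)
  have "(x * S)\<^sup>2 = S\<^sup>2 + 1"
    using cosh_square_eq[of x] by (simp add: C S_def)
  then have xp: "x\<^sup>2 = 1 + p"
    using S by (simp add: p_def field_simps)
  have S2: "S\<^sup>2 = 1 / p"
    by (simp add: p_def)
  have "scaled_fb_B 0 x = x * (- (3/4) * (1 + S\<^sup>2) - x\<^sup>2 / 3 + x\<^sup>2 * S\<^sup>2 / 2)"
    using S by (simp add: scaled_fb_B_at_0 x C S_def[symmetric] field_simps power3_eq_cube power2_eq_square)
  also have "\<dots> = - (x * (1 + p) * (1 / (4 * p) + 1 / 3))"
    unfolding S2 xp using p by (simp add: field_simps)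
  finally have "- scaled_fb_B 0 x / scaled_fb_x 0 x = x * (1 / (4 * p) + 1 / 3)"
    using p by (simp add: scaled_fb_x_at_0 x S_def[symmetric] p_def[symmetric])
  moreover have "4 * sinh x / cosh x - 2 * sinh x * cosh x / ((sinh x)\<^sup>2 - 0) = 4 / x - 2 * x"
    using S by (simp add: C S_def[symmetric] power2_eq_square)
  moreover have "(4 / x - 2 * x) * (x * (1 / (4 * p) + 1 / 3)) + (1 / ((sinh x)\<^sup>2 - 0) - 1 / (1 + 0))
      = (1 - p) * (1 / (2 * p) - 1 / 3)"
  proof -
    have "(4 / x - 2 * x) * (x * (1 / (4 * p) + 1 / 3)) = (4 - 2 * x\<^sup>2) * (1 / (4 * p) + 1 / 3)"
      using x by (simp add: field_simps power2_eq_square)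
    also have "\<dots> + (p - 1) = (1 - p) * (1 / (2 * p) - 1 / 3)"
      unfolding xp using p by (simp add: field_simps)
    finally show ?thesis
      by (simp add: S_def[symmetric] p_def[symmetric])
  qed
  ultimately have "H_sq_rate 0 x = H_sq 0 x * ((1 - p) * (1 / (2 * p) - 1 / 3))"
    by (simp only: H_sq_rate_def)
  moreover have "H_sq 0 x > 0"
    using x by (simp add: H_sq_def)
  moreover have "1 / (2 * p) > 1 / 3"
    using p by (simp add: field_simps)
  ultimately show ?thesis
    using p by simp
qed

lemma H_sq_rate_tendsto:
  assumes x: "x > 0" and X: "(X \<longlongrightarrow> x) (at_right 0)"
  shows "((\<lambda>B. H_sq_rate B (X B)) \<longlongrightarrow> H_sq_rate 0 x) (at_right 0)"
proof -
  have pair: "((\<lambda>B. (B, X B)) \<longlongrightarrow> (0, x)) (at_right 0)"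
    by (intro tendsto_Pair X tendsto_ident_at)
  have "eventually (\<lambda>B. X B > 0) (at_right 0)"
    using order_tendstoD(1)[OF X x] .
  then have ev: "eventually (\<lambda>B. (B, X B) \<in> {0..} \<times> {0<..}) (at_right 0)"
    using eventually_at_right_less[of 0] by eventually_elim auto
  have 1: "((\<lambda>B. scaled_fb_B B (X B)) \<longlongrightarrow> scaled_fb_B 0 x) (at_right 0)"
    using continuous_on_tendsto_compose[OF continuous_on_scaled_fb(2) pair _ ev] x by simp
  have 2: "((\<lambda>B. scaled_fb_x B (X B)) \<longlongrightarrow> scaled_fb_x 0 x) (at_right 0)"
    using continuous_on_tendsto_compose[OF continuous_on_scaled_fb(3) pair _ ev] x by simp
  have "scaled_fb_x 0 x \<noteq> 0"
    using scaled_fb_x_pos[of 0 x] x by simp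
  then show ?thesis
    unfolding H_sq_rate_def H_sq_def using x
    by (intro tendsto_intros 1 2 X) auto
qed

text \<open>Strict inequalities at the Euclidean root persist for all sufficiently small \<open>B\<close>.\<close>

lemma euclidean_scale_range:
  obtains \<beta> where "\<beta> > 0"
    and "\<And>B. 0 < B \<Longrightarrow> B < \<beta> \<Longrightarrow> scaled_fb_root B > 0 \<and> scaled_fb B (scaled_fb_root B) = 0 \<and>
      (scaled_fb_root has_real_derivative - scaled_fb_B B (scaled_fb_root B) / scaled_fb_x B (scaled_fb_root B)) (at B) \<and>
      B < (sinh (scaled_fb_root B))\<^sup>2 \<and> H_sq_rate B (scaled_fb_root B) > 0"
proof -
  obtain x0 where x0: "x0 > 0" "scaled_fb 0 x0 = 0" "sinh x0 > 1"
    by (rule euclidean_root)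
  note lim = scaled_fb_root_tendsto[OF x0(1,2)]
  have "((\<lambda>B. (sinh (scaled_fb_root B))\<^sup>2 - B) \<longlongrightarrow> (sinh x0)\<^sup>2 - 0) (at_right 0)"
    by (intro tendsto_intros lim)
  then have "eventually (\<lambda>B. (sinh (scaled_fb_root B))\<^sup>2 - B > 0) (at_right 0)"
    by (rule order_tendstoD(1)) (use x0(1) in simp)
  then have "eventually (\<lambda>B. (scaled_fb_root B > 0 \<and> scaled_fb B (scaled_fb_root B) = 0) \<and>
      (sinh (scaled_fb_root B))\<^sup>2 - B > 0 \<and> H_sq_rate B (scaled_fb_root B) > 0) (at_right 0)"
    using eventually_scaled_fb_root order_tendstoD(1)[OF H_sq_rate_tendsto[OF x0(1) lim] H_sq_rate_at_0_pos[OF x0]]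
    by eventually_elim simp
  then obtain \<beta> where "\<beta> > 0" and \<beta>: "\<And>B. 0 < B \<Longrightarrow> B < \<beta> \<Longrightarrow>
      (scaled_fb_root B > 0 \<and> scaled_fb B (scaled_fb_root B) = 0) \<and>
      (sinh (scaled_fb_root B))\<^sup>2 - B > 0 \<and> H_sq_rate B (scaled_fb_root B) > 0"
    by (auto simp: eventually_at_right_field)
  have root: "scaled_fb_root B > 0 \<and> scaled_fb B (scaled_fb_root B) = 0" if "0 < B" "B < \<beta>" for B
    using \<beta>[OF that] by blast
  show ?thesis
  proof (rule that[OF \<open>\<beta> > 0\<close>])
    fix B assume B: "0 < B" "B < \<beta>"
    show "scaled_fb_root B > 0 \<and> scaled_fb B (scaled_fb_root B) = 0 \<and>
      (scaled_fb_root has_real_derivative - scaled_fb_B B (scaled_fb_root B) / scaled_fb_x B (scaled_fb_root B)) (at B) \<and>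
      B < (sinh (scaled_fb_root B))\<^sup>2 \<and> H_sq_rate B (scaled_fb_root B) > 0"
      using \<beta>[OF B] scaled_fb_root_has_real_derivative[OF root B] by auto
  qed
qed

section \<open>The free boundary parameter and the radius\<close>

text \<open>The arclength parameter \<open>s\<close> with scaled parameter \<open>x\<close>; in it \<open>b = \<surd>B cosh x\<close>, as for a catenoid of
  neck radius \<open>\<surd>B\<close>.\<close>

definition profile_parameter :: "real \<Rightarrow> real \<Rightarrow> real" where
  "profile_parameter a x = arsinh (sqrt ((a - 1/2) / (2 * a)) * sinh x)"

lemma sinh_profile_parameter: "sinh (profile_parameter a x) = sqrt ((a - 1/2) / (2 * a)) * sinh x"
  by (simp add: profile_parameter_def)

lemma profile_parameter_pos: "a > 1/2 \<Longrightarrow> x > 0 \<Longrightarrow> profile_parameter a x > 0"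
  by (simp add: profile_parameter_def)

lemma profile_parameter_surj:
  assumes "a > 1/2" "s > 0"
  obtains x where "x > 0" "profile_parameter a x = s"
proof
  define l where "l = sqrt ((a - 1/2) / (2 * a))"
  have l: "l > 0"
    using assms by (simp add: l_def)
  show "arsinh (sinh s / l) > 0" "profile_parameter a (arsinh (sinh s / l)) = s"
    unfolding profile_parameter_def l_def[symmetric] using l assms by (simp_all add: arsinh_sinh_real)
qed

lemma cosh_profile_parameter:
  assumes "a > 1/2"
  shows "sqrt (2 * a) * cosh (profile_parameter a x) = sqrt (1 + (a - 1/2) + (a - 1/2) * (cosh x)\<^sup>2)"
proof -
  have "(cosh (profile_parameter a x))\<^sup>2 = 1 + (a - 1/2) / (2 * a) * (sinh x)\<^sup>2"
    using assms by (simp add: cosh_square_eq sinh_profile_parameter power_mult_distrib)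
  then have "(sqrt (2 * a) * cosh (profile_parameter a x))\<^sup>2 = 1 + (a - 1/2) + (a - 1/2) * (cosh x)\<^sup>2"
    using assms by (simp add: power_mult_distrib cosh_square_eq field_simps)
  then show ?thesis
    using assms by (intro real_sqrt_unique[symmetric]) auto
qed

lemma prof_profile_parameter:
  assumes "a > 1/2"
  shows "prof a (profile_parameter a x) = sqrt (a - 1/2) * cosh x"
proof -
  have "a * cosh (2 * profile_parameter a x) - 1/2 = a * (1 + 2 * (sinh (profile_parameter a x))\<^sup>2) - 1/2"
    by (simp add: cosh_double cosh_square_eq)
  also have "\<dots> = (a - 1/2) * (cosh x)\<^sup>2"
    using assms by (simp add: sinh_profile_parameter power_mult_distrib cosh_square_eq field_simps)
  finally show ?thesis
    by (simp add: prof_def real_sqrt_mult)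
qed

lemma mori_K_eq: "mori_K a = sqrt (a - 1/2) * sqrt (1 + (a - 1/2))"
proof -
  have "a\<^sup>2 - 1/4 = (a - 1/2) * (1 + (a - 1/2))"
    by (simp add: power2_eq_square field_simps)
  then show ?thesis
    by (simp add: mori_K_def real_sqrt_mult)
qed

lemma slope_profile_parameter:
  assumes "a > 1/2"
  shows "slope a (profile_parameter a x) = sinh x * sqrt (1 + (a - 1/2) + (a - 1/2) * (cosh x)\<^sup>2) / cosh x"
proof -
  define w where "w = sqrt (a - 1/2)"
  have w: "w \<noteq> 0"
    using assms by (simp add: w_def)
  have "a * sinh (2 * profile_parameter a x) = (sqrt (2 * a))\<^sup>2 * (w / sqrt (2 * a) * sinh x) * cosh (profile_parameter a x)"
    using assms by (simp add: sinh_double sinh_profile_parameter real_sqrt_divide w_def)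
  also have "\<dots> = w * sinh x * (sqrt (2 * a) * cosh (profile_parameter a x))"
    using assms by (simp add: power2_eq_square divide_simps)
  finally show ?thesis
    unfolding cosh_profile_parameter[OF assms] slope_def prof_profile_parameter[OF assms] w_def[symmetric] using w by simp
qed

lemma mori_t_profile_parameter:
  assumes a: "a > 1/2"
  shows "mori_t a (profile_parameter a x) = sqrt (a - 1/2) * scaled_height (a - 1/2) x"
proof -
  define w where "w = sqrt (a - 1/2)"
  have w: "w > 0"
    using a by (simp add: w_def)
  have B: "a - 1/2 \<ge> 0"
    using a by simp
  have "(\<lambda>x. mori_t a (profile_parameter a x)) x = primitive (\<lambda>x. w * scaled_climb (a - 1/2) x) x"
  proof (rule primitive_unique)
    fix x
    define l E where "l = sqrt ((a - 1/2) / (2 * a))" and "E = sqrt (1 + (a - 1/2) + (a - 1/2) * (cosh x)\<^sup>2)"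
    have l: "l = w / sqrt (2 * a)"
      by (simp add: l_def w_def real_sqrt_divide)
    have cs: "sqrt ((l * sinh x)\<^sup>2 + 1) = cosh (profile_parameter a x)"
      by (simp add: profile_parameter_def l_def cosh_arsinh_real)
    have "(profile_parameter a has_real_derivative 1 / sqrt ((l * sinh x)\<^sup>2 + 1) * (l * cosh x)) (at x)"
      unfolding profile_parameter_def[abs_def] l_def[symmetric]
      by (rule DERIV_chain2[OF arsinh_real_has_field_derivative]) (auto intro!: derivative_eq_intros)
    then have "(profile_parameter a has_real_derivative l * cosh x / cosh (profile_parameter a x)) (at x)"
      unfolding cs by simp
    from DERIV_chain2[OF has_real_derivative_primitive[OF continuous_on_climb[OF a]] this]
    have "((\<lambda>x. mori_t a (profile_parameter a x)) has_real_derivative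
        climb a (profile_parameter a x) * (l * cosh x / cosh (profile_parameter a x))) (at x)"
      by (simp add: mori_t_eq[OF a])
    moreover have "l * cosh x / cosh (profile_parameter a x) = w * cosh x / E"
      using a cosh_profile_parameter[OF a, of x] by (simp add: l E_def)
    moreover have "climb a (profile_parameter a x) = sqrt (1 + (a - 1/2)) / (cosh x * (1 + (a - 1/2) * (cosh x)\<^sup>2))"
      using w a by (simp add: climb_def prof_profile_parameter[OF a] mori_K_eq w_def[symmetric] power_mult_distrib)
        (simp add: w_def)
    moreover have "\<dots> * (w * cosh x / E) = w * scaled_climb (a - 1/2) x"
      by (simp add: scaled_climb_def E_def)
    ultimately show "((\<lambda>x. mori_t a (profile_parameter a x)) has_real_derivative w * scaled_climb (a - 1/2) x) (at x)"
      by simp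
  next
    show "mori_t a (profile_parameter a 0) = 0"
      by (simp add: mori_t_eq[OF a] profile_parameter_def)
    show "continuous_on UNIV (\<lambda>x. w * scaled_climb (a - 1/2) x)"
      by (intro continuous_intros continuous_on_scaled_climb_slice B)
  qed
  also have "\<dots> = w * scaled_height (a - 1/2) x"
  proof (rule sym, rule primitive_unique)
    show "((\<lambda>x. w * scaled_height (a - 1/2) x) has_real_derivative w * scaled_climb (a - 1/2) x) (at x)" for x
      by (intro DERIV_cmult scaled_height_has_real_derivative B)
  qed (auto simp: scaled_height_def intro!: continuous_intros continuous_on_scaled_climb_slice B)
  finally show ?thesis
    by (simp add: w_def)
qed

lemma free_boundary_iff_scaled_fb:
  assumes a: "a > 1/2" and x: "x > 0"
  shows "slope a (profile_parameter a x) * sinh (mori_t a (profile_parameter a x)) = mori_K a * cosh (mori_t a (profile_parameter a x))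
     \<longleftrightarrow> scaled_fb (a - 1/2) x = 0"
proof -
  define w t p where "w = sqrt (a - 1/2)" and "t = w * scaled_height (a - 1/2) x" and "p = slope a (profile_parameter a x)"
  have w: "w > 0"
    using a by (simp add: w_def)
  have p: "p > 0"
    using slope_pos[OF a profile_parameter_pos[OF a x]] by (simp add: p_def)
  have K: "mori_K a / p = w * fb_target (a - 1/2) x"
    by (simp add: p_def slope_profile_parameter[OF a] mori_K_eq fb_target_def w_def)
  have "scaled_tanh (a - 1/2) (scaled_height (a - 1/2) x) = tanh t / w"
    using a by (simp add: scaled_tanh_def t_def w_def)
  moreover have "p * sinh t = mori_K a * cosh t \<longleftrightarrow> tanh t = w * fb_target (a - 1/2) x"
    unfolding K[symmetric] using p by (simp add: tanh_def field_simps)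
  ultimately show ?thesis
    unfolding mori_t_profile_parameter[OF a] w_def[symmetric] t_def[symmetric] p_def[symmetric] scaled_fb_def
    using w by (simp add: divide_eq_eq mult.commute)
qed

lemma mori_s0_eq:
  assumes a: "a > 1/2" and x: "x > 0" "scaled_fb (a - 1/2) x = 0"
  shows "mori_s0 a = profile_parameter a x"
  unfolding mori_s0_def
proof (rule the_equality)
  have d: "deriv (mori_b a) s = slope a s" for s
    unfolding mori_b_eq[OF a] by (rule DERIV_imp_deriv[OF prof_has_real_derivative[OF a]])
  show "profile_parameter a x > 0 \<and> deriv (mori_b a) (profile_parameter a x) * sinh (mori_t a (profile_parameter a x))
      = mori_K a * cosh (mori_t a (profile_parameter a x))"
    using free_boundary_iff_scaled_fb[OF a x(1)] x(2) profile_parameter_pos[OF a x(1)] by (simp add: d)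
  fix s assume s: "s > 0 \<and> deriv (mori_b a) s * sinh (mori_t a s) = mori_K a * cosh (mori_t a s)"
  then obtain y where y: "y > 0" "profile_parameter a y = s"
    using profile_parameter_surj[OF a] by blast
  then have "scaled_fb (a - 1/2) y = 0"
    using free_boundary_iff_scaled_fb[OF a y(1)] s by (simp add: d)
  then have "scaled_fb_root (a - 1/2) = y" "scaled_fb_root (a - 1/2) = x"
    using a x y by (auto intro!: scaled_fb_root_eqI)
  then show "s = profile_parameter a x"
    using y by simp
qed

text \<open>At a free boundary point \<open>tanh t = K / b'\<close>, so \<open>cosh\<^sup>2 t = b'\<^sup>2 / (b'\<^sup>2 - K\<^sup>2)\<close>, and
  \<open>b'\<^sup>2 - K\<^sup>2 = (1 + b\<^sup>2) (b\<^sup>2 - K\<^sup>2) / b\<^sup>2\<close>. The elliptic integral \<open>t\<close> thus disappears from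
  \<open>sinh\<^sup>2 r = (1 + b\<^sup>2) cosh\<^sup>2 t - 1\<close>.\<close>

lemma free_boundary_radius:
  assumes a: "a > 1/2" and scaled_fb: "slope a s * sinh t = mori_K a * cosh t"
  shows "(mori_K a)\<^sup>2 < (prof a s)\<^sup>2"
    and "(1 + (prof a s)\<^sup>2) * (cosh t)\<^sup>2 - 1 = (prof a s) ^ 4 / ((prof a s)\<^sup>2 - (mori_K a)\<^sup>2)"
proof -
  define b K p c where "b = prof a s" and "K = mori_K a" and "p = slope a s" and "c = cosh t"
  have b: "b > 0" and K: "K > 0" and c: "c \<ge> 1"
    using a mori_K_pos cosh_real_ge_1[of t] by (auto simp: b_def K_def c_def)
  have p2: "p\<^sup>2 = 1 + b\<^sup>2 - K\<^sup>2 / b\<^sup>2"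
    using slope_sq[OF a] by (simp add: p_def b_def K_def)
  have "p\<^sup>2 * (c\<^sup>2 - 1) = K\<^sup>2 * c\<^sup>2"
    using arg_cong[OF scaled_fb, of "\<lambda>x. x\<^sup>2"]
    by (simp add: power_mult_distrib sinh_square_eq p_def K_def c_def)
  then have 1: "c\<^sup>2 * (p\<^sup>2 - K\<^sup>2) = p\<^sup>2"
    by (simp add: algebra_simps)
  have "K\<^sup>2 * c\<^sup>2 > 0"
    using K c by simp
  then have "p \<noteq> 0"
    using \<open>p\<^sup>2 * (c\<^sup>2 - 1) = K\<^sup>2 * c\<^sup>2\<close> by auto
  then have "c\<^sup>2 * (p\<^sup>2 - K\<^sup>2) > 0"
    using 1 by simp
  then have pos: "p\<^sup>2 - K\<^sup>2 > 0"
    by (simp add: zero_less_mult_iff)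
  have fac: "(p\<^sup>2 - K\<^sup>2) * b\<^sup>2 = (1 + b\<^sup>2) * (b\<^sup>2 - K\<^sup>2)"
    unfolding p2 using b by (simp add: field_simps)
  have "(1 + b\<^sup>2) * (b\<^sup>2 - K\<^sup>2) > 0"
    unfolding fac[symmetric] using pos b by simp
  then have bK: "b\<^sup>2 - K\<^sup>2 > 0"
    using b by (simp add: zero_less_mult_iff not_less[symmetric])
       (smt (verit) zero_le_power2)
  then show "(mori_K a)\<^sup>2 < (prof a s)\<^sup>2"
    by (simp add: b_def K_def)
  have "p\<^sup>2 * b\<^sup>2 = b\<^sup>2 + b\<^sup>2 * b\<^sup>2 - K\<^sup>2"
    unfolding p2 using b by (simp add: field_simps)
  moreover have "c\<^sup>2 * ((1 + b\<^sup>2) * (b\<^sup>2 - K\<^sup>2)) = p\<^sup>2 * b\<^sup>2"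
    unfolding fac[symmetric] using 1 by simp
  ultimately have "((1 + b\<^sup>2) * c\<^sup>2 - 1) * (b\<^sup>2 - K\<^sup>2) = b ^ 4"
    by (simp add: algebra_simps power_numeral_reduce)
  then show "(1 + (prof a s)\<^sup>2) * (cosh t)\<^sup>2 - 1 = (prof a s) ^ 4 / ((prof a s)\<^sup>2 - (mori_K a)\<^sup>2)"
    using bK by (simp add: b_def K_def c_def field_simps)
qed

lemma mori_r_eq:
  "a > 1/2 \<Longrightarrow> mori_r a = arcosh (sqrt (1 + (prof a (mori_s0 a))\<^sup>2) * cosh (mori_t a (mori_s0 a)))"
  by (simp add: mori_r_def dist_p0_def mori_surface_def mori_u_def cosh_arsinh_real mori_b_eq add_ac)

lemma cosh_mori_r:
  assumes "a > 1/2"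
  shows "mori_r a \<ge> 0" "cosh (mori_r a) = sqrt (1 + (prof a (mori_s0 a))\<^sup>2) * cosh (mori_t a (mori_s0 a))"
proof -
  have "1 * 1 \<le> sqrt (1 + (prof a (mori_s0 a))\<^sup>2) * cosh (mori_t a (mori_s0 a))"
    using cosh_real_ge_1 by (intro mult_mono) auto
  then show "mori_r a \<ge> 0" "cosh (mori_r a) = sqrt (1 + (prof a (mori_s0 a))\<^sup>2) * cosh (mori_t a (mori_s0 a))"
    unfolding mori_r_eq[OF assms] by (simp_all add: arcosh_nonneg_real cosh_arcosh_real)
qed

lemma sinh_mori_r:
  assumes a: "a > 1/2" and x: "x > 0" "scaled_fb (a - 1/2) x = 0"
  shows "sinh (mori_r a) = mori_K a * sqrt (H_sq (a - 1/2) x)"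
proof -
  define B where "B = a - 1/2"
  have B: "B > 0"
    using a by (simp add: B_def)
  note s0 = mori_s0_eq[OF a x]
  have "slope a (mori_s0 a) * sinh (mori_t a (mori_s0 a)) = mori_K a * cosh (mori_t a (mori_s0 a))"
    unfolding s0 using free_boundary_iff_scaled_fb[OF a x(1)] x(2) by simp
  note rad = free_boundary_radius[OF a this]
  have b2: "(prof a (mori_s0 a))\<^sup>2 = B * (cosh x)\<^sup>2"
    unfolding s0 prof_profile_parameter[OF a] using B by (simp add: power_mult_distrib B_def)
  have K2: "(mori_K a)\<^sup>2 = B * (1 + B)"
    using mori_K_sq[OF a] by (simp add: B_def power2_eq_square field_simps)
  have d: "B * (cosh x)\<^sup>2 - B * (1 + B) = B * ((sinh x)\<^sup>2 - B)"
    by (simp add: cosh_square_eq algebra_simps)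
  have pos: "(sinh x)\<^sup>2 - B > 0"
    using rad(1) B unfolding b2 K2 by (simp add: cosh_square_eq)
  have "(sinh (mori_r a))\<^sup>2 = (1 + (prof a (mori_s0 a))\<^sup>2) * (cosh (mori_t a (mori_s0 a)))\<^sup>2 - 1"
    by (simp add: sinh_square_eq cosh_mori_r[OF a] power_mult_distrib)
  also have "\<dots> = (B * (cosh x)\<^sup>2)\<^sup>2 / (B * ((sinh x)\<^sup>2 - B))"
    unfolding rad(2) K2 d[symmetric] b2[symmetric] by simp
  also have "\<dots> = (mori_K a)\<^sup>2 * H_sq B x"
  proof -
    have "(B * c)\<^sup>2 / (B * e) = B * f * (c\<^sup>2 / (e * f))" if "B \<noteq> 0" "e \<noteq> 0" "f \<noteq> 0" for c e f :: real
      using that by (simp add: power2_eq_square)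
    from this[of "(sinh x)\<^sup>2 - B" "1 + B" "(cosh x)\<^sup>2"] show ?thesis
      unfolding K2 H_sq_def using B pos by (simp flip: power_mult)
  qed
  finally have "(sinh (mori_r a))\<^sup>2 = (mori_K a * sqrt (H_sq B x))\<^sup>2"
    using pos B by (simp add: power_mult_distrib H_sq_def)
  then show ?thesis
    using cosh_mori_r(1)[OF a] mori_K_pos[OF a] pos B
    by (subst (asm) power2_eq_iff_nonneg) (auto simp: B_def H_sq_def)
qed

lemma has_real_derivative_cong_interval:
  fixes f g :: "real \<Rightarrow> real"
  assumes "(g has_real_derivative d) (at a)" and "l < a" "a < u" and "\<And>x. l < x \<Longrightarrow> x < u \<Longrightarrow> f x = g x"
  shows "(f has_real_derivative d) (at a)"
proof (rule has_field_derivative_transform_within_open[OF assms(1), of "{l<..<u}"])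
qed (use assms in auto)

text \<open>The analytic half of the theorem. Since \<open>sinh r = K H\<close> with \<open>K\<close> and \<open>H\<close> increasing, the positivity of
  \<open>r'\<close> comes with that of \<open>H'\<close>.\<close>

lemma mori_near_limit:
  obtains \<delta> where "\<delta> > 0"
    and "\<And>a. a \<in> {1/2<..<1/2 + \<delta>} \<Longrightarrow> mori_s0 a > 0"
    and "\<And>a. a \<in> {1/2<..<1/2 + \<delta>} \<Longrightarrow>
      slope a (mori_s0 a) * sinh (mori_t a (mori_s0 a)) = mori_K a * cosh (mori_t a (mori_s0 a))"
    and "\<And>a. a \<in> {1/2<..<1/2 + \<delta>} \<Longrightarrow> \<exists>d. (mori_s0 has_real_derivative d) (at a)"
    and "\<And>a. a \<in> {1/2<..<1/2 + \<delta>} \<Longrightarrow> \<exists>d. (mori_r has_real_derivative d) (at a) \<and> d > 0"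
    and "\<And>a. a \<in> {1/2<..<1/2 + \<delta>} \<Longrightarrow> \<exists>d. (mori_H has_real_derivative d) (at a) \<and> d > 0"
proof -
  obtain \<delta> where \<delta>: "\<delta> > 0" and range: "\<And>B. 0 < B \<Longrightarrow> B < \<delta> \<Longrightarrow>
      scaled_fb_root B > 0 \<and> scaled_fb B (scaled_fb_root B) = 0 \<and>
      (scaled_fb_root has_real_derivative - scaled_fb_B B (scaled_fb_root B) / scaled_fb_x B (scaled_fb_root B)) (at B) \<and>
      B < (sinh (scaled_fb_root B))\<^sup>2 \<and> H_sq_rate B (scaled_fb_root B) > 0"
    using euclidean_scale_range by blast
  define x where "x a = scaled_fb_root (a - 1/2)" for a
  have root: "x a > 0" "scaled_fb (a - 1/2) (x a) = 0" if "1/2 < a" "a < 1/2 + \<delta>" for a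
    using range[of "a - 1/2"] that by (auto simp: x_def)
  have s0: "mori_s0 a = profile_parameter a (x a)" if "1/2 < a" "a < 1/2 + \<delta>" for a
    using mori_s0_eq that root by simp
  have sr: "sinh (mori_r a) = mori_K a * sqrt (H_sq (a - 1/2) (x a))" if "1/2 < a" "a < 1/2 + \<delta>" for a
    using sinh_mori_r that root by simp
  have x': "\<exists>d. (x has_real_derivative d) (at a)" if "1/2 < a" "a < 1/2 + \<delta>" for a
  proof -
    have "0 < a - 1/2" "a - 1/2 < \<delta>"
      using that by auto
    from range[OF this] obtain d where "(scaled_fb_root has_real_derivative d) (at (a - 1/2))"
      by blast
    from DERIV_chain2[where g = "\<lambda>a. a - 1/2", OF this DERIV_diff[OF DERIV_ident DERIV_const]] show ?thesis
      unfolding x_def by blast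
  qed
  have H': "\<exists>d. ((\<lambda>a. sqrt (H_sq (a - 1/2) (x a))) has_real_derivative d) (at a) \<and> d > 0
        \<and> H_sq (a - 1/2) (x a) > 0" if "1/2 < a" "a < 1/2 + \<delta>" for a
  proof -
    define B where "B = a - 1/2"
    have B: "0 < B" "B < \<delta>"
      using that by (auto simp: B_def)
    have "((\<lambda>B. H_sq B (scaled_fb_root B)) has_real_derivative H_sq_rate B (scaled_fb_root B)) (at (a - 1/2))"
      using H_sq_has_real_derivative range[OF B] B by (auto simp: B_def[symmetric])
    from DERIV_chain2[where g = "\<lambda>a. a - 1/2", OF this DERIV_diff[OF DERIV_ident DERIV_const]]
    have d: "((\<lambda>a. H_sq (a - 1/2) (x a)) has_real_derivative H_sq_rate B (scaled_fb_root B)) (at a)"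
      unfolding x_def by simp
    have pos: "H_sq (a - 1/2) (x a) > 0"
      unfolding x_def B_def[symmetric] H_sq_def using B range[OF B] by simp
    have "((\<lambda>a. sqrt (H_sq (a - 1/2) (x a))) has_real_derivative
        inverse (sqrt (H_sq (a - 1/2) (x a))) / 2 * H_sq_rate B (scaled_fb_root B)) (at a)"
      by (rule DERIV_chain2[OF DERIV_real_sqrt[OF pos] d])
    moreover have "inverse (sqrt (H_sq (a - 1/2) (x a))) / 2 * H_sq_rate B (scaled_fb_root B) > 0"
      using pos range[OF B] by simp
    ultimately show ?thesis
      using pos by blast
  qed
  show ?thesis
  proof (rule that[OF \<delta>])
    fix a assume "a \<in> {1/2<..<1/2 + \<delta>}"
    then have a: "1/2 < a" "a < 1/2 + \<delta>"
      by auto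
    show "mori_s0 a > 0"
      using s0[OF a] profile_parameter_pos root a by simp
    show "slope a (mori_s0 a) * sinh (mori_t a (mori_s0 a)) = mori_K a * cosh (mori_t a (mori_s0 a))"
      unfolding s0[OF a] using free_boundary_iff_scaled_fb[OF a(1)] root[OF a] by simp
    obtain d where d: "(x has_real_derivative d) (at a)"
      using x'[OF a] by blast
    have "\<exists>d. ((\<lambda>a. profile_parameter a (x a)) has_real_derivative d) (at a)"
    proof -
      have "((\<lambda>a. (a - 1/2) / (2 * a)) has_real_derivative (1 * (2 * a) - (a - 1/2) * 2) / (2 * a * (2 * a))) (at a)"
        using a by (auto intro!: derivative_eq_intros)
      moreover have "(a - 1/2) / (2 * a) > 0"
        using a by simp
      ultimately have "((\<lambda>a. sqrt ((a - 1/2) / (2 * a))) has_real_derivative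
          inverse (sqrt ((a - 1/2) / (2 * a))) / 2 * ((1 * (2 * a) - (a - 1/2) * 2) / (2 * a * (2 * a)))) (at a)"
        by (intro DERIV_chain2[OF DERIV_real_sqrt])
      from DERIV_chain2[OF arsinh_real_has_field_derivative DERIV_mult[OF this DERIV_chain2[OF has_field_derivative_sinh[OF DERIV_ident] d]]]
      show ?thesis
        unfolding profile_parameter_def by blast
    qed
    then obtain d' where "((\<lambda>a. profile_parameter a (x a)) has_real_derivative d') (at a)"
      by blast
    from has_real_derivative_cong_interval[OF this a s0]
    show "\<exists>d. (mori_s0 has_real_derivative d) (at a)"
      by blast
    obtain h' where h': "((\<lambda>a. sqrt (H_sq (a - 1/2) (x a))) has_real_derivative h') (at a)" "h' > 0"
        "H_sq (a - 1/2) (x a) > 0"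
      using H'[OF a] by blast
    have "mori_H a = sqrt (H_sq (a - 1/2) (x a))" if "1/2 < a" "a < 1/2 + \<delta>" for a
      using sr[OF that] mori_K_pos[OF that(1)] by (simp add: mori_H_def)
    from has_real_derivative_cong_interval[OF h'(1) a this] h'(2)
    show "\<exists>d. (mori_H has_real_derivative d) (at a) \<and> d > 0"
      by blast
    define y where "y = mori_K a * sqrt (H_sq (a - 1/2) (x a))"
    define y' where "y' = a / mori_K a * sqrt (H_sq (a - 1/2) (x a)) + h' * mori_K a"
    have "((\<lambda>a. arsinh (mori_K a * sqrt (H_sq (a - 1/2) (x a)))) has_real_derivative
        1 / sqrt (y\<^sup>2 + 1) * y') (at a)"
      unfolding y_def y'_def
      by (intro DERIV_chain2[OF arsinh_real_has_field_derivative] DERIV_mult mori_K_has_real_derivative a h')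
    moreover have "mori_r a = arsinh (mori_K a * sqrt (H_sq (a - 1/2) (x a)))" if "1/2 < a" "a < 1/2 + \<delta>" for a
      using arsinh_sinh_real[of "mori_r a"] sr[OF that] by simp
    ultimately have "(mori_r has_real_derivative 1 / sqrt (y\<^sup>2 + 1) * y') (at a)"
      by (rule has_real_derivative_cong_interval[OF _ a])
    moreover have "y' > 0"
      unfolding y'_def using a h' mori_K_pos[OF a(1)] by (intro add_pos_pos mult_pos_pos divide_pos_pos) auto
    then have "1 / sqrt (y\<^sup>2 + 1) * y' > 0"
      by (intro mult_pos_pos divide_pos_pos) (auto intro: add_nonneg_pos)
    ultimately show "\<exists>d. (mori_r has_real_derivative d) (at a) \<and> d > 0"
      by blast
  qed
qed

section \<open>Geometry of the rotational surfaces\<close>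

lemma axis_nth_distinct [simp]:
  "axis (1::2) c $ 1 = c" "axis (1::2) c $ 2 = 0" "axis (2::2) c $ 1 = 0" "axis (2::2) c $ 2 = c"
  "axis (1::3) c $ 1 = c" "axis (1::3) c $ 2 = 0" "axis (1::3) c $ 3 = 0"
  "axis (2::3) c $ 1 = 0" "axis (2::3) c $ 2 = c" "axis (2::3) c $ 3 = 0"
  "axis (3::3) c $ 1 = 0" "axis (3::3) c $ 2 = 0" "axis (3::3) c $ 3 = c"
  by (simp_all add: axis_def)

lemma partialI:
  "((\<lambda>h. f (x + h *\<^sub>R axis i 1)) has_vector_derivative d) (at 0) \<Longrightarrow> partial i f x = d"
  by (simp add: partial_def vector_derivative_at)

lemma has_vector_derivative_vector3:
  assumes "(f1 has_real_derivative d1) F" "(f2 has_real_derivative d2) F" "(f3 has_real_derivative d3) F"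
    and "F = at a within S"
  shows "((\<lambda>h. vector [f1 h, f2 h, f3 h] :: real^3) has_vector_derivative vector [d1, d2, d3]) F"
proof -
  have v: "(vector [x, y, z] :: real^3) = x *\<^sub>R axis 1 1 + y *\<^sub>R axis 2 1 + z *\<^sub>R axis 3 (1::real)" for x y z :: real
    by (simp add: vec_eq_iff forall_3)
  show ?thesis
    using assms(1-3) unfolding v assms(4)
    by (auto intro!: derivative_eq_intros simp: has_real_derivative_iff_has_vector_derivative)
qed

lemma hyp_inner_eq:
  "hyp_inner p v w = v $ 1 * w $ 1 + (cosh (p $ 1))\<^sup>2 * v $ 2 * w $ 2 + (sinh (p $ 1))\<^sup>2 * v $ 3 * w $ 3"
  by (simp add: hyp_inner_def fermi_metric_def sum_3)

lemma partial_fermi_metric: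
  "partial i (\<lambda>q. fermi_metric q $ j $ k) p =
     (if i = 1 \<and> j = k \<and> j \<noteq> 1 then 2 * sinh (p $ 1) * cosh (p $ 1) else 0)"
proof (rule partialI)
  have "((\<lambda>h. fermi_metric (p + h *\<^sub>R axis i 1) $ j $ k) has_real_derivative
      (if i = 1 \<and> j = k \<and> j \<noteq> 1 then 2 * sinh (p $ 1) * cosh (p $ 1) else 0)) (at 0)"
    using exhaust_3[of i] exhaust_3[of j]
    by (elim disjE; cases "j = k") (auto simp: fermi_metric_def intro!: derivative_eq_intros)
  then show "((\<lambda>h. fermi_metric (p + h *\<^sub>R axis i 1) $ j $ k) has_vector_derivative
      (if i = 1 \<and> j = k \<and> j \<noteq> 1 then 2 * sinh (p $ 1) * cosh (p $ 1) else 0)) (at 0)"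
    by (simp add: has_real_derivative_iff_has_vector_derivative)
qed

text \<open>\<open>du/ds\<close> for \<open>u = arsinh b\<close>.\<close>

definition u_slope :: "real \<Rightarrow> real \<Rightarrow> real" where
  "u_slope a s = slope a s / sqrt (1 + (prof a s)\<^sup>2)"

lemma one_plus_sq_pos [simp]: "0 < 1 + (x::real)\<^sup>2"
  by (simp add: add_pos_nonneg)

lemma mori_u_has_real_derivative:
  assumes "a > 1/2"
  shows "(mori_u a has_real_derivative u_slope a s) (at s)"
  unfolding mori_u_def[abs_def] mori_b_eq[OF assms] u_slope_def
  by (rule DERIV_cong[OF DERIV_chain2[OF arsinh_real_has_field_derivative prof_has_real_derivative[OF assms]]])
     (simp add: add.commute)

lemma cosh_mori_u: "a > 1/2 \<Longrightarrow> cosh (mori_u a s) = sqrt (1 + (prof a s)\<^sup>2)"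
  by (simp add: mori_u_def mori_b_eq cosh_arsinh_real add.commute)

lemma sinh_mori_u: "a > 1/2 \<Longrightarrow> sinh (mori_u a s) = prof a s"
  by (simp add: mori_u_def mori_b_eq)

lemma mori_t_has_real_derivative:
  assumes "a > 1/2"
  shows "(mori_t a has_real_derivative climb a s) (at s)"
  unfolding mori_t_eq[OF assms] by (rule has_real_derivative_primitive[OF continuous_on_climb[OF assms]])

text \<open>\<open>d\<^sup>2u/ds\<^sup>2\<close>.\<close>

definition u_accel :: "real \<Rightarrow> real \<Rightarrow> real" where
  "u_accel a s = (prof a s + (mori_K a)\<^sup>2 / (prof a s) ^ 3) / sqrt (1 + (prof a s)\<^sup>2)
     - prof a s * (slope a s)\<^sup>2 / (sqrt (1 + (prof a s)\<^sup>2)) ^ 3"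

text \<open>\<open>d\<^sup>2t/ds\<^sup>2\<close>.\<close>

definition climb_slope :: "real \<Rightarrow> real \<Rightarrow> real" where
  "climb_slope a s = - (mori_K a * slope a s * (1 + 3 * (prof a s)\<^sup>2)) / (prof a s * (1 + (prof a s)\<^sup>2))\<^sup>2"

lemma u_slope_has_real_derivative:
  assumes a: "a > 1/2"
  shows "(u_slope a has_real_derivative u_accel a s) (at s)"
proof -
  define W where "W = sqrt (1 + (prof a s)\<^sup>2)"
  have W: "W > 0"
    by (simp add: W_def)
  have dW: "((\<lambda>s. sqrt (1 + (prof a s)\<^sup>2)) has_real_derivative prof a s * slope a s / W) (at s)"
      by (rule DERIV_cong[OF DERIV_chain2[OF DERIV_real_sqrt DERIV_add[OF DERIV_const DERIV_power[OF prof_has_real_derivative[OF a]]]]])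
       (simp_all add: W_def divide_simps)
  have alg: "(X * W - p * (b * p / W)) / (W * W) = X / W - b * p\<^sup>2 / W ^ 3" for X b p
    using W by (simp add: field_simps power2_eq_square power3_eq_cube)
  have nz: "sqrt (1 + (prof a s)\<^sup>2) \<noteq> 0"
    using W unfolding W_def by linarith
  show ?thesis
    using DERIV_divide[OF slope_has_real_derivative[OF a] dW nz]
    unfolding W_def[symmetric] alg u_slope_def[abs_def] u_accel_def .
qed

lemma climb_has_real_derivative:
  assumes a: "a > 1/2"
  shows "(climb a has_real_derivative climb_slope a s) (at s)"
proof -
  have nz: "prof a s * (1 + (prof a s)\<^sup>2) \<noteq> 0"
    using a one_plus_sq_pos[of "prof a s"] by (simp add: less_imp_neq[symmetric])
  have d: "((\<lambda>s. prof a s * (1 + (prof a s)\<^sup>2)) has_real_derivative slope a s * (1 + 3 * (prof a s)\<^sup>2)) (at s)"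
    by (rule derivative_eq_intros prof_has_real_derivative[OF a] refl)+
       (simp add: algebra_simps power2_eq_square)
  show ?thesis
    unfolding climb_def[abs_def] climb_slope_def
    by (rule DERIV_cong[OF DERIV_divide[OF DERIV_const d nz]]) (simp add: power2_eq_square)
qed

lemma shift_at_0:
  assumes "(f has_real_derivative d) (at c)"
  shows "((\<lambda>h. f (c + h)) has_real_derivative d) (at 0)"
  using assms DERIV_shift[of f d 0 c] by (simp add: add.commute)

lemma partial_mori_surface:
  assumes a: "a > 1/2"
  shows "partial 1 (mori_surface a) x = vector [u_slope a (x $ 1), climb a (x $ 1), 0]"
    and "partial 2 (mori_surface a) x = vector [0, 0, 1]"
  by (rule partialI, unfold mori_surface_def, rule has_vector_derivative_vector3[OF _ _ _ refl];
      auto intro!: derivative_eq_intros shift_at_0 mori_u_has_real_derivative mori_t_has_real_derivative a)+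

lemma partial_partial_mori_surface:
  assumes a: "a > 1/2"
  shows "partial 1 (partial 1 (mori_surface a)) x = vector [u_accel a (x $ 1), climb_slope a (x $ 1), 0]"
    and "partial 2 (partial 1 (mori_surface a)) x = 0"
    and "partial i (partial 2 (mori_surface a)) x = 0"
proof -
  show "partial 1 (partial 1 (mori_surface a)) x = vector [u_accel a (x $ 1), climb_slope a (x $ 1), 0]"
    unfolding partial_mori_surface(1)[OF a, abs_def]
    by (rule partialI, rule has_vector_derivative_vector3[OF _ _ _ refl])
       (auto intro!: shift_at_0 u_slope_has_real_derivative climb_has_real_derivative a)
  show "partial 2 (partial 1 (mori_surface a)) x = 0"
    unfolding partial_mori_surface(1)[OF a, abs_def] by (rule partialI) simp
  show "partial i (partial 2 (mori_surface a)) x = 0"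
    unfolding partial_mori_surface(2)[OF a, abs_def] by (rule partialI) simp
qed

lemma mori_surface_nth [simp]:
  "mori_surface a x $ 1 = mori_u a (x $ 1)" "mori_surface a x $ 2 = mori_t a (x $ 1)" "mori_surface a x $ 3 = x $ 2"
  by (simp_all add: mori_surface_def)

text \<open>The energy integral of the profile, read as a statement about arclength; it makes the induced
  metric \<open>ds\<^sup>2 + b\<^sup>2 d\<theta>\<^sup>2\<close>.\<close>

lemma unit_speed:
  assumes a: "a > 1/2"
  shows "(u_slope a s)\<^sup>2 + (1 + (prof a s)\<^sup>2) * (climb a s)\<^sup>2 = 1"
proof -
  define b w where "b = prof a s" and "w = 1 + b\<^sup>2"
  have b: "b > 0" and w: "w > 0"
    using a by (simp_all add: b_def w_def)
  have "(u_slope a s)\<^sup>2 = (w - (mori_K a)\<^sup>2 / b\<^sup>2) / w"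
    using w by (simp add: u_slope_def power_divide slope_sq[OF a] b_def w_def)
  moreover have "(climb a s)\<^sup>2 = (mori_K a)\<^sup>2 / (b\<^sup>2 * w\<^sup>2)"
    by (simp add: climb_def power_divide power_mult_distrib b_def w_def)
  moreover have "(w - K / b\<^sup>2) / w + w * (K / (b\<^sup>2 * w\<^sup>2)) = 1" for K
    using b w by (simp add: field_simps power2_eq_square)
  ultimately show ?thesis
    unfolding b_def[symmetric] w_def[symmetric] by simp
qed

lemma first_form_mori:
  assumes a: "a > 1/2"
  shows "first_form (mori_surface a) x =
    (\<chi> i j. if i \<noteq> j then 0 else if i = 1 then 1 else (prof a (x $ 1))\<^sup>2)"
  using unit_speed[OF a, of "x $ 1"]
  by (simp add: first_form_def vec_eq_iff forall_2 hyp_inner_eq partial_mori_surface[OF a] cosh_mori_u[OF a]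
      sinh_mori_u[OF a] power2_eq_square[symmetric] mult.assoc)

lemma matrix_inv_eqI:
  fixes A B :: "real^'n^'n"
  assumes "A ** B = mat 1" "B ** A = mat 1"
  shows "matrix_inv A = B"
proof -
  have "A ** matrix_inv A = mat 1 \<and> matrix_inv A ** A = mat 1"
    unfolding matrix_inv_def by (rule someI_ex) (use assms in blast)
  then have "matrix_inv A = matrix_inv A ** (A ** B)"
    by (simp add: assms)
  also have "\<dots> = B"
    using \<open>A ** matrix_inv A = mat 1 \<and> _\<close> by (simp add: matrix_mul_assoc)
  finally show ?thesis .
qed

lemma matrix_inv_first_form_mori:
  assumes a: "a > 1/2"
  shows "matrix_inv (first_form (mori_surface a) x) =
    (\<chi> i j. if i \<noteq> j then 0 else if i = 1 then 1 else 1 / (prof a (x $ 1))\<^sup>2)"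
  unfolding first_form_mori[OF a] using prof_nonzero[OF a]
  by (intro matrix_inv_eqI) (simp_all add: vec_eq_iff forall_2 matrix_matrix_mult_def mat_def sum_2)

lemma det_first_form_mori:
  assumes a: "a > 1/2"
  shows "sqrt (det (first_form (mori_surface a) x)) = prof a (x $ 1)"
  using prof_pos[OF a] by (simp add: first_form_mori[OF a] det_2 real_sqrt_unique less_imp_le)

lemma laplace_beltrami_mori:
  assumes a: "a > 1/2"
  shows "laplace_beltrami (mori_surface a) f x =
    (partial 1 (\<lambda>y. prof a (y $ 1) * partial 1 f y) x
      + partial 2 (\<lambda>y. prof a (y $ 1) * (partial 2 f y / (prof a (y $ 1))\<^sup>2)) x) / prof a (x $ 1)"
  by (simp add: laplace_beltrami_def det_first_form_mori[OF a] matrix_inv_first_form_mori[OF a] sum_2)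

lemma conormal_deriv_mori:
  assumes a: "a > 1/2"
  shows "conormal_deriv (mori_surface a) f x = sgn (x $ 1) * partial 1 f x"
  by (simp add: conormal_deriv_def matrix_inv_first_form_mori[OF a] sum_2)

text \<open>The velocity of the profile turned by a right angle in the metric \<open>du\<^sup>2 + cosh\<^sup>2 u dt\<^sup>2\<close>.\<close>

definition mori_normal :: "real \<Rightarrow> real \<Rightarrow> real^3" where
  "mori_normal a s = vector [- sqrt (1 + (prof a s)\<^sup>2) * climb a s, u_slope a s / sqrt (1 + (prof a s)\<^sup>2), 0]"

text \<open>In the orthonormal components \<open>(N\<^sub>1, cosh u N\<^sub>2)\<close> this says that a unit vector in the plane which is
  orthogonal to a given unit vector is determined up to sign.\<close>

lemma is_unit_normal_mori_iff:
  assumes a: "a > 1/2"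
  shows "is_unit_normal (mori_surface a) x N \<longleftrightarrow> N = mori_normal a (x $ 1) \<or> N = - mori_normal a (x $ 1)"
proof -
  define W k v where "W = sqrt (1 + (prof a (x $ 1))\<^sup>2)" and "k = climb a (x $ 1)" and "v = u_slope a (x $ 1)"
  have W: "W > 0" and W2: "W\<^sup>2 = 1 + (prof a (x $ 1))\<^sup>2"
    by (simp_all add: W_def)
  have unit: "v\<^sup>2 + (W * k)\<^sup>2 = 1"
    using unit_speed[OF a, of "x $ 1"] by (simp add: v_def k_def W2 power_mult_distrib)
  have cu: "cosh (mori_u a (x $ 1)) = W"
    by (simp add: cosh_mori_u[OF a] W_def)
  have "is_unit_normal (mori_surface a) x N \<longleftrightarrow>
      (N $ 1)\<^sup>2 + (W * N $ 2)\<^sup>2 = 1 \<and> v * N $ 1 + (W * k) * (W * N $ 2) = 0 \<and> N $ 3 = 0"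
    using prof_nonzero[OF a, of "x $ 1"]
    by (auto simp: is_unit_normal_def hyp_inner_eq forall_2 partial_mori_surface[OF a] cu
        sinh_mori_u[OF a] k_def[symmetric] v_def[symmetric] power2_eq_square algebra_simps)
  also have "\<dots> \<longleftrightarrow> (N $ 1 = - (W * k) \<and> W * N $ 2 = v \<or> N $ 1 = W * k \<and> W * N $ 2 = - v) \<and> N $ 3 = 0"
  proof -
    have "X\<^sup>2 + Y\<^sup>2 = 1 \<and> v * X + (W * k) * Y = 0 \<longleftrightarrow> X = - (W * k) \<and> Y = v \<or> X = W * k \<and> Y = - v" for X Y
    proof
      assume XY: "X\<^sup>2 + Y\<^sup>2 = 1 \<and> v * X + (W * k) * Y = 0"
      \<comment> \<open>The component of \<open>(X, Y)\<close> along the rotated velocity.\<close>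
      define e where "e = v * Y - (W * k) * X"
      have "X = - (W * k) * e" "Y = v * e"
        using XY unit unfolding e_def by algebra+
      moreover have "e\<^sup>2 = 1"
        using XY unit unfolding e_def by algebra
      then have "e = 1 \<or> e = -1"
        by (simp add: power2_eq_1_iff)
      ultimately show "X = - (W * k) \<and> Y = v \<or> X = W * k \<and> Y = - v"
        by auto
    qed (use unit in \<open>auto simp: algebra_simps\<close>)
    from this[of "N $ 1" "W * N $ 2"] show ?thesis
      by blast
  qed
  also have "\<dots> \<longleftrightarrow> N = mori_normal a (x $ 1) \<or> N = - mori_normal a (x $ 1)"
    using W by (auto simp: vec_eq_iff forall_3 mori_normal_def W_def[symmetric] k_def[symmetric] v_def[symmetric]
        field_simps)
  finally show ?thesis .
qed

text \<open>The two principal curvatures are \<open>- K/b\<^sup>2\<close> and \<open>K/b\<^sup>2\<close>; in particular the surface is minimal. The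
  curvature of the parallels comes from the Christoffel symbols alone, that of the profile needs its
  second derivatives and the energy integral.\<close>

lemma second_form_mori:
  assumes a: "a > 1/2"
  shows "second_form (mori_surface a) x (mori_normal a (x $ 1)) =
    (\<chi> i j. if i \<noteq> j then 0 else if i = 1 then - mori_K a / (prof a (x $ 1))\<^sup>2 else mori_K a)"
proof -
  define b p K W where "b = prof a (x $ 1)" and "p = slope a (x $ 1)" and "K = mori_K a"
    and "W = sqrt (1 + (prof a (x $ 1))\<^sup>2)"
  have nz: "b \<noteq> 0" "W \<noteq> 0" and W2: "W\<^sup>2 = 1 + b\<^sup>2"
    using prof_nonzero[OF a] one_plus_sq_pos[of "prof a (x $ 1)"] by (simp_all add: b_def W_def less_imp_neq[symmetric])
  have p2: "p\<^sup>2 * b\<^sup>2 = W\<^sup>2 * b\<^sup>2 - K\<^sup>2"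
    unfolding W2 using nz(1) by (simp add: slope_sq[OF a] p_def b_def K_def field_simps)
  have k: "climb a (x $ 1) = K / (b * W\<^sup>2)"
    by (simp add: climb_def W2 b_def K_def)
  have v: "u_slope a (x $ 1) = p / W"
    by (simp add: u_slope_def p_def W_def)
  have cu: "cosh (mori_u a (x $ 1)) = W" and su: "sinh (mori_u a (x $ 1)) = b"
    by (simp_all add: cosh_mori_u[OF a] sinh_mori_u[OF a] W_def b_def)
  have N: "mori_normal a (x $ 1) = vector [- W * climb a (x $ 1), u_slope a (x $ 1) / W, 0]"
    by (simp add: mori_normal_def W_def)
  note expand = second_form_def partial_partial_mori_surface[OF a] partial_mori_surface[OF a] hyp_inner_eq
      christoffel_def partial_fermi_metric sum_3 cu su N
  have "second_form (mori_surface a) x (mori_normal a (x $ 1)) $ 2 $ 2 = b * (W * (W * climb a (x $ 1)))"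
    by (simp add: expand)
  then have 22: "second_form (mori_surface a) x (mori_normal a (x $ 1)) $ 2 $ 2 = K"
    using nz by (simp add: k power2_eq_square)
  have "second_form (mori_surface a) x (mori_normal a (x $ 1)) $ 1 $ 1
      = - (W * climb a (x $ 1)) * u_accel a (x $ 1) + W * u_slope a (x $ 1) * climb_slope a (x $ 1)
        + b * W * (climb a (x $ 1))\<^sup>2 * (W * climb a (x $ 1)) + 2 * b * u_slope a (x $ 1) * climb a (x $ 1) * u_slope a (x $ 1)"
    using nz by (simp add: expand power2_eq_square algebra_simps)
  also have "\<dots> = - K / b\<^sup>2"
  proof -
    have ua: "u_accel a (x $ 1) = (b + K\<^sup>2 / b ^ 3) / W - b * p\<^sup>2 / W ^ 3"
      by (simp add: u_accel_def b_def K_def W_def p_def)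
    have cs: "climb_slope a (x $ 1) = - (K * p * (1 + 3 * b\<^sup>2)) / (b * W\<^sup>2)\<^sup>2"
      by (simp add: climb_slope_def W2 b_def K_def p_def)
    show ?thesis
    proof -
      \<comment> \<open>The square root enters only through its square.\<close>
      define w y where "w = W\<^sup>2" and "y = b\<^sup>2"
      have w: "w \<noteq> 0" "w = 1 + y" and y: "y \<noteq> 0"
        unfolding w_def y_def W2[symmetric] using nz by simp_all
      have 1: "- (W * (K / (b * W\<^sup>2))) * ((b + K\<^sup>2 / b ^ 3) / W - b * p\<^sup>2 / W ^ 3)
          = K * (- (y * y + K\<^sup>2) / (y * y * w) + p\<^sup>2 / (w * w))"
        unfolding w_def y_def using nz by (simp add: field_simps power2_eq_square power3_eq_cube)
      have 2: "W * (p / W) * (- (K * p * (1 + 3 * b\<^sup>2)) / (b * W\<^sup>2)\<^sup>2) = K * (- p\<^sup>2 * (1 + 3 * y) / (y * (w * w)))"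
        unfolding w_def y_def using nz by (simp add: field_simps power2_eq_square)
      have 3: "b * W * (K / (b * W\<^sup>2))\<^sup>2 * (W * (K / (b * W\<^sup>2))) = K * (K\<^sup>2 / (y * (w * w)))"
        unfolding w_def y_def using nz by (simp add: field_simps power2_eq_square)
      have 4: "2 * b * (p / W) * (K / (b * W\<^sup>2)) * (p / W) = K * (2 * p\<^sup>2 / (w * w))"
        unfolding w_def y_def using nz by (simp add: field_simps power2_eq_square)
      have "p\<^sup>2 = w - K\<^sup>2 / y"
        using p2 y by (simp add: w_def[symmetric] y_def[symmetric] field_simps)
      then have "- (y * y + K\<^sup>2) / (y * y * w) + p\<^sup>2 / (w * w) + (- p\<^sup>2 * (1 + 3 * y) / (y * (w * w)))
          + K\<^sup>2 / (y * (w * w)) + 2 * p\<^sup>2 / (w * w) = - 1 / y"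
        using w(1) y by (simp add: divide_simps) (simp add: w(2) algebra_simps)
      then have "K * (- (y * y + K\<^sup>2) / (y * y * w) + p\<^sup>2 / (w * w) + (- p\<^sup>2 * (1 + 3 * y) / (y * (w * w)))
          + K\<^sup>2 / (y * (w * w)) + 2 * p\<^sup>2 / (w * w)) = K * (- 1 / y)"
        by (rule arg_cong)
      then show ?thesis
        unfolding k v ua cs 1 2 3 4 by (simp add: y_def algebra_simps)
    qed
  qed
  finally have 11: "second_form (mori_surface a) x (mori_normal a (x $ 1)) $ 1 $ 1 = - K / b\<^sup>2" .
  have "second_form (mori_surface a) x (mori_normal a (x $ 1)) $ 1 $ 2 = 0"
      "second_form (mori_surface a) x (mori_normal a (x $ 1)) $ 2 $ 1 = 0"
    by (simp_all add: expand)
  then show ?thesis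
    using 11 22 by (simp add: vec_eq_iff forall_2 b_def K_def)
qed

lemma second_form_minus: "second_form X x (- N) = - second_form X x N"
  by (simp add: second_form_def vec_eq_iff hyp_inner_def sum_negf)

text \<open>A change of sign of the normal cancels in the square of the shape operator, so the choice made in the
  definition is immaterial.\<close>

lemma normA_sq_mori:
  assumes a: "a > 1/2"
  shows "normA_sq (mori_surface a) x = 2 * (mori_K a)\<^sup>2 / (prof a (x $ 1)) ^ 4"
proof -
  define N where "N = (SOME N. is_unit_normal (mori_surface a) x N)"
  have "is_unit_normal (mori_surface a) x (mori_normal a (x $ 1))"
    by (simp add: is_unit_normal_mori_iff[OF a])
  then have "is_unit_normal (mori_surface a) x N"
    unfolding N_def by (rule someI)
  then have "second_form (mori_surface a) x N = second_form (mori_surface a) x (mori_normal a (x $ 1))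
      \<or> second_form (mori_surface a) x N = - second_form (mori_surface a) x (mori_normal a (x $ 1))"
    unfolding is_unit_normal_mori_iff[OF a] by (auto simp: second_form_minus)
  then show ?thesis
    unfolding normA_sq_def N_def[symmetric] matrix_inv_first_form_mori[OF a] second_form_mori[OF a] Let_def
    using prof_nonzero[OF a, of "x $ 1"]
    by (auto simp: trace_def matrix_matrix_mult_def sum_2 power_numeral_reduce field_simps)
qed

section \<open>The Jacobi field of the family and its boundary defect\<close>

text \<open>\<open>prof_param\<close> is the derivative of \<open>b\<close> with respect to \<open>a\<close>, for fixed \<open>s\<close>, and \<open>prof_param_s\<close> is the
  derivative of the latter in \<open>s\<close>.\<close>

definition prof_param :: "real \<Rightarrow> real \<Rightarrow> real" where
  "prof_param a s = cosh (2 * s) / (2 * prof a s)"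

definition prof_param_s :: "real \<Rightarrow> real \<Rightarrow> real" where
  "prof_param_s a s = sinh (2 * s) / prof a s - cosh (2 * s) * slope a s / (2 * (prof a s)\<^sup>2)"

text \<open>\<open>d\<^sup>2b/ds\<^sup>2\<close>, by the profile equation.\<close>

definition accel :: "real \<Rightarrow> real \<Rightarrow> real" where
  "accel a s = prof a s + (mori_K a)\<^sup>2 / (prof a s) ^ 3"

text \<open>The Jacobian \<open>b\<^sub>s t\<^sub>a - t\<^sub>s b\<^sub>a\<close> of the profiles in the coordinates \<open>(b, t)\<close>; it is the normal component
  of the variation field of the family.\<close>

definition jacobi_field :: "real \<Rightarrow> real \<Rightarrow> real" where
  "jacobi_field a s = slope a s * primitive (climb_param a) s - climb a s * prof_param a s"

definition jacobi_field_s :: "real \<Rightarrow> real \<Rightarrow> real" where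
  "jacobi_field_s a s = accel a s * primitive (climb_param a) s + slope a s * climb_param a s
     - climb_slope a s * prof_param a s - climb a s * prof_param_s a s"

lemma prof_param_has_real_derivative:
  assumes a: "a > 1/2"
  shows "(prof_param a has_real_derivative prof_param_s a s) (at s)"
proof -
  have 1: "((\<lambda>s. cosh (2 * s)) has_real_derivative 2 * sinh (2 * s)) (at s)"
    by (auto intro!: derivative_eq_intros)
  have 2: "((\<lambda>s. 2 * prof a s) has_real_derivative 2 * slope a s) (at s)"
    by (rule DERIV_cmult[OF prof_has_real_derivative[OF a]])
  have 3: "(2 * S * (2 * B) - C * (2 * P)) / (2 * B * (2 * B)) = S / B - C * P / (2 * B\<^sup>2)"
    if "B \<noteq> 0" for S B C P :: real
    using that by (simp add: field_simps power2_eq_square)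
  show ?thesis
    unfolding prof_param_def[abs_def] prof_param_s_def 3[OF prof_nonzero[OF a], symmetric]
    by (rule DERIV_divide[OF 1 2]) (use prof_nonzero[OF a] in simp)
qed

lemma slope_has_real_derivative_accel:
  "a > 1/2 \<Longrightarrow> (slope a has_real_derivative accel a s) (at s)"
  unfolding accel_def by (rule slope_has_real_derivative)

lemma accel_pos:
  assumes "a > 1/2"
  shows "accel a s > 0"
  using prof_pos[OF assms, of s] by (simp add: accel_def add_pos_nonneg)

lemma jacobi_field_has_real_derivative:
  assumes a: "a > 1/2"
  shows "(jacobi_field a has_real_derivative jacobi_field_s a s) (at s)"
proof -
  have "continuous_on UNIV (climb_param a)"
    using continuous_on_slice[OF continuous_on_climb_param(2)] a by simp
  note t = has_real_derivative_primitive[OF this]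
  show ?thesis
    unfolding jacobi_field_def[abs_def]
    by (rule DERIV_cong[OF DERIV_diff[OF DERIV_mult[OF slope_has_real_derivative_accel[OF a] t]
          DERIV_mult[OF climb_has_real_derivative[OF a] prof_param_has_real_derivative[OF a]]]])
       (simp add: jacobi_field_s_def algebra_simps)
qed

lemma jacobi_field_s_0: "a > 1/2 \<Longrightarrow> jacobi_field_s a 0 = 0"
  by (simp add: jacobi_field_s_def climb_slope_def prof_param_s_def)

text \<open>This is the derivative in \<open>a\<close> of the energy integral \<open>b\<^sub>s\<^sup>2 = 1 + b\<^sup>2 - K\<^sup>2/b\<^sup>2\<close>, divided by 2; it
  suffices to insert the closed form of \<open>b\<close>.\<close>

lemma prof_param_slope:
  assumes a: "a > 1/2"
  shows "slope a s * prof_param_s a s = accel a s * prof_param a s - a / (prof a s)\<^sup>2"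
proof -
  define b p K where "b = prof a s" and "p = slope a s" and "K = mori_K a"
  have b: "b \<noteq> 0"
    using a by (simp add: b_def)
  have C: "cosh (2 * s) = (b\<^sup>2 + 1/2) / a"
    using a by (simp add: b_def prof_sq[OF a] field_simps)
  have S: "sinh (2 * s) = b * p / a"
    using a by (simp add: b_def p_def slope_def)
  have p2: "p\<^sup>2 = 1 + b\<^sup>2 - K\<^sup>2 / b\<^sup>2"
    by (simp add: p_def b_def K_def slope_sq[OF a])
  have K2: "K\<^sup>2 = a\<^sup>2 - 1/4"
    by (simp add: K_def mori_K_sq[OF a])
  have "slope a s * prof_param_s a s = p\<^sup>2 * (1 - 1 / (2 * b\<^sup>2)) / (2 * a)"
    unfolding prof_param_s_def C S b_def[symmetric] p_def[symmetric] using b a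
    by (simp add: field_simps power2_eq_square)
  also have "\<dots> = (b + K\<^sup>2 / b ^ 3) * ((b\<^sup>2 + 1/2) / (2 * a * b)) - a / b\<^sup>2"
    unfolding p2 K2 using b a by (simp add: divide_simps) (simp add: algebra_simps power_numeral_reduce)
  also have "\<dots> = accel a s * prof_param a s - a / (prof a s)\<^sup>2"
    unfolding accel_def prof_param_def C b_def[symmetric] K_def[symmetric] by simp
  finally show ?thesis .
qed

text \<open>The Wronskian of the Jacobi field with \<open>b\<^sub>s\<close>, the Jacobi field of the translations along the axis.
  The terms with \<open>t\<^sub>a\<close> cancel, and so do the terms of \<open>t\<^sub>s\<^sub>a\<close> and \<open>t\<^sub>s\<^sub>s\<close> that contain \<open>b\<^sub>a\<close>, since both come
  from differentiating \<open>t\<^sub>s\<close> as a function of \<open>b\<close>.\<close>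

lemma jacobi_field_wronskian:
  assumes a: "a > 1/2"
  shows "prof a s * (jacobi_field_s a s * slope a s - jacobi_field a s * accel a s) = a / mori_K a"
proof -
  define b p K k \<beta> q w where "b = prof a s" and "p = slope a s" and "K = mori_K a"
    and "k = climb a s" and "\<beta> = prof_param a s" and "q = accel a s" and "w = 1 + b\<^sup>2"
  have b: "b \<noteq> 0" and K: "K \<noteq> 0" and w: "w \<noteq> 0"
    using a mori_K_pos[OF a] one_plus_sq_pos[of b] unfolding w_def b_def K_def
    by (simp, linarith, linarith)
  have k: "k = K / (b * w)"
    by (simp add: k_def climb_def K_def b_def w_def)
  have ka: "climb_param a s = (a / K) / (b * w) - K * \<beta> * (1 + 3 * b\<^sup>2) / (b * w)\<^sup>2"
    by (simp add: climb_param_def K_def b_def w_def \<beta>_def prof_param_def)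
  have ks: "climb_slope a s = - (K * p * (1 + 3 * b\<^sup>2)) / (b * w)\<^sup>2"
    by (simp add: climb_slope_def K_def p_def b_def w_def)
  have p2: "p\<^sup>2 = w - K\<^sup>2 / b\<^sup>2"
    by (simp add: p_def b_def K_def w_def slope_sq[OF a])
  have "b * (jacobi_field_s a s * p - jacobi_field a s * q)
      = b * (p\<^sup>2 * climb_param a s - climb_slope a s * \<beta> * p - k * (p * prof_param_s a s) + q * k * \<beta>)"
    by (simp add: jacobi_field_s_def jacobi_field_def p_def q_def k_def \<beta>_def algebra_simps power2_eq_square)
  also have "p\<^sup>2 * climb_param a s - climb_slope a s * \<beta> * p = p\<^sup>2 * (a / K) / (b * w)"
  proof -
    define X where "X = K * (1 + 3 * b\<^sup>2) / (b * w)\<^sup>2"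
    have X: "climb_param a s = (a / K) / (b * w) - \<beta> * X" "climb_slope a s = - (p * X)"
      by (simp_all add: ka ks X_def)
    show ?thesis
      unfolding X by (simp add: algebra_simps power2_eq_square)
  qed
  also have "p * prof_param_s a s = q * \<beta> - a / b\<^sup>2"
    by (simp add: p_def q_def \<beta>_def b_def prof_param_slope[OF a])
  also have "b * (p\<^sup>2 * (a / K) / (b * w) - k * (q * \<beta> - a / b\<^sup>2) + q * k * \<beta>)
      = b * (p\<^sup>2 * (a / K) / (b * w) + k * (a / b\<^sup>2))"
    by (simp add: algebra_simps)
  also have "\<dots> = a / K"
    unfolding k p2 using b K w by (simp add: field_simps power2_eq_square)
  finally show ?thesis
    by (simp add: b_def p_def q_def K_def)
qed

text \<open>The algebra behind the boundary defect. Here \<open>n\<close>, \<open>m\<close>, \<open>P\<close> are the derivatives of \<open>b\<close>, \<open>t\<close> and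
  \<open>p = b\<^sub>s\<close> along the curve of free boundary points, \<open>c = cosh t\<close>, \<open>\<sigma> = sinh t\<close>, \<open>w = cosh u\<close>, and
  \<open>Sr = sinh r\<close>. Geometrically, the function \<open>cosh \<rho>\<close> has Hessian \<open>cosh \<rho>\<close> times the metric, and the
  free boundary condition states that its gradient is tangent to the surface; the derivative of this
  statement along the family is the hypothesis \<open>fb'\<close>, which reduces to \<open>G\<close> below. The claim is linear in \<open>n\<close> and \<open>m\<close>, and their coefficients vanish
  separately.\<close>

lemma boundary_defect_algebra:
  fixes b p K Ka k q w m n P c \<sigma> \<phi> \<phi>s Sr r' :: real
  assumes nz: "b \<noteq> 0" "w \<noteq> 0" "p \<noteq> 0" "c \<noteq> 0"
    and w2: "w\<^sup>2 = 1 + b\<^sup>2" and p2: "p\<^sup>2 = w\<^sup>2 - K\<^sup>2 / b\<^sup>2" and q: "q = b + K\<^sup>2 / b ^ 3"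
    and k: "k = K / (b * w\<^sup>2)"
    and P: "p * P = q * n - K * Ka / b\<^sup>2"
    and scaled_fb: "p * \<sigma> = K * c" and fb': "P * \<sigma> + p * (c * m) = Ka * c + K * (\<sigma> * m)"
    and Sr: "Sr = b * c * w / p" and r': "Sr * r' = b * n / w * c + w * (\<sigma> * m)"
    and \<phi>: "\<phi> = p * m - k * n" and \<phi>s: "b * (\<phi>s * p - \<phi> * q) = Ka"
  shows "Sr * \<phi>s - w * c * \<phi> = K / b\<^sup>2 * (Sr * r')"
proof -
  have \<sigma>: "\<sigma> = K * c / p"
    using scaled_fb nz by (simp add: field_simps)
  have "c * (P * K + p\<^sup>2 * m) = c * (Ka * p + K\<^sup>2 * m)"
    using fb' nz(3) unfolding \<sigma> by (simp add: field_simps power2_eq_square)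
  then have "P * K + p\<^sup>2 * m = Ka * p + K\<^sup>2 * m"
    using nz by simp
  then have "(p * P) * K + p ^ 3 * m = Ka * p\<^sup>2 + K\<^sup>2 * p * m"
    by (metis (no_types, opaque_lifting) distrib_left mult.assoc mult.commute power2_eq_square power3_eq_cube)
  then have "Ka * (p\<^sup>2 + K\<^sup>2 / b\<^sup>2) = K * q * n + p * (p\<^sup>2 - K\<^sup>2) * m"
    unfolding P by (simp add: algebra_simps power2_eq_square power3_eq_cube)
  then have G: "w\<^sup>2 * Ka = K * q * n + p * (p\<^sup>2 - K\<^sup>2) * m"
    by (simp add: p2 mult.commute)
  \<comment> \<open>The coefficients of \<open>n\<close> and \<open>m\<close> in the claim, up to nonzero factors.\<close>
  have n0: "- (w\<^sup>2 * (b * q) * k) + K * q + w\<^sup>2 * p\<^sup>2 * k - K * p\<^sup>2 / b = 0"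
    unfolding k using nz by (simp add: field_simps power2_eq_square)
  have bq: "b * q = b\<^sup>2 + K\<^sup>2 / b\<^sup>2"
    unfolding q using nz by (simp add: field_simps power2_eq_square power3_eq_cube)
  have m0: "w\<^sup>2 * (b * q) + (p\<^sup>2 - K\<^sup>2) - w\<^sup>2 * p\<^sup>2 - K\<^sup>2 * w\<^sup>2 / b\<^sup>2 = 0"
    unfolding bq p2 w2 using nz by (simp add: field_simps power2_eq_square)
  have "(w\<^sup>2 * (b * q) * \<phi> + w\<^sup>2 * Ka - w\<^sup>2 * p\<^sup>2 * \<phi>) - K / b\<^sup>2 * (b * n * p\<^sup>2 + w\<^sup>2 * K * m * p)
      = n * (- (w\<^sup>2 * (b * q) * k) + K * q + w\<^sup>2 * p\<^sup>2 * k - K * p\<^sup>2 / b)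
        + p * m * (w\<^sup>2 * (b * q) + (p\<^sup>2 - K\<^sup>2) - w\<^sup>2 * p\<^sup>2 - K\<^sup>2 * w\<^sup>2 / b\<^sup>2)"
    unfolding \<phi> G using nz by (simp add: field_simps power2_eq_square)
  also have "\<dots> = 0"
    unfolding n0 m0 by simp
  finally have main: "w\<^sup>2 * (b * q) * \<phi> + w\<^sup>2 * Ka - w\<^sup>2 * p\<^sup>2 * \<phi> = K / b\<^sup>2 * (b * n * p\<^sup>2 + w\<^sup>2 * K * m * p)"
    by simp
  have "\<phi>s * p = \<phi> * q + Ka / b"
    using \<phi>s nz by (simp add: field_simps)
  then have \<phi>s': "\<phi>s = (\<phi> * q + Ka / b) / p"
    using nz by (simp add: field_simps)
  have "Sr * \<phi>s - w * c * \<phi> = c / (w * p\<^sup>2) * (w\<^sup>2 * (b * q) * \<phi> + w\<^sup>2 * Ka - w\<^sup>2 * p\<^sup>2 * \<phi>)"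
    unfolding Sr \<phi>s' using nz by (simp add: field_simps power2_eq_square)
  also have "\<dots> = K / b\<^sup>2 * (Sr * r')"
    unfolding main r' \<sigma> using nz by (simp add: field_simps power2_eq_square)
  finally show ?thesis .
qed

lemma prof_total_derivative:
  assumes a: "a > 1/2" and g: "(g has_real_derivative g') (at a)"
  shows "((\<lambda>a. prof a (g a)) has_real_derivative prof_param a (g a) + slope a (g a) * g') (at a)"
proof -
  have "((\<lambda>a. 2 * g a) has_real_derivative 2 * g') (at a)"
    by (rule DERIV_cmult[OF g])
  from DERIV_chain2[OF has_field_derivative_cosh[OF DERIV_ident] this]
  have "((\<lambda>a. cosh (2 * g a)) has_real_derivative sinh (2 * g a) * (2 * g')) (at a)"
    by simp
  then have "((\<lambda>a. a * cosh (2 * g a) - 1/2) has_real_derivative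
      cosh (2 * g a) + a * (sinh (2 * g a) * (2 * g'))) (at a)"
    by (rule DERIV_cong[OF DERIV_diff[OF DERIV_mult[OF DERIV_ident] DERIV_const]]) simp
  from DERIV_chain2[OF DERIV_real_sqrt[OF prof_arg_pos[OF a]] this]
  show ?thesis
    unfolding prof_def[symmetric]
    by (rule DERIV_cong) (use prof_nonzero[OF a] in \<open>simp add: prof_param_def slope_def field_simps\<close>)
qed

lemma slope_total_derivative:
  assumes a: "a > 1/2" and g: "(g has_real_derivative g') (at a)"
  shows "\<exists>d. ((\<lambda>a. slope a (g a)) has_real_derivative d) (at a)"
proof -
  have "((\<lambda>a. 2 * g a) has_real_derivative 2 * g') (at a)"
    by (rule DERIV_cmult[OF g])
  from DERIV_chain2[OF has_field_derivative_sinh[OF DERIV_ident] this]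
  have "((\<lambda>a. a * sinh (2 * g a)) has_real_derivative
      1 * sinh (2 * g a) + (cosh (2 * g a) * 1 * (2 * g')) * a) (at a)"
    by (rule DERIV_mult[OF DERIV_ident])
  from DERIV_divide[OF this prof_total_derivative[OF a g] prof_nonzero[OF a]]
  show ?thesis
    unfolding slope_def by blast
qed

lemma mori_t_total_derivative:
  assumes a: "a > 1/2" and g: "(g has_real_derivative g') (at a)"
  shows "((\<lambda>a. mori_t a (g a)) has_real_derivative primitive (climb_param a) (g a) + climb a (g a) * g') (at a)"
proof (rule has_real_derivative_cong_interval[of _ _ _ "1/2" "a + 1"])
  show "((\<lambda>a. primitive (climb a) (g a)) has_real_derivative primitive (climb_param a) (g a) + climb a (g a) * g') (at a)"
    by (rule has_real_derivative_primitive_total[where U = "{1/2<..}", OF _ continuous_on_climb_param _ _ _ g])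
       (use a climb_has_real_derivative_param in auto)
qed (use a mori_t_eq in auto)

text \<open>Agreement on one side of \<open>c\<close> suffices, as is needed at the boundary of the band, beyond which an
  extension of a kernel function is arbitrary.\<close>

lemma derivatives_agree:
  fixes f g :: "real \<Rightarrow> real"
  assumes "(f has_real_derivative f') (at c)" "(g has_real_derivative g') (at c)"
    and "l < u" "c \<in> {l..u}" "\<And>x. x \<in> {l..u} \<Longrightarrow> f x = g x"
  shows "f' = g'"
proof -
  have "(g has_real_derivative f') (at c within {l..u})"
    by (rule has_field_derivative_transform_within[OF has_field_derivative_at_within[OF assms(1)], where d = 1])
       (use assms(4,5) in auto)
  moreover have "(g has_real_derivative g') (at c within {l..u})"
    by (rule has_field_derivative_at_within[OF assms(2)])
  ultimately show ?thesis
    using vector_derivative_unique_within_closed_interval[OF assms(3), of c g f' g'] assms(4)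
    by (simp add: has_real_derivative_iff_has_vector_derivative)
qed

text \<open>The defect measures how the boundary points move: the normal variation satisfies the linearized free
  boundary condition for the fixed ball exactly up to the term caused by the change of the radius, whose
  factor is the curvature \<open>K/b\<^sup>2\<close> of the profile.\<close>

lemma jacobi_field_boundary_defect:
  assumes a: "l < a" "a < u" "l \<ge> 1/2"
    and scaled_fb: "\<And>a. l < a \<Longrightarrow> a < u \<Longrightarrow>
      slope a (mori_s0 a) * sinh (mori_t a (mori_s0 a)) = mori_K a * cosh (mori_t a (mori_s0 a))"
    and s0: "mori_s0 a > 0" "(mori_s0 has_real_derivative s0') (at a)"
    and r: "(mori_r has_real_derivative r') (at a)"
  shows "jacobi_field_s a (mori_s0 a) - cosh (mori_r a) / sinh (mori_r a) * jacobi_field a (mori_s0 a)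
      = mori_K a / (prof a (mori_s0 a))\<^sup>2 * r'"
proof -
  have a': "a > 1/2"
    using a by simp
  define s where "s = mori_s0 a"
  define b p K k q w t where "b = prof a s" and "p = slope a s" and "K = mori_K a"
    and "k = climb a s" and "q = accel a s" and "w = sqrt (1 + b\<^sup>2)" and "t = mori_t a s"
  define n m where "n = prof_param a s + p * s0'" and "m = primitive (climb_param a) s + k * s0'"
  define c \<sigma> where "c = cosh t" and "\<sigma> = sinh t"
  have b: "b > 0" and K: "K > 0" and p: "p > 0" and w: "w > 0" and c: "c > 0"
    using prof_pos[OF a'] mori_K_pos[OF a'] slope_pos[OF a' s0(1)] one_plus_sq_pos[of b]
    by (simp_all add: b_def K_def p_def s_def w_def c_def)
  have w2: "w\<^sup>2 = 1 + b\<^sup>2"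
    by (simp add: w_def)
  have p2: "p\<^sup>2 = w\<^sup>2 - K\<^sup>2 / b\<^sup>2"
    unfolding w2 by (simp add: p_def b_def K_def slope_sq[OF a'])
  have q: "q = b + K\<^sup>2 / b ^ 3"
    by (simp add: q_def accel_def b_def K_def)
  have k: "k = K / (b * w\<^sup>2)"
    unfolding w2 by (simp add: k_def climb_def b_def K_def)
  have db: "((\<lambda>a. prof a (mori_s0 a)) has_real_derivative n) (at a)"
    using prof_total_derivative[OF a' s0(2)] by (simp add: n_def p_def s_def)
  have dt: "((\<lambda>a. mori_t a (mori_s0 a)) has_real_derivative m) (at a)"
    using mori_t_total_derivative[OF a' s0(2)] by (simp add: m_def k_def s_def)
  have dK: "(mori_K has_real_derivative a / K) (at a)"
    using mori_K_has_real_derivative[OF a'] by (simp add: K_def)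
  obtain P where dp: "((\<lambda>a. slope a (mori_s0 a)) has_real_derivative P) (at a)"
    using slope_total_derivative[OF a' s0(2)] by blast
  have dc: "((\<lambda>a. cosh (mori_t a (mori_s0 a))) has_real_derivative \<sigma> * m) (at a)"
    using DERIV_chain2[OF has_field_derivative_cosh[OF DERIV_ident] dt] by (simp add: \<sigma>_def t_def s_def)
  have ds: "((\<lambda>a. sinh (mori_t a (mori_s0 a))) has_real_derivative c * m) (at a)"
    using DERIV_chain2[OF has_field_derivative_sinh[OF DERIV_ident] dt] by (simp add: c_def t_def s_def)
  note vals = s_def[symmetric] b_def[symmetric] p_def[symmetric] K_def[symmetric] t_def[symmetric]
    c_def[symmetric] \<sigma>_def[symmetric]
  have P: "p * P = q * n - K * (a / K) / b\<^sup>2"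
  proof -
    have "((\<lambda>a. (slope a (mori_s0 a))\<^sup>2) has_real_derivative 2 * p * P) (at a)"
      by (rule DERIV_cong[OF DERIV_power[OF dp]]) (simp add: vals)
    moreover have "((\<lambda>a. 1 + (prof a (mori_s0 a))\<^sup>2 - (mori_K a)\<^sup>2 / (prof a (mori_s0 a))\<^sup>2) has_real_derivative
        2 * b * n - (2 * K * (a / K) * b\<^sup>2 - K\<^sup>2 * (2 * b * n)) / (b\<^sup>2 * b\<^sup>2)) (at a)"
      by (rule DERIV_cong[OF DERIV_diff[OF DERIV_add[OF DERIV_const DERIV_power[OF db]]
            DERIV_divide[OF DERIV_power[OF dK] DERIV_power[OF db]]]])
         (use b in \<open>simp_all add: vals prof_nonzero[OF a']\<close>)
    ultimately have "2 * p * P = 2 * b * n - (2 * K * (a / K) * b\<^sup>2 - K\<^sup>2 * (2 * b * n)) / (b\<^sup>2 * b\<^sup>2)"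
      by (rule derivatives_agree[where l = "(l + a) / 2" and u = "a"]) (use a slope_sq in auto)
    moreover have "(2 * K * (a / K) * b\<^sup>2 - K\<^sup>2 * (2 * b * n)) / (b\<^sup>2 * b\<^sup>2)
        = 2 * (K * (a / K) / b\<^sup>2) - 2 * (K\<^sup>2 / b ^ 3 * n)"
      using b by (simp add: field_simps power2_eq_square power3_eq_cube)
    ultimately show ?thesis
      unfolding q by (simp add: distrib_right)
  qed
  have fb0: "p * \<sigma> = K * c"
    using scaled_fb[OF a(1,2)] by (simp add: vals)
  have fb': "P * \<sigma> + p * (c * m) = (a / K) * c + K * (\<sigma> * m)"
  proof -
    have "((\<lambda>a. slope a (mori_s0 a) * sinh (mori_t a (mori_s0 a))) has_real_derivative P * \<sigma> + p * (c * m)) (at a)"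
      by (rule DERIV_cong[OF DERIV_mult[OF dp ds]]) (simp add: vals)
    moreover have "((\<lambda>a. mori_K a * cosh (mori_t a (mori_s0 a))) has_real_derivative (a / K) * c + K * (\<sigma> * m)) (at a)"
      by (rule DERIV_cong[OF DERIV_mult[OF dK dc]]) (simp add: vals)
    ultimately show ?thesis
      by (rule derivatives_agree[where l = "(l + a) / 2" and u = "a"]) (use a scaled_fb in auto)
  qed
  have Cr: "cosh (mori_r a) = w * c"
    using cosh_mori_r(2)[OF a'] by (simp add: vals w_def)
  have "((\<lambda>a. cosh (mori_r a)) has_real_derivative sinh (mori_r a) * r') (at a)"
    using DERIV_chain2[OF has_field_derivative_cosh[OF DERIV_ident] r] by simp
  moreover have "((\<lambda>a. sqrt (1 + (prof a (mori_s0 a))\<^sup>2) * cosh (mori_t a (mori_s0 a))) has_real_derivative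
      b * n / w * c + w * (\<sigma> * m)) (at a)"
  proof -
    have "((\<lambda>a. sqrt (1 + (prof a (mori_s0 a))\<^sup>2)) has_real_derivative b * n / w) (at a)"
      by (rule DERIV_cong[OF DERIV_chain2[OF DERIV_real_sqrt DERIV_add[OF DERIV_const DERIV_power[OF db]]]])
         (simp_all add: vals w_def divide_simps)
    from DERIV_mult[OF this dc] show ?thesis
      by (rule DERIV_cong) (simp add: vals w_def)
  qed
  ultimately have r': "sinh (mori_r a) * r' = b * n / w * c + w * (\<sigma> * m)"
    by (rule derivatives_agree[where l = "(l + a) / 2" and u = "a"]) (use a cosh_mori_r in auto)
  have Sr: "sinh (mori_r a) = b * c * w / p"
  proof -
    have "c\<^sup>2 - \<sigma>\<^sup>2 = 1"
      by (simp add: c_def \<sigma>_def cosh_square_eq)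
    moreover have "\<sigma> = K * c / p"
      using fb0 p by (simp add: field_simps)
    ultimately have "c\<^sup>2 * (p\<^sup>2 - K\<^sup>2) = p\<^sup>2"
      using p by (simp add: field_simps)
    moreover have "p\<^sup>2 * b\<^sup>2 = w\<^sup>2 * b\<^sup>2 - K\<^sup>2"
      unfolding p2 using b by (simp add: field_simps)
    ultimately have "p\<^sup>2 * (w\<^sup>2 * c\<^sup>2 - 1) = (b * c * w)\<^sup>2"
      using w2 by algebra
    then have "(sinh (mori_r a))\<^sup>2 = (b * c * w / p)\<^sup>2"
      using p by (simp add: sinh_square_eq Cr power_mult_distrib power_divide field_simps)
    then show ?thesis
      using cosh_mori_r(1)[OF a'] b c w p by (subst (asm) power2_eq_iff_nonneg) auto
  qed
  have Sr0: "sinh (mori_r a) > 0"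
    unfolding Sr using b c w p by simp
  have "jacobi_field a s = p * m - k * n"
    by (simp add: jacobi_field_def m_def n_def p_def k_def algebra_simps)
  moreover have "b * (jacobi_field_s a s * p - jacobi_field a s * q) = a / K"
    using jacobi_field_wronskian[OF a', of s] by (simp add: b_def p_def q_def K_def)
  ultimately have "sinh (mori_r a) * jacobi_field_s a s - w * c * jacobi_field a s = K / b\<^sup>2 * (sinh (mori_r a) * r')"
    using b w p c w2 p2 q k P fb0 fb' Sr r'
    by (intro boundary_defect_algebra[where m = m and n = n and P = P and Ka = "a / K" and \<sigma> = \<sigma> and k = k and q = q and p = p]) auto
  then have "jacobi_field_s a s - (w * c) / sinh (mori_r a) * jacobi_field a s = K / b\<^sup>2 * r'"
    using Sr0 by (simp add: field_simps)
  then show ?thesis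
    by (simp add: Cr vals)
qed

section \<open>The kernel\<close>

lemma vector2_shift:
  "vector [s, \<theta>] + h *\<^sub>R axis 1 1 = (vector [s + h, \<theta>] :: real^2)"
  "vector [s, \<theta>] + h *\<^sub>R axis 2 1 = (vector [s, \<theta> + h] :: real^2)"
  by (simp_all add: vec_eq_iff forall_2)

lemma vector2_surj: "(x :: real^2) = vector [x $ 1, x $ 2]"
  by (simp add: vec_eq_iff forall_2)

lemma Ck_on_const: "Ck_on k S (\<lambda>x. c)"
proof (induction k arbitrary: c)
  case (Suc k)
  then show ?case
    by (auto intro!: exI[of _ "\<lambda>x h. 0"])
qed simp

lemma partial_eq_derivative:
  assumes "(f has_derivative f') (at x)"
  shows "partial i f x = f' (axis i 1)"
proof (rule partialI)
  have "((\<lambda>h. x + h *\<^sub>R axis i 1) has_derivative (\<lambda>h. h *\<^sub>R axis i 1)) (at (0::real))"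
    by (auto intro!: derivative_eq_intros)
  from has_derivative_compose[OF this] assms
  have "((\<lambda>h. f (x + h *\<^sub>R axis i 1)) has_derivative (\<lambda>h. f' (h *\<^sub>R axis i 1))) (at 0)"
    by simp
  then show "((\<lambda>h. f (x + h *\<^sub>R axis i 1)) has_vector_derivative f' (axis i 1)) (at 0)"
    using linear_scale[OF has_derivative_linear[OF assms]] by (simp add: has_vector_derivative_def)
qed

lemma smooth_on_partial:
  fixes F :: "real^2 \<Rightarrow> real"
  assumes "smooth_on UNIV F"
  shows "smooth_on UNIV (partial i F)"
  unfolding smooth_on_def
proof
  fix k
  have "Ck_on (Suc k) UNIV F"
    using assms by (simp add: smooth_on_def)
  then obtain F' where F': "\<And>x. (F has_derivative F' x) (at x)" "\<And>v. Ck_on k UNIV (\<lambda>x. F' x v)"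
    by auto
  have "partial i F = (\<lambda>x. F' x (axis i 1))"
    using partial_eq_derivative[OF F'(1)] by auto
  then show "Ck_on k UNIV (partial i F)"
    using F'(2) by simp
qed

lemma smooth_on_slice_derivative:
  fixes F :: "real^2 \<Rightarrow> real"
  assumes "smooth_on UNIV F"
  shows "((\<lambda>s. F (vector [s, \<theta>])) has_real_derivative partial 1 F (vector [s, \<theta>])) (at s)"
proof -
  have "Ck_on (Suc 0) UNIV F"
    using assms unfolding smooth_on_def by blast
  then obtain F' where F': "\<And>x. (F has_derivative F' x) (at x)"
    by auto
  have "((\<lambda>h. vector [s, \<theta>] + h *\<^sub>R axis 1 1 :: real^2) has_derivative (\<lambda>h. h *\<^sub>R axis 1 1)) (at 0)"
    by (auto intro!: derivative_eq_intros)
  from has_derivative_compose[OF this] F'[of "vector [s, \<theta>]"]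
  have "((\<lambda>h. F (vector [s + h, \<theta>])) has_derivative (\<lambda>h. F' (vector [s, \<theta>]) (h *\<^sub>R axis 1 1))) (at 0)"
    by (simp add: vector2_shift)
  moreover have "F' (vector [s, \<theta>]) (h *\<^sub>R axis 1 1) = partial 1 F (vector [s, \<theta>]) * h" for h
    using linear_scale[OF has_derivative_linear[OF F'[of "vector [s, \<theta>]"]]]
    by (simp add: partial_eq_derivative[OF F'])
  ultimately have "((\<lambda>h. F (vector [s + h, \<theta>])) has_real_derivative partial 1 F (vector [s, \<theta>])) (at 0)"
    by (simp add: has_field_derivative_def fun_eq_iff)
  then show ?thesis
    using DERIV_shift[of "\<lambda>s. F (vector [s, \<theta>])" "partial 1 F (vector [s, \<theta>])" 0 s] by (simp add: add.commute)
qed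

lemma in_mori_band [simp]: "vector [s, \<theta>] \<in> mori_band a \<longleftrightarrow> \<bar>s\<bar> \<le> mori_s0 a"
  by (simp add: mori_band_def)

text \<open>The first component of a normal along the profile never vanishes, so by continuity it keeps its sign.\<close>

lemma normal_sign_constant:
  assumes \<nu>: "unit_normal_family \<nu>" and a: "a > 1/2"
  obtains e where "e = 1 \<or> e = -1" "\<And>s. \<nu> a (vector [s, 0]) = e *\<^sub>R mori_normal a s"
proof -
  define g where "g s = \<nu> a (vector [s, 0]) $ 1" for s
  have alt: "\<nu> a (vector [s, 0]) = mori_normal a s \<or> \<nu> a (vector [s, 0]) = - mori_normal a s" for s
  proof -
    have "is_unit_normal (mori_surface a) (vector [s, 0]) (\<nu> a (vector [s, 0]))"
      using \<nu> a unfolding unit_normal_family_def by blast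
    then show ?thesis
      unfolding is_unit_normal_mori_iff[OF a] by simp
  qed
  have neg: "mori_normal a s $ 1 < 0" for s
    using climb_pos[OF a, of s] by (simp add: mori_normal_def add_pos_nonneg)
  have "Ck_on 0 ({1/2<..} \<times> UNIV) (\<lambda>(a, x). \<nu> a x)"
    using \<nu> unfolding unit_normal_family_def smooth_on_def by blast
  then have cont: "continuous_on ({1/2<..} \<times> UNIV) (\<lambda>(a, x). \<nu> a x)"
    by simp
  have "continuous_on UNIV (\<lambda>s. vector [s, 0] :: real^2)"
  proof -
    have "(vector [s, 0] :: real^2) = s *\<^sub>R axis 1 1" for s
      by (simp add: vec_eq_iff forall_2)
    then show ?thesis
      by (auto intro!: continuous_intros)
  qed
  then have "continuous_on UNIV (\<lambda>s. (a, vector [s, 0] :: real^2))"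
    by (intro continuous_intros)
  then have "continuous_on UNIV (\<lambda>s. (\<lambda>(a, x). \<nu> a x) (a, vector [s, 0]))"
    by (rule continuous_on_compose2[OF cont]) (use a in blast)
  then have "continuous_on UNIV (\<lambda>s. \<nu> a (vector [s, 0]))"
    by simp
  then have gc: "continuous_on UNIV g"
    unfolding g_def by (intro continuous_intros)
  have g0: "g s \<noteq> 0" for s
    using alt[of s] neg[of s] by (auto simp: g_def)
  have same: "g s < 0 \<longleftrightarrow> g 0 < 0" for s
  proof (rule ccontr)
    assume "\<not> ?thesis"
    then have "0 \<in> closed_segment (g 0) (g s)"
      using g0[of 0] g0[of s] by (auto simp: closed_segment_eq_real_ivl)
    moreover have "closed_segment (g 0) (g s) \<subseteq> range g"
      using connected_continuous_image[OF gc] by (intro closed_segment_subset) (auto simp: is_interval_connected_1[symmetric] is_interval_convex)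
    ultimately show False
      using g0 by auto
  qed
  show ?thesis
  proof (rule that)
    define e :: real where "e = (if g 0 < 0 then 1 else -1)"
    show "e = 1 \<or> e = -1"
      by (simp add: e_def)
    show "\<nu> a (vector [s, 0]) = e *\<^sub>R mori_normal a s" for s
      using alt[of s] neg[of s] same[of s] by (auto simp: e_def g_def)
  qed
qed

text \<open>The reparametrization by \<open>s\<^sub>0(a) \<tau>\<close> changes the variation field by a tangential vector only, which the
  normal does not see.\<close>

lemma parametric_field_eq_jacobi_field:
  assumes a: "a > 1/2" and s0: "mori_s0 a > 0" "(mori_s0 has_real_derivative s0') (at a)"
    and s: "\<bar>s\<bar> \<le> mori_s0 a" and e: "\<nu> a (vector [s, 0]) = e *\<^sub>R mori_normal a s"
  shows "parametric_field \<nu> a (vector [s, 0]) = e * jacobi_field a s"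
proof -
  define \<tau> where "\<tau> = s / mori_s0 a"
  have \<tau>: "mori_s0 a * \<tau> = s"
    using s0 by (simp add: \<tau>_def)
  define W where "W = sqrt (1 + (prof a s)\<^sup>2)"
  have W: "W > 0"
    by (simp add: W_def add_pos_nonneg)
  have g: "((\<lambda>a. mori_s0 a * \<tau>) has_real_derivative s0' * \<tau>) (at a)"
    by (rule DERIV_cmult_right[OF s0(2)])
  define n m where "n = prof_param a s + slope a s * (s0' * \<tau>)"
    and "m = primitive (climb_param a) s + climb a s * (s0' * \<tau>)"
  have dt: "((\<lambda>\<alpha>. mori_t \<alpha> (mori_s0 \<alpha> * \<tau>)) has_real_derivative m) (at a)"
    using mori_t_total_derivative[OF a g] by (simp add: \<tau> m_def)
  have "((\<lambda>\<alpha>. arsinh (prof \<alpha> (mori_s0 \<alpha> * \<tau>))) has_real_derivative n / W) (at a)"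
    by (rule DERIV_cong[OF DERIV_chain2[OF arsinh_real_has_field_derivative prof_total_derivative[OF a g]]])
       (simp add: \<tau> n_def W_def add.commute)
  then have du: "((\<lambda>\<alpha>. mori_u \<alpha> (mori_s0 \<alpha> * \<tau>)) has_real_derivative n / W) (at a)"
    by (rule has_real_derivative_cong_interval[where l = "1/2" and u = "a + 1"])
       (use a in \<open>auto simp: mori_u_def mori_b_eq\<close>)
  have "((\<lambda>\<alpha>. mori_Psi \<alpha> \<tau> 0) has_vector_derivative vector [n / W, m, 0]) (at a)"
    unfolding mori_Psi_def mori_surface_def vector_2
    by (rule has_vector_derivative_vector3[OF du dt _ refl]) simp
  then have "vector_derivative (\<lambda>\<alpha>. mori_Psi \<alpha> \<tau> 0) (at a) = vector [n / W, m, 0]"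
    by (rule vector_derivative_at)
  then have "parametric_field \<nu> a (vector [s, 0])
      = hyp_inner (mori_surface a (vector [s, 0])) (vector [n / W, m, 0]) (e *\<^sub>R mori_normal a s)"
    using s e by (simp add: parametric_field_def \<tau>_def)
  also have "\<dots> = e * (slope a s * m - climb a s * n)"
  proof -
    have cu: "cosh (mori_u a s) = W"
      by (simp add: cosh_mori_u[OF a] W_def)
    have "mori_normal a s = vector [- W * climb a s, slope a s / W / W, 0]"
      by (simp add: mori_normal_def W_def u_slope_def)
    then show ?thesis
      using W by (simp add: hyp_inner_eq cu field_simps power2_eq_square)
  qed
  also have "slope a s * m - climb a s * n = jacobi_field a s"
    by (simp add: m_def n_def jacobi_field_def algebra_simps)
  finally show ?thesis .
qed

lemma parametric_field_not_in_kernel: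
  assumes a: "a > 1/2" and s0: "mori_s0 a > 0" "(mori_s0 has_real_derivative s0') (at a)"
    and defect: "jacobi_field_s a (mori_s0 a) - cosh (mori_r a) / sinh (mori_r a) * jacobi_field a (mori_s0 a) \<noteq> 0"
    and \<nu>: "unit_normal_family \<nu>"
  shows "parametric_field \<nu> a \<notin> jacobi_kernel a (mori_r a)"
proof
  define S where "S = mori_s0 a"
  assume "parametric_field \<nu> a \<in> jacobi_kernel a (mori_r a)"
  then obtain F where F: "smooth_on UNIV F" "\<And>x. x \<in> mori_band a \<Longrightarrow> parametric_field \<nu> a x = F x"
    and bd: "\<And>x. \<bar>x $ 1\<bar> = mori_s0 a \<Longrightarrow>
      conormal_deriv (mori_surface a) F x - cosh (mori_r a) / sinh (mori_r a) * F x = 0"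
    unfolding jacobi_kernel_def by blast
  obtain e where e: "e = 1 \<or> e = -1" "\<And>s. \<nu> a (vector [s, 0]) = e *\<^sub>R mori_normal a s"
    using normal_sign_constant[OF \<nu> a] by blast
  have Fj: "F (vector [s, 0]) = e * jacobi_field a s" if "s \<in> {0..S}" for s
  proof -
    have s: "\<bar>s\<bar> \<le> mori_s0 a"
      using that by (simp add: S_def)
    have "parametric_field \<nu> a (vector [s, 0]) = e * jacobi_field a s"
      by (rule parametric_field_eq_jacobi_field[where e = e, OF a s0 s]) (rule e(2))
    then show ?thesis
      using F(2)[of "vector [s, 0]"] s by simp
  qed
  have "partial 1 F (vector [S, 0]) = e * jacobi_field_s a S"
    by (rule derivatives_agree[OF smooth_on_slice_derivative[OF F(1)]
          DERIV_cmult[OF jacobi_field_has_real_derivative[OF a]], of 0 S])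
       (use Fj s0 in \<open>auto simp: S_def\<close>)
  then have "e * jacobi_field_s a S - cosh (mori_r a) / sinh (mori_r a) * (e * jacobi_field a S) = 0"
    using bd[of "vector [S, 0]"] s0 Fj[of S] by (simp add: conormal_deriv_mori[OF a] S_def)
  then have "e * (jacobi_field_s a S - cosh (mori_r a) / sinh (mori_r a) * jacobi_field a S) = 0"
    by (simp add: algebra_simps)
  then show False
    using e(1) defect by (auto simp: S_def)
qed

text \<open>Rotational symmetry is assumed on one parallel only, because an extension of a kernel function is
  arbitrary outside the band.\<close>

lemma laplace_beltrami_rotational:
  fixes F :: "real^2 \<Rightarrow> real"
  assumes a: "a > 1/2" and F: "smooth_on UNIV F" and c: "\<And>\<theta>. F (vector [s, \<theta>]) = c"
  shows "laplace_beltrami (mori_surface a) F (vector [s, 0]) =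
    (slope a s * partial 1 F (vector [s, 0]) + prof a s * partial 1 (partial 1 F) (vector [s, 0])) / prof a s"
proof -
  have p2: "partial 2 F (vector [s, \<theta>]) = 0" for \<theta>
    by (rule partialI) (simp add: vector2_shift c)
  have "partial 2 (\<lambda>y. prof a (y $ 1) * (partial 2 F y / (prof a (y $ 1))\<^sup>2)) (vector [s, 0]) = 0"
    by (rule partialI) (simp add: vector2_shift p2)
  moreover have "partial 1 (\<lambda>y. prof a (y $ 1) * partial 1 F y) (vector [s, 0])
      = slope a s * partial 1 F (vector [s, 0]) + prof a s * partial 1 (partial 1 F) (vector [s, 0])"
  proof (rule partialI)
    have "((\<lambda>s. prof a s * partial 1 F (vector [s, 0])) has_real_derivative
       slope a s * partial 1 F (vector [s, 0]) + prof a s * partial 1 (partial 1 F) (vector [s, 0])) (at s)"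
      by (rule DERIV_cong[OF DERIV_mult[OF prof_has_real_derivative[OF a]
            smooth_on_slice_derivative[OF smooth_on_partial[OF F]]]]) simp
    from shift_at_0[OF this]
    show "((\<lambda>h. prof a ((vector [s, 0] + h *\<^sub>R axis 1 1) $ 1) * partial 1 F (vector [s, 0] + h *\<^sub>R axis 1 1))
        has_vector_derivative slope a s * partial 1 F (vector [s, 0]) + prof a s * partial 1 (partial 1 F) (vector [s, 0])) (at 0)"
      unfolding vector2_shift by (simp add: has_real_derivative_iff_has_vector_derivative)
  qed
  ultimately show ?thesis
    by (simp add: laplace_beltrami_mori[OF a])
qed

lemma constant_on_interval:
  fixes f :: "real \<Rightarrow> real"
  assumes d: "\<And>x. x \<in> {l..u} \<Longrightarrow> (f has_real_derivative 0) (at x)" and x: "x \<in> {l..u}"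
  shows "f x = f l"
proof (cases "l = u")
  case False
  then have "l < u"
    using x by simp
  moreover have "continuous_on {l..u} f"
    by (rule DERIV_continuous_on[OF has_field_derivative_at_within[OF d]])
  ultimately show ?thesis
    by (rule DERIV_isconst2) (use d x in \<open>simp_all\<close>)
qed (use x in simp)

text \<open>Reduction of order with the solution \<open>b\<^sub>s\<close>. The Wronskian of \<open>y\<close> with \<open>b\<^sub>s\<close> is constant, so a
  multiple of the Jacobi field can be subtracted to make it vanish. The remainder is then a multiple of
  \<open>b\<^sub>s\<close>, and since its derivative at 0 vanishes while that of \<open>b\<^sub>s\<close> does not, it is 0. In this way the
  second-order equation of the Jacobi field itself never has to be verified.\<close>

lemma even_jacobi_solution:
  assumes a: "a > 1/2" and S: "S > 0"
    and y: "\<And>s. (y has_real_derivative y1 s) (at s)" "\<And>s. (y1 has_real_derivative y2 s) (at s)"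
    and ode: "\<And>s. s \<in> {0..S} \<Longrightarrow> (slope a s * y1 s + prof a s * y2 s) / prof a s
        + (2 * (mori_K a)\<^sup>2 / (prof a s) ^ 4 - 2) * y s = 0"
    and y10: "y1 0 = 0"
  obtains \<mu> where "\<And>s. s \<in> {0..S} \<Longrightarrow> y s = \<mu> * jacobi_field a s" "y1 S = \<mu> * jacobi_field_s a S"
proof -
  define K where "K = mori_K a"
  have K: "K > 0"
    using mori_K_pos[OF a] by (simp add: K_def)
  note b0 = prof_nonzero[OF a]
  \<comment> \<open>The Wronskian \<open>b (y\<^sub>s b\<^sub>s - y b\<^sub>s\<^sub>s)\<close>, with \<open>b b\<^sub>s\<^sub>s\<close> written as a function of \<open>b\<close>.\<close>
  define Wr where "Wr s = prof a s * (y1 s * slope a s) - y s * ((prof a s)\<^sup>2 + K\<^sup>2 / (prof a s)\<^sup>2)" for s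
  have ba: "prof a s * accel a s = (prof a s)\<^sup>2 + K\<^sup>2 / (prof a s)\<^sup>2" for s
    using b0[of s] by (simp add: accel_def K_def field_simps power2_eq_square power3_eq_cube)
  have dWr: "(Wr has_real_derivative 0) (at s)" if "s \<in> {0..S}" for s
  proof -
    define b p where "b = prof a s" and "p = slope a s"
    have b: "b \<noteq> 0"
      using b0 by (simp add: b_def)
    have 1: "((\<lambda>s. prof a s * (y1 s * slope a s)) has_real_derivative
        p * (y1 s * p) + (y2 s * p + accel a s * y1 s) * b) (at s)"
      unfolding b_def p_def
      by (rule DERIV_mult[OF prof_has_real_derivative[OF a] DERIV_mult[OF y(2) slope_has_real_derivative_accel[OF a]]])
    have "((\<lambda>s. (prof a s)\<^sup>2 + K\<^sup>2 / (prof a s)\<^sup>2) has_real_derivative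
        2 * b * p + (0 * b\<^sup>2 - K\<^sup>2 * (2 * b * p)) / (b\<^sup>2 * b\<^sup>2)) (at s)"
      by (rule DERIV_cong[OF DERIV_add[OF DERIV_power[OF prof_has_real_derivative[OF a]]
            DERIV_divide[OF DERIV_const DERIV_power[OF prof_has_real_derivative[OF a]]]]])
         (simp_all add: b0 b_def p_def)
    from DERIV_diff[OF 1 DERIV_mult[OF y(1) this]]
    have "(Wr has_real_derivative p * (y1 s * p) + (y2 s * p + accel a s * y1 s) * b
        - (y1 s * (b\<^sup>2 + K\<^sup>2 / b\<^sup>2) + (2 * b * p + (0 * b\<^sup>2 - K\<^sup>2 * (2 * b * p)) / (b\<^sup>2 * b\<^sup>2)) * y s)) (at s)"
      unfolding Wr_def[abs_def] b_def p_def .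
    moreover have "p * (y1 s * p) + (y2 s * p + accel a s * y1 s) * b
        - (y1 s * (b\<^sup>2 + K\<^sup>2 / b\<^sup>2) + (2 * b * p + (0 * b\<^sup>2 - K\<^sup>2 * (2 * b * p)) / (b\<^sup>2 * b\<^sup>2)) * y s)
        = p * b * ((p * y1 s + b * y2 s) / b + (2 * K\<^sup>2 / b ^ 4 - 2) * y s)"
      using b by (simp add: ba[of s, folded b_def, symmetric])
        (simp add: field_simps power_numeral_reduce)
    ultimately show ?thesis
      using ode[OF that] by (simp add: b_def p_def K_def)
  qed
  have Wr: "Wr s = Wr 0" if "s \<in> {0..S}" for s
    by (rule constant_on_interval[OF dWr that])
  define \<mu> where "\<mu> = Wr 0 * K / a"
  define z z1 where "z s = y s - \<mu> * jacobi_field a s" and "z1 s = y1 s - \<mu> * jacobi_field_s a s" for s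
  have dz: "(z has_real_derivative z1 s) (at s)" for s
    unfolding z_def[abs_def] z1_def by (rule DERIV_diff[OF y(1) DERIV_cmult[OF jacobi_field_has_real_derivative[OF a]]])
  have zW: "z1 s * slope a s = z s * accel a s" if "s \<in> {0..S}" for s
  proof -
    have "prof a s * (z1 s * slope a s - z s * accel a s)
        = (prof a s * (y1 s * slope a s) - y s * (prof a s * accel a s))
          - \<mu> * (prof a s * (jacobi_field_s a s * slope a s - jacobi_field a s * accel a s))"
      by (simp add: z_def z1_def algebra_simps)
    also have "\<dots> = Wr s - \<mu> * (a / K)"
      unfolding jacobi_field_wronskian[OF a] ba Wr_def K_def ..
    also have "\<dots> = 0"
      unfolding Wr[OF that] \<mu>_def using K a by simp
    finally show ?thesis
      using b0[of s] by simp
  qed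
  \<comment> \<open>At 0 the slope vanishes but the acceleration does not.\<close>
  have z0: "z 0 = 0"
    using zW[of 0] S accel_pos[OF a, of 0] by simp
  define c where "c = z S / slope a S"
  have zc: "z s = c * slope a s" if s: "s \<in> {0<..S}" for s
  proof (cases "s = S")
    case True
    then show ?thesis
      using slope_pos[OF a S] by (simp add: c_def)
  next
    case False
    then have sS: "s < S"
      using s by simp
    have d: "((\<lambda>s. z s / slope a s) has_real_derivative 0) (at x)" if "x \<in> {s..S}" for x
    proof -
      have "slope a x \<noteq> 0"
        using slope_pos[OF a, of x] that s by simp
      from DERIV_divide[OF dz slope_has_real_derivative_accel[OF a] this] show ?thesis
        using zW[of x] that s by simp
    qed
    have "z S / slope a S = z s / slope a s"
      by (rule constant_on_interval[of s S "\<lambda>s. z s / slope a s", OF d]) (use sS in simp_all)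
    then show ?thesis
      using slope_pos[OF a, of s] s by (simp add: c_def)
  qed
  have zc0: "z s = c * slope a s" if "s \<in> {0..S}" for s
    using zc[of s] z0 that by (cases "s = 0") auto
  have "z1 0 = c * accel a 0"
    by (rule derivatives_agree[OF dz DERIV_cmult[OF slope_has_real_derivative_accel[OF a]], of 0 S]) (use S zc0 in auto)
  moreover have "z1 0 = 0"
    by (simp add: z1_def y10 jacobi_field_s_0[OF a])
  ultimately have "c = 0"
    using accel_pos[OF a, of 0] by simp
  then have zz: "z s = 0" if "s \<in> {0..S}" for s
    using zc0[OF that] by simp
  have "z1 S = 0"
    using zW[of S] zz[of S] slope_pos[OF a S] S by simp
  then show ?thesis
    using that[of \<mu>] zz by (simp add: z_def z1_def)
qed

lemma zero_in_even_kernel: "(\<lambda>x. 0) \<in> jacobi_kernel_0_ev a"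
proof -
  have p0: "partial i (\<lambda>x. 0 :: real) x = 0" for i :: 2 and x
    by (rule partialI) simp
  show ?thesis
    unfolding jacobi_kernel_0_ev_def jacobi_kernel_def
    by (auto intro!: exI[of _ "\<lambda>x. 0"]
        simp: smooth_on_def Ck_on_const laplace_beltrami_def conormal_deriv_def p0)
qed

lemma even_kernel_trivial:
  assumes a: "a > 1/2" and s0: "mori_s0 a > 0"
    and defect: "jacobi_field_s a (mori_s0 a) - cosh (mori_r a) / sinh (mori_r a) * jacobi_field a (mori_s0 a) \<noteq> 0"
    and f: "f \<in> jacobi_kernel_0_ev a"
  shows "f = (\<lambda>x. 0)"
proof -
  define S where "S = mori_s0 a"
  have S: "S > 0"
    using s0 by (simp add: S_def)
  have out: "\<And>x. x \<notin> mori_band a \<Longrightarrow> f x = 0"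
    and rot: "\<And>s \<theta> \<theta>'. f (vector [s, \<theta>]) = f (vector [s, \<theta>'])"
    and even: "\<And>s \<theta>. f (vector [- s, \<theta>]) = f (vector [s, \<theta>])"
    using f unfolding jacobi_kernel_0_ev_def jacobi_kernel_def by blast+
  obtain F where F: "smooth_on UNIV F" "\<And>x. x \<in> mori_band a \<Longrightarrow> f x = F x"
    and lap: "\<And>x. x \<in> mori_band a \<Longrightarrow>
      laplace_beltrami (mori_surface a) F x + (normA_sq (mori_surface a) x - 2) * F x = 0"
    and bd: "\<And>x. \<bar>x $ 1\<bar> = mori_s0 a \<Longrightarrow>
      conormal_deriv (mori_surface a) F x - cosh (mori_r a) / sinh (mori_r a) * F x = 0"
    using f unfolding jacobi_kernel_0_ev_def jacobi_kernel_def by blast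
  define y y1 y2 where "y s = F (vector [s, 0])" and "y1 s = partial 1 F (vector [s, 0])"
    and "y2 s = partial 1 (partial 1 F) (vector [s, 0])" for s
  have dy: "(y has_real_derivative y1 s) (at s)" for s
    unfolding y_def[abs_def] y1_def by (rule smooth_on_slice_derivative[OF F(1)])
  have dy1: "(y1 has_real_derivative y2 s) (at s)" for s
    unfolding y1_def[abs_def] y2_def by (rule smooth_on_slice_derivative[OF smooth_on_partial[OF F(1)]])
  have ode: "(slope a s * y1 s + prof a s * y2 s) / prof a s
      + (2 * (mori_K a)\<^sup>2 / (prof a s) ^ 4 - 2) * y s = 0" if "s \<in> {0..S}" for s
  proof -
    have s: "\<bar>s\<bar> \<le> mori_s0 a"
      using that by (simp add: S_def)
    have "F (vector [s, \<theta>]) = y s" for \<theta>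
      using F(2)[of "vector [s, \<theta>]"] F(2)[of "vector [s, 0]"] rot[of s \<theta> 0] s by (simp add: y_def)
    from laplace_beltrami_rotational[OF a F(1) this] lap[of "vector [s, 0]"] show ?thesis
      using s by (simp add: normA_sq_mori[OF a] y_def y1_def y2_def)
  qed
  have yeven: "y (- s) = y s" if "s \<in> {- S..S}" for s
    using F(2)[of "vector [s, 0]"] F(2)[of "vector [- s, 0]"] even[of s 0] that
    by (simp add: y_def S_def abs_le_iff)
  have "y1 0 = - y1 0"
  proof (rule derivatives_agree[where f = y and g = "\<lambda>s. y (- s)" and c = 0 and l = "- S" and u = S])
    show "(y has_real_derivative y1 0) (at 0)"
      by (rule dy)
    show "((\<lambda>s. y (- s)) has_real_derivative - y1 0) (at 0)"
      by (rule DERIV_cong[OF DERIV_chain2[where f = y and g = uminus, OF dy DERIV_minus[OF DERIV_ident]]]) simp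
  qed (use S yeven in auto)
  then have "y1 0 = 0"
    by simp
  then obtain \<mu> where \<mu>: "\<And>s. s \<in> {0..S} \<Longrightarrow> y s = \<mu> * jacobi_field a s" "y1 S = \<mu> * jacobi_field_s a S"
    using even_jacobi_solution[OF a S dy dy1 ode] by blast
  have "y1 S - cosh (mori_r a) / sinh (mori_r a) * y S = 0"
    using bd[of "vector [S, 0]"] S by (simp add: conormal_deriv_mori[OF a] y1_def y_def S_def)
  then have "\<mu> * (jacobi_field_s a S - cosh (mori_r a) / sinh (mori_r a) * jacobi_field a S) = 0"
    using \<mu>(1)[of S] \<mu>(2) S by (simp add: algebra_simps)
  then have "\<mu> = 0"
    using defect by (simp add: S_def)
  then have y0: "y s = 0" if "s \<in> {- S..S}" for s
    using \<mu>(1)[of "\<bar>s\<bar>"] yeven[OF that] that by (cases "s \<ge> 0") (auto simp: abs_le_iff)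
  show ?thesis
  proof
    fix x
    show "f x = 0"
    proof (cases "x \<in> mori_band a")
      case True
      then have x: "x $ 1 \<in> {- S..S}"
        by (simp add: mori_band_def S_def abs_le_iff)
      have "f x = f (vector [x $ 1, 0])"
        using rot[of "x $ 1" "x $ 2" 0] vector2_surj[of x] by simp
      also have "\<dots> = y (x $ 1)"
        using F(2)[of "vector [x $ 1, 0]"] x by (simp add: y_def S_def abs_le_iff)
      finally show ?thesis
        using y0[OF x] by simp
    qed (rule out)
  qed
qed

theorem corollary6p1:
  shows "(\<exists>\<epsilon>>0. strict_mono_on {1/2<..<1/2 + \<epsilon>} mori_H) \<and>
    (\<exists>\<delta>0>0. \<forall>a\<in>{1/2<..<1/2 + \<delta>0}.
       (\<exists>r'. (mori_r has_real_derivative r') (at a) \<and> r' > 0) \<and>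
       (\<forall>\<nu>. unit_normal_family \<nu> \<longrightarrow>
          parametric_field \<nu> a \<notin> jacobi_kernel a (mori_r a)) \<and>
       has_dimension (jacobi_kernel_0_ev a) 0)"
proof -
  obtain \<delta> where \<delta>: "\<delta> > 0"
    and s0: "\<And>a. a \<in> {1/2<..<1/2 + \<delta>} \<Longrightarrow> mori_s0 a > 0"
    and scaled_fb: "\<And>a. a \<in> {1/2<..<1/2 + \<delta>} \<Longrightarrow>
      slope a (mori_s0 a) * sinh (mori_t a (mori_s0 a)) = mori_K a * cosh (mori_t a (mori_s0 a))"
    and ds0: "\<And>a. a \<in> {1/2<..<1/2 + \<delta>} \<Longrightarrow> \<exists>d. (mori_s0 has_real_derivative d) (at a)"
    and dr: "\<And>a. a \<in> {1/2<..<1/2 + \<delta>} \<Longrightarrow> \<exists>d. (mori_r has_real_derivative d) (at a) \<and> d > 0"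
    and dH: "\<And>a. a \<in> {1/2<..<1/2 + \<delta>} \<Longrightarrow> \<exists>d. (mori_H has_real_derivative d) (at a) \<and> d > 0"
    using mori_near_limit by blast
  have "strict_mono_on {1/2<..<1/2 + \<delta>} mori_H"
  proof (rule strict_mono_onI)
    fix x y assume xy: "x \<in> {1/2<..<1/2 + \<delta>}" "y \<in> {1/2<..<1/2 + \<delta>}" "x < y"
    show "mori_H x < mori_H y"
      by (rule DERIV_pos_imp_increasing[OF xy(3)], rule dH) (use xy in simp)
  qed
  moreover have "(\<exists>r'. (mori_r has_real_derivative r') (at a) \<and> r' > 0) \<and>
       (\<forall>\<nu>. unit_normal_family \<nu> \<longrightarrow>
          parametric_field \<nu> a \<notin> jacobi_kernel a (mori_r a)) \<and>
       has_dimension (jacobi_kernel_0_ev a) 0" if a: "a \<in> {1/2<..<1/2 + \<delta>}" for a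
  proof -
    have a': "a > 1/2" "a < 1/2 + \<delta>"
      using a by auto
    obtain s0' where s0': "(mori_s0 has_real_derivative s0') (at a)"
      using ds0[OF a] by blast
    obtain r' where r': "(mori_r has_real_derivative r') (at a)" "r' > 0"
      using dr[OF a] by blast
    have "jacobi_field_s a (mori_s0 a) - cosh (mori_r a) / sinh (mori_r a) * jacobi_field a (mori_s0 a)
        = mori_K a / (prof a (mori_s0 a))\<^sup>2 * r'"
      by (rule jacobi_field_boundary_defect[OF a' _ _ s0[OF a] s0' r'(1)]) (use scaled_fb in auto)
    also have "\<dots> > 0"
      using mori_K_pos[OF a'(1)] prof_pos[OF a'(1), of "mori_s0 a"] r'(2)
      by (intro mult_pos_pos divide_pos_pos zero_less_power)
    finally have defect: "jacobi_field_s a (mori_s0 a) - cosh (mori_r a) / sinh (mori_r a) * jacobi_field a (mori_s0 a) \<noteq> 0"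
      by simp
    have "jacobi_kernel_0_ev a = {0}"
      using even_kernel_trivial[OF a'(1) s0[OF a] defect] zero_in_even_kernel[of a]
      unfolding zero_fun_def by blast
    then have "has_dimension (jacobi_kernel_0_ev a) 0"
      unfolding has_dimension_def
      by (intro exI[of _ "{}"]) (simp add: fun_space.independent_empty fun_space.span_empty)
    then show ?thesis
      using r' parametric_field_not_in_kernel[OF a'(1) s0[OF a] s0' defect] by blast
  qed
  ultimately show ?thesis
    using \<delta> by blast
qed

end
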